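(* Let $\Omega^{(2)}=\Omega^{(2)}(\tau_1,\tau_2,\epsilon)$, $(\tau_1,\tau_2,\epsilon)\in\mathcal{D}^\epsilon$, be the period matrix of the genus two Riemann surface obtained by sewing two tori. For $a=1,2$, $$\Omega^{(2)}_{aa}=\tau_a+\frac{\epsilon}{2\pi i}\,\omega_{aa},\qquad\Omega^{(2)}_{a\bar a}=-\frac{\epsilon}{2\pi i}\,\omega_{a\bar a},$$ where $\omega_{ab}$ is the sum of the weights of all isomorphism classes of chequered necklaces of type $ab$.
   Context: Convention: $\bar1=2$, $\bar2=1$. $\mathbb{H}_1$ is the upper half-plane. Modular notation: for $\tau\in\mathbb{H}_1$, $q=e^{2\pi i\tau}$: $E_k(\tau)=0$ for $k$ odd, and for even $k\ge2$, $E_k(\tau)=-\frac{B_k}{k!}+\frac{2}{(k-1)!}\sum_{n\ge1}\sigma_{k-1}(n)q^n$. For $k,l\ge1$, $C(k,l,\tau)=(-1)^{k+1}\frac{(k+l-1)!}{(k-1)!(l-1)!}E_{k+l}(\tau)$ and $A_a(k,l,\tau_a,\epsilon)=\frac{\epsilon^{(k+l)/2}}{\sqrt{kl}}C(k,l,\tau_a)$. Sewing: $\Lambda_\tau$ is the lattice with basis $(2\pi i\tau,2\pi i)$, $D(\Lambda)=\min_{0\ne\lambda\in\Lambda}|\lambda|$, and $\mathcal{D}^\epsilon=\{(\tau_1,\tau_2,\epsilon)\in\mathbb{H}_1\times\mathbb{H}_1\times\mathbb{C}\mid|\epsilon|<\frac14D(\Lambda_{\tau_1})D(\Lambda_{\tau_2})\}$.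 For $\mathcal{S}_a=\mathbb{C}/\Lambda_{\tau_a}$ with coordinate $z_a$ at the origin, $r_a<\frac12D(\Lambda_{\tau_a})$, $|\epsilon|\le r_1r_2$, excise $|z_a|\le|\epsilon|/r_{\bar a}$ and identify the annuli $|\epsilon|/r_{\bar a}\le|z_a|\le r_a$ via $z_1z_2=\epsilon$. The genus two surface has homology basis inherited from the tori ($a_a,b_a$ with periods $2\pi i$, $2\pi i\tau_a$ on $\mathcal{S}_a$), and $\Omega^{(2)}_{ij}=\frac1{2\pi i}\oint_{b_i}\nu_j$ with holomorphic 1-forms $\nu_j$ normalized by $\oint_{a_i}\nu_j=2\pi i\delta_{ij}$. Chequered necklaces: connected graphs with $n\ge2$ nodes, $n-2$ of valency 2 and two (the end nodes) of valency 1, with the edges oriented from left to right; nodes are labelled by positive integers and edges are labelled alternately by $1$ or $2$ along the graph. In addition there is the degenerate necklace $N_0$, a single node with no edges. The weight of an edge labelled $a$ going from a node labelled $k$ to a node labelled $l$ is $A_a(k,l,\tau_a,\epsilon)$; the weight $\omega(N)$ of a necklace is the product of the weights of its edges, and $\omega(N_0)=1$. A chequered necklace whose two end nodes are labelled $1$, whose leftmost edge is labelled $a$ and whose rightmost edge is labelled $b$, is said to be of type $\bar a\bar b$. The degenerate necklace $N_0$ (with node labelled $1$) is counted in both types $12$ and $21$. $\mathcal{N}_{ab}$ is the set of isomorphism classes of chequered necklaces of type $ab$, and $\omega_{ab}=\sum_{N\in\mathcal{N}_{ab}}\omega(N)$, understood as a power series in $\epsilon$. *)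

theory Defs
  imports
    "HOL-Complex_Analysis.Complex_Analysis"
    "HOL-Computational_Algebra.Formal_Power_Series"
begin

text \<open>The two tori are indexed by the two-element type \<open>2\<close> with elements \<open>1\<close> and \<open>2\<close>.\<close>

definition bar :: "2 \<Rightarrow> 2" where
  "bar a = (if a = 1 then 2 else 1)"

definition bernoulli :: "nat \<Rightarrow> real" where
  "bernoulli k = fact k * fps_nth (fps_X / (fps_exp 1 - 1)) k"

definition divisor_sum :: "nat \<Rightarrow> nat \<Rightarrow> nat" where
  "divisor_sum k n = (\<Sum>d | d dvd n. d ^ k)"

definition eisenstein :: "nat \<Rightarrow> complex \<Rightarrow> complex" where
  "eisenstein k \<tau> =
     (if odd k then 0
      else - of_real (bernoulli k) / fact k +
           2 / fact (k - 1) *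
           (\<Sum>n. of_nat (divisor_sum (k - 1) (Suc n)) * exp (2 * of_real pi * \<i> * \<tau>) ^ Suc n))"

definition moment_C :: "nat \<Rightarrow> nat \<Rightarrow> complex \<Rightarrow> complex" where
  "moment_C k l \<tau> =
     (- 1) ^ (k + 1) * (fact (k + l - 1) / (fact (k - 1) * fact (l - 1))) * eisenstein (k + l) \<tau>"

text \<open>
  The half-integral power \<open>\<epsilon>\<close> to the \<open>(k + l) / 2\<close> is read with the principal square root. In the
  weight of a necklace with both end nodes labelled \<open>1\<close> only integral powers survive (see
  \<open>weight_eq_power\<close> below), so the choice of the root is immaterial.
\<close>

definition moment_A :: "nat \<Rightarrow> nat \<Rightarrow> complex \<Rightarrow> complex \<Rightarrow> complex" where
  "moment_A k l \<tau> \<epsilon> = csqrt \<epsilon> ^ (k + l) / of_real (sqrt (real (k * l))) * moment_C k l \<tau>"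

definition upper_half_plane :: "complex set" where
  "upper_half_plane = {\<tau>. Im \<tau> > 0}"

definition period_lattice :: "complex \<Rightarrow> complex set" where
  "period_lattice \<tau> =
     {of_int m * (2 * of_real pi * \<i> * \<tau>) + of_int n * (2 * of_real pi * \<i>) | m n. True}"

definition min_length :: "complex \<Rightarrow> real" where
  "min_length \<tau> = Inf (norm ` (period_lattice \<tau> - {0}))"

definition sewing_domain :: "(complex \<times> complex \<times> complex) set" where
  "sewing_domain =
     {(\<tau>\<^sub>1, \<tau>\<^sub>2, \<epsilon>). \<tau>\<^sub>1 \<in> upper_half_plane \<and> \<tau>\<^sub>2 \<in> upper_half_plane \<and>
        norm \<epsilon> < 1 / 4 * min_length \<tau>\<^sub>1 * min_length \<tau>\<^sub>2}"

definition sewing_radii :: "(2 \<Rightarrow> complex) \<Rightarrow> complex \<Rightarrow> (2 \<Rightarrow> real) \<Rightarrow> bool" where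
  "sewing_radii \<tau> \<epsilon> r \<longleftrightarrow>
     (\<forall>a. 0 < r a \<and> r a < 1 / 2 * min_length (\<tau> a)) \<and> norm \<epsilon> \<le> r 1 * r 2"

text \<open>
  The preimage in the complex plane of the \<open>a\<close>-th torus with the disc about the origin removed.
  The bounding circle is kept: it belongs to the annulus that is identified with its counterpart
  on the other torus.
\<close>

definition excised_torus ::
    "(2 \<Rightarrow> complex) \<Rightarrow> complex \<Rightarrow> (2 \<Rightarrow> real) \<Rightarrow> 2 \<Rightarrow> complex set" where
  "excised_torus \<tau> \<epsilon> r a =
     {z. \<forall>w\<in>period_lattice (\<tau> a). norm \<epsilon> / r (bar a) \<le> norm (z - w)}"

definition sewing_annulus :: "complex \<Rightarrow> (2 \<Rightarrow> real) \<Rightarrow> 2 \<Rightarrow> complex set" where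
  "sewing_annulus \<epsilon> r a = {z. norm \<epsilon> / r (bar a) \<le> norm z \<and> norm z \<le> r a}"

text \<open>
  A holomorphic 1-form on the sewn surface is a pair of elliptic functions \<open>f 1\<close>, \<open>f 2\<close> on the
  excised tori such that \<open>f 1 z\<^sub>1 dz\<^sub>1\<close> and \<open>f 2 z\<^sub>2 dz\<^sub>2\<close> agree under the identification
  \<open>z\<^sub>1 z\<^sub>2 = \<epsilon>\<close>, where \<open>dz\<^sub>2 = - \<epsilon> / z\<^sub>1\<^sup>2 dz\<^sub>1\<close>. Since every point of a bounding circle is an interior
  point of the sewn surface, holomorphy there means that \<open>f a\<close> continues analytically across
  the circle, whence \<open>analytic_on\<close> rather than \<open>holomorphic_on\<close>.

  For \<open>\<epsilon> = 0\<close> the surface degenerates to the two full tori meeting in one point, and a 1-form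
  is a pair of holomorphic 1-forms on the tori: simple poles with opposite residues at the node
  are excluded by the residue theorem on each torus.
\<close>

definition sewn_one_form ::
    "(2 \<Rightarrow> complex) \<Rightarrow> complex \<Rightarrow> (2 \<Rightarrow> real) \<Rightarrow> (2 \<Rightarrow> complex \<Rightarrow> complex) \<Rightarrow> bool" where
  "sewn_one_form \<tau> \<epsilon> r f \<longleftrightarrow>
     (\<forall>a. f a analytic_on excised_torus \<tau> \<epsilon> r a \<and>
          (\<forall>z\<in>excised_torus \<tau> \<epsilon> r a. \<forall>w\<in>period_lattice (\<tau> a). f a (z + w) = f a z)) \<and>
     (\<epsilon> \<noteq> 0 \<longrightarrow>
        (\<forall>z\<^sub>1\<in>sewing_annulus \<epsilon> r 1. \<forall>z\<^sub>2\<in>sewing_annulus \<epsilon> r 2.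
           z\<^sub>1 * z\<^sub>2 = \<epsilon> \<longrightarrow> f 1 z\<^sub>1 = f 2 z\<^sub>2 * (- \<epsilon> / z\<^sub>1\<^sup>2)))"

text \<open>
  A lift to the plane of a closed curve on the \<open>a\<close>-th excised torus with the given period. On an
  excised torus the period determines the homology class, since the bounding circle is
  null-homologous.
\<close>

definition torus_cycle ::
    "(2 \<Rightarrow> complex) \<Rightarrow> complex \<Rightarrow> (2 \<Rightarrow> real) \<Rightarrow> 2 \<Rightarrow> complex \<Rightarrow> (real \<Rightarrow> complex) \<Rightarrow> bool" where
  "torus_cycle \<tau> \<epsilon> r a p \<gamma> \<longleftrightarrow>
     valid_path \<gamma> \<and> path_image \<gamma> \<subseteq> excised_torus \<tau> \<epsilon> r a \<and> pathfinish \<gamma> = pathstart \<gamma> + p"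

definition a_cycle ::
    "(2 \<Rightarrow> complex) \<Rightarrow> complex \<Rightarrow> (2 \<Rightarrow> real) \<Rightarrow> 2 \<Rightarrow> (real \<Rightarrow> complex) \<Rightarrow> bool" where
  "a_cycle \<tau> \<epsilon> r a \<gamma> \<longleftrightarrow> torus_cycle \<tau> \<epsilon> r a (2 * of_real pi * \<i>) \<gamma>"

definition b_cycle ::
    "(2 \<Rightarrow> complex) \<Rightarrow> complex \<Rightarrow> (2 \<Rightarrow> real) \<Rightarrow> 2 \<Rightarrow> (real \<Rightarrow> complex) \<Rightarrow> bool" where
  "b_cycle \<tau> \<epsilon> r a \<gamma> \<longleftrightarrow> torus_cycle \<tau> \<epsilon> r a (2 * of_real pi * \<i> * \<tau> a) \<gamma>"

text \<open>
  Here \<open>\<nu> j a\<close> is the coefficient of \<open>dz\<^sub>a\<close> in the \<open>j\<close>-th normalized 1-form, so the integral of that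
  form along a curve on the \<open>i\<close>-th torus is the integral of \<open>\<nu> j i\<close>.
\<close>

definition normalized_forms ::
    "(2 \<Rightarrow> complex) \<Rightarrow> complex \<Rightarrow> (2 \<Rightarrow> real) \<Rightarrow> (2 \<Rightarrow> real \<Rightarrow> complex) \<Rightarrow>
      (2 \<Rightarrow> 2 \<Rightarrow> complex \<Rightarrow> complex) \<Rightarrow> bool" where
  "normalized_forms \<tau> \<epsilon> r \<alpha> \<nu> \<longleftrightarrow>
     (\<forall>j. sewn_one_form \<tau> \<epsilon> r (\<nu> j)) \<and>
     (\<forall>i j. contour_integral (\<alpha> i) (\<nu> j i) = (if i = j then 2 * of_real pi * \<i> else 0))"

definition is_period_matrix ::
    "(2 \<Rightarrow> complex) \<Rightarrow> complex \<Rightarrow> (2 \<Rightarrow> real) \<Rightarrow> complex ^ 2 ^ 2 \<Rightarrow> bool" where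
  "is_period_matrix \<tau> \<epsilon> r \<Omega> \<longleftrightarrow>
     (\<exists>\<alpha> \<beta> \<nu>. (\<forall>i. a_cycle \<tau> \<epsilon> r i (\<alpha> i) \<and> b_cycle \<tau> \<epsilon> r i (\<beta> i)) \<and>
        normalized_forms \<tau> \<epsilon> r \<alpha> \<nu> \<and>
        (\<forall>i j. \<Omega> $ i $ j = 1 / (2 * of_real pi * \<i>) * contour_integral (\<beta> i) (\<nu> j i)))"

text \<open>
  An oriented path graph with labelled nodes and edges has no automorphisms, and its isomorphism
  class is given by its labels read from left to right. The \<open>i\<close>-th edge runs from the \<open>i\<close>-th to
  the \<open>(i + 1)\<close>-st node.
\<close>

datatype necklace = Necklace (node_labels: "nat list") (edge_labels: "2 list")

definition chequered :: "necklace \<Rightarrow> bool" where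
  "chequered N \<longleftrightarrow>
     length (node_labels N) = Suc (length (edge_labels N)) \<and>
     (\<forall>k\<in>set (node_labels N). 0 < k) \<and>
     (\<forall>i. Suc i < length (edge_labels N) \<longrightarrow> edge_labels N ! Suc i = bar (edge_labels N ! i))"

text \<open>
  Type \<open>ab\<close> means that the outermost edges are labelled \<open>bar a\<close> (left) and \<open>bar b\<close> (right). The
  degenerate necklace, which has no edges, is of types \<open>12\<close> and \<open>21\<close>.
\<close>

definition necklaces :: "2 \<Rightarrow> 2 \<Rightarrow> necklace set" where
  "necklaces a b =
     {N. chequered N \<and> hd (node_labels N) = 1 \<and> last (node_labels N) = 1 \<and>
         (if edge_labels N = [] then a \<noteq> b
          else hd (edge_labels N) = bar a \<and> last (edge_labels N) = bar b)}"

definition weight :: "(2 \<Rightarrow> complex) \<Rightarrow> complex \<Rightarrow> necklace \<Rightarrow> complex" where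
  "weight \<tau> \<epsilon> N =
     (\<Prod>i<length (edge_labels N).
        moment_A (node_labels N ! i) (node_labels N ! Suc i) (\<tau> (edge_labels N ! i)) \<epsilon>)"

text \<open>The exponent of \<open>\<epsilon>\<close> in the weight of a necklace whose end nodes are labelled \<open>1\<close>.\<close>

definition degree_of :: "necklace \<Rightarrow> nat" where
  "degree_of N =
     (\<Sum>i<length (edge_labels N). node_labels N ! i + node_labels N ! Suc i) div 2"

text \<open>
  The sum of the weights is a power series in \<open>\<epsilon>\<close>: its term of degree \<open>n\<close> is the sum of the weights
  of the finitely many necklaces of degree \<open>n\<close>.
\<close>

definition omega_term :: "(2 \<Rightarrow> complex) \<Rightarrow> complex \<Rightarrow> 2 \<Rightarrow> 2 \<Rightarrow> nat \<Rightarrow> complex" where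
  "omega_term \<tau> \<epsilon> a b n = (\<Sum>N | N \<in> necklaces a b \<and> degree_of N = n. weight \<tau> \<epsilon> N)"

definition omega :: "(2 \<Rightarrow> complex) \<Rightarrow> complex \<Rightarrow> 2 \<Rightarrow> 2 \<Rightarrow> complex" where
  "omega \<tau> \<epsilon> a b = (\<Sum>n. omega_term \<tau> \<epsilon> a b n)"

lemma finite_necklaces_degree: "finite {N \<in> necklaces a b. degree_of N = n}"
proof -
  let ?m = "2 * n + 1"
  let ?K = "{ks. set ks \<subseteq> {..?m} \<and> length ks \<le> ?m + 1}"
  let ?E = "{es :: 2 list. set es \<subseteq> UNIV \<and> length es \<le> ?m}"
  have "{N \<in> necklaces a b. degree_of N = n} \<subseteq> case_prod Necklace ` (?K \<times> ?E)"
  proof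
    fix N assume "N \<in> {N \<in> necklaces a b. degree_of N = n}"
    then have N: "chequered N" "hd (node_labels N) = 1" "degree_of N = n"
      by (auto simp: necklaces_def)
    obtain ks es where Nk: "N = Necklace ks es" by (cases N)
    have len: "length ks = Suc (length es)" and pos: "\<And>i. i < length ks \<Longrightarrow> 0 < ks ! i"
      using N(1) by (auto simp: chequered_def Nk)
    let ?s = "\<lambda>i. ks ! i + ks ! Suc i"
    have S: "(\<Sum>i<length es. ?s i) \<le> ?m"
      using N(3) by (simp add: degree_of_def Nk)
    have "(\<Sum>i<length es. 1) \<le> (\<Sum>i<length es. ?s i)"
      using pos len by (intro sum_mono) (simp add: Suc_le_eq)
    then have les: "length es \<le> ?m" using S by simp
    have step: "?s i \<le> ?m" if "i < length es" for i
      using member_le_sum[of i "{..<length es}" ?s] that S by simp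
    have "ks ! i \<le> ?m" if "i < length ks" for i
    proof (cases i)
      case 0
      have "ks ! 0 = 1" using N(2) len by (cases ks) (auto simp: Nk)
      then show ?thesis using 0 by simp
    next
      case (Suc j)
      then show ?thesis using step[of j] that len by simp
    qed
    then have "set ks \<subseteq> {..?m}" by (auto simp: in_set_conv_nth)
    then show "N \<in> case_prod Necklace ` (?K \<times> ?E)"
      using les len by (auto simp: Nk image_iff)
  qed
  moreover have "finite (?K \<times> ?E)"
    by (intro finite_cartesian_product finite_lists_length_le) auto
  ultimately show ?thesis by (meson finite_imageI finite_subset)
qed

lemma weight_eq_power:
  assumes "N \<in> necklaces a b"
  shows "weight \<tau> \<epsilon> N = weight \<tau> 1 N * \<epsilon> ^ degree_of N"
proof -
  obtain ks es where Nk: "N = Necklace ks es" by (cases N)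
  let ?S = "\<Sum>i<length es. ks ! i + ks ! Suc i"
  have len: "length ks = Suc (length es)" and ends: "hd ks = 1" "last ks = 1"
    using assms by (auto simp: necklaces_def chequered_def Nk)
  have tel: "(\<Sum>i<m. ks ! i + ks ! Suc i) + ks ! 0 + ks ! m = 2 * (\<Sum>i\<le>m. ks ! i)" for m
    by (induction m) simp_all
  have "ks \<noteq> []" using len by auto
  then have "ks ! 0 = 1" "ks ! length es = 1"
    using len ends by (simp_all add: hd_conv_nth last_conv_nth)
  then have "?S + 2 = 2 * (\<Sum>i\<le>length es. ks ! i)"
    using tel[of "length es"] by simp
  then have "even ?S" by presburger
  then have S: "2 * degree_of N = ?S" by (simp add: degree_of_def Nk)
  have "weight \<tau> \<epsilon> N = weight \<tau> 1 N * (\<Prod>i<length es. csqrt \<epsilon> ^ (ks ! i + ks ! Suc i))"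
    unfolding weight_def Nk necklace.sel moment_A_def prod.distrib[symmetric]
    by (intro prod.cong refl) simp
  also have "(\<Prod>i<length es. csqrt \<epsilon> ^ (ks ! i + ks ! Suc i)) = csqrt \<epsilon> ^ ?S"
    by (simp add: power_sum)
  also have "\<dots> = \<epsilon> ^ degree_of N"
    unfolding S[symmetric] by (simp add: power_mult)
  finally show ?thesis .
qed

end

theory Submission
  imports Defs
begin

text \<open>
  On each torus, Liouville's theorem determines a holomorphic 1-form of the sewn surface by its
  \<open>a\<close>-period and its negative Laurent coefficients at the origin; its Taylor coefficients are then
  linear in these data, with the moments \<open>C(k, l, \<tau>\<^sub>a)\<close> as coefficients. The gluing \<open>z\<^sub>1 z\<^sub>2 = \<epsilon>\<close>
  expresses the negative coefficients on one torus by the nonnegative ones on the other, so the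
  latter solve \<open>y\<^sub>a = u\<^sub>a - B\<^sub>a y\<^bsub>bar a\<^esub>\<close>, and iteration gives a Neumann series whose first entry
  sums the weights of the chequered necklaces. The series converges on the whole sewing domain
  because a disc of radius below \<open>D(\<Lambda>) / 2\<close> embeds in the torus: the area of the complement being
  nonnegative, the suitably rescaled moment matrix is a contraction of \<open>\<ell>\<^sup>2\<close> (Grunsky's inequality).
  Finite truncations are polynomials in \<open>\<epsilon>\<close> with a uniform bound, and Cauchy's estimates turn this
  into convergence of the power series in \<open>\<epsilon>\<close>.
\<close>

text \<open>The domain reaches up to \<open>norm \<epsilon> < D 1 * D 2 / 4\<close>, where
  \<open>D a\<close> is the minimal length of the lattice of torus \<open>a\<close>, and this shapes
  the convergence proof. What is available up to the radii \<open>D a / 2\<close> is an operator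
  bound for the moment matrices, and such a bound does not control the sum of the absolute values of
  the weights. The sum over necklaces is therefore never rearranged absolutely. Labels and number of
  edges are both cut off at \<open>M\<close>; the finite set obtained contains every necklace of
  degree below \<open>M\<close>, and a bound on a circle around 0, uniform in \<open>M\<close>,
  controls each power of \<epsilon> separately. The radii \<open>R a\<close> lie strictly between
  \<open>r a\<close> and \<open>D a / 2\<close>. Scaling by them gives moment matrices of norm at
  most one and leaves a factor \<open>\<epsilon> / (R 1 * R 2)\<close> on each edge, so the
  smallness required is exactly \<open>norm \<epsilon> < R 1 * R 2\<close>. The area argument meets
  one obstruction: no elliptic function has a single simple pole modulo the lattice. A function with
  principal part \<open>1 / z\<close> is only quasi-periodic, and a multiple of \<open>Re z\<close>
  absorbs its increments.\<close>

section \<open>Planar Lebesgue measure: rotations and area integrals over discs\<close>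

lemma lborel_translate:
  fixes c :: "'a::euclidean_space"
  assumes [measurable]: "f \<in> borel_measurable borel"
  shows "(\<integral>\<^sup>+x. f (x + c) \<partial>lborel) = (\<integral>\<^sup>+x. f x \<partial>lborel)"
proof -
  have "(\<integral>\<^sup>+x. f x \<partial>lborel) = (\<integral>\<^sup>+x. f x \<partial>distr lborel borel ((+) c))"
    by (simp add: lborel_distr_plus)
  also have "\<dots> = (\<integral>\<^sup>+x. f (x + c) \<partial>lborel)"
    by (subst nn_integral_distr) (auto simp: add.commute)
  finally show ?thesis ..
qed

lemma lborel_reflect:
  assumes [measurable]: "f \<in> borel_measurable borel"
  shows "(\<integral>\<^sup>+x. f (- x) \<partial>lborel) = (\<integral>\<^sup>+x. f x \<partial>(lborel :: 'a::euclidean_space measure))"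
proof -
  have *: "lborel = distr lborel borel (\<lambda>x::'a. - x)"
    using lborel_affine[of "-1" "0::'a"] by (simp add: density_1 flip: ennreal_power)
  have "(\<integral>\<^sup>+x. f x \<partial>lborel) = (\<integral>\<^sup>+x. f x \<partial>distr lborel borel (\<lambda>x::'a. - x))"
    using * by simp
  also have "\<dots> = (\<integral>\<^sup>+x. f (- x) \<partial>lborel)"
    by (subst nn_integral_distr) auto
  finally show ?thesis ..
qed

text \<open>Uniqueness of Haar measure, tested against the unit disc, which a rotation preserves.\<close>

lemma lborel_rotate:
  fixes c :: complex and f :: "complex \<Rightarrow> ennreal"
  assumes c: "norm c = 1" and f[measurable]: "f \<in> borel_measurable borel"
  shows "(\<integral>\<^sup>+z. f (c * z) \<partial>lborel) = (\<integral>\<^sup>+z. f z \<partial>lborel)"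
proof -
  let ?B = "cball (0::complex) 1"
  have c0: "c \<noteq> 0" using c by auto
  define M where "M f = (\<integral>\<^sup>+z. f (c * z) \<partial>lborel)" for f :: "complex \<Rightarrow> ennreal"
  define N where "N f = (\<integral>\<^sup>+z. f z \<partial>lborel)" for f :: "complex \<Rightarrow> ennreal"
  have Mtr: "M (\<lambda>z. g (z + w)) = M g" if [measurable]: "g \<in> borel_measurable borel" for g w
  proof -
    have "M (\<lambda>z. g (z + w)) = (\<integral>\<^sup>+z. g (c * (z + w / c)) \<partial>lborel)"
      unfolding M_def using c0 by (simp add: distrib_left)
    also have "\<dots> = M g"
      unfolding M_def by (rule lborel_translate[where f = "\<lambda>z. g (c * z)"]) simp
    finally show ?thesis .
  qed
  \<comment> \<open>In the double integral of \<open>f (c * z) * g (c * z + y)\<close> translation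
    invariance of \<open>M\<close> moves the shift \<open>y\<close> from \<open>g\<close> to
    \<open>f\<close>. Integrating over \<open>y\<close> first then separates the factors again, with
    the roles of \<open>M\<close> and \<open>N\<close> exchanged.\<close>
  have key: "M f * N g = M g * N f" if [measurable]: "g \<in> borel_measurable borel" for g
  proof -
    have "M f * N g = (\<integral>\<^sup>+z. f (c * z) * N g \<partial>lborel)"
      unfolding M_def by (subst nn_integral_multc) auto
    also have "\<dots> = (\<integral>\<^sup>+z. \<integral>\<^sup>+y. f (c * z) * g (c * z + y) \<partial>lborel \<partial>lborel)"
    proof (intro nn_integral_cong)
      fix z
      have "N g = (\<integral>\<^sup>+y. g (c * z + y) \<partial>lborel)"
        unfolding N_def using lborel_translate[of g "c * z"] by (simp add: add.commute)
      then show "f (c * z) * N g = (\<integral>\<^sup>+y. f (c * z) * g (c * z + y) \<partial>lborel)"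
        by (simp add: nn_integral_cmult)
    qed
    also have "\<dots> = (\<integral>\<^sup>+y. \<integral>\<^sup>+z. f (c * z) * g (c * z + y) \<partial>lborel \<partial>lborel)"
      by (rule lborel_pair.Fubini') measurable
    also have "\<dots> = (\<integral>\<^sup>+y. M (\<lambda>z. f (z + - y) * g z) \<partial>lborel)"
    proof (intro nn_integral_cong)
      fix y
      show "(\<integral>\<^sup>+z. f (c * z) * g (c * z + y) \<partial>lborel) = M (\<lambda>z. f (z + - y) * g z)"
        using Mtr[of "\<lambda>z. f (z + - y) * g z" y] by (simp add: M_def)
    qed
    also have "\<dots> = (\<integral>\<^sup>+z. \<integral>\<^sup>+y. f (c * z + - y) * g (c * z) \<partial>lborel \<partial>lborel)"
      unfolding M_def by (rule lborel_pair.Fubini') measurable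
    also have "\<dots> = (\<integral>\<^sup>+z. N f * g (c * z) \<partial>lborel)"
    proof (intro nn_integral_cong)
      fix z
      have "(\<integral>\<^sup>+y. f (c * z + - y) \<partial>lborel) = (\<integral>\<^sup>+y. f (c * z + y) \<partial>lborel)"
        using lborel_reflect[of "\<lambda>y. f (c * z + y)"] by simp
      also have "\<dots> = N f"
        unfolding N_def using lborel_translate[of f "c * z"] by (simp add: add.commute)
      finally show "(\<integral>\<^sup>+y. f (c * z + - y) * g (c * z) \<partial>lborel) = N f * g (c * z)"
        by (subst nn_integral_multc) auto
    qed
    also have "\<dots> = M g * N f"
      unfolding M_def by (subst nn_integral_cmult) (auto simp: mult.commute)
    finally show ?thesis .
  qed
  have ind: "indicator ?B (c * z) = (indicator ?B z :: ennreal)" for z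
    using c by (auto simp: indicator_def norm_mult)
  have "M f * N (indicator ?B) = M (indicator ?B) * N f"
    by (rule key) (rule borel_measurable_indicator, simp)
  moreover have "M (indicator ?B) = N (indicator ?B)"
    by (simp add: M_def N_def ind)
  moreover have "N (indicator ?B) = ennreal pi"
    by (simp add: N_def emeasure_cball unit_ball_vol_2)
  ultimately have "ennreal pi * M f = ennreal pi * N f"
    by (simp add: mult.commute)
  then have "M f = N f"
    by (simp add: ennreal_mult_cancel_left)
  then show ?thesis by (simp add: M_def N_def)
qed

text \<open>Under the squared modulus the area of the disc becomes \<pi> times length on
  \<open>{0..R\<^sup>2}\<close>, because a disc of squared radius \<open>x\<close> has area \<pi>
  times \<open>x\<close>. Comparing the tails \<open>{x<..}\<close> identifies the two measures, and
  a one-dimensional power remains to be integrated; this replaces polar coordinates.\<close>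

lemma integral_cball_norm_power:
  assumes R: "R \<ge> 0"
  shows "(\<integral>\<^sup>+z. indicator (cball 0 R) z * ennreal (norm z ^ (2 * n)) \<partial>(lborel :: complex measure)) =
    ennreal (pi * R ^ (2 * n + 2) / (n + 1))"
proof -
  define M where "M = distr (density lborel (indicator (cball (0::complex) R))) borel (\<lambda>z. (norm z)\<^sup>2)"
  define N where "N = density lborel (\<lambda>x::real. ennreal pi * indicator {0..R\<^sup>2} x)"
  have circ: "emeasure lborel (cball (0::complex) s) = ennreal (pi * s\<^sup>2)" if "s \<ge> 0" for s
    using that by (simp add: emeasure_cball unit_ball_vol_2)
  have MM: "emeasure M {x<..} = ennreal (if x < 0 then pi * R\<^sup>2 else if x > R\<^sup>2 then 0 else pi * (R\<^sup>2 - x))" for x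
  proof -
    have "emeasure M {x<..} = emeasure lborel ({z. x < (norm z)\<^sup>2} \<inter> cball (0::complex) R)"
      unfolding M_def
      by (subst emeasure_distr, simp, simp, subst emeasure_density)
         (auto intro!: borel_measurable_indicator simp: vimage_def indicator_inter_arith[symmetric] Int_commute)
    also have "\<dots> = ennreal (if x < 0 then pi * R\<^sup>2 else if x > R\<^sup>2 then 0 else pi * (R\<^sup>2 - x))"
    proof -
      consider "x < 0" | "x > R\<^sup>2" "x \<ge> 0" | "0 \<le> x" "x \<le> R\<^sup>2" by linarith
      then show ?thesis
      proof cases
        case 1
        then have "{z. x < (norm z)\<^sup>2} \<inter> cball (0::complex) R = cball 0 R"
          by (auto intro: less_le_trans)
        then show ?thesis using 1 R circ by simp
      next
        case 2
        have "\<not> x < (norm z)\<^sup>2" if "norm z \<le> R" for z :: complex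
          using 2 power_mono[OF that, of 2] by simp
        then have "{z. x < (norm z)\<^sup>2} \<inter> cball (0::complex) R = {}" by auto
        then show ?thesis using 2 by simp
      next
        case 3
        have eq: "{z. x < (norm z)\<^sup>2} \<inter> cball (0::complex) R = cball 0 R - cball 0 (sqrt x)"
        proof (intro set_eqI)
          fix z :: complex
          have "x < (norm z)\<^sup>2 \<longleftrightarrow> sqrt x < norm z"
            using real_sqrt_less_iff[of x "(norm z)\<^sup>2"] by simp
          then show "z \<in> {z. x < (norm z)\<^sup>2} \<inter> cball 0 R \<longleftrightarrow> z \<in> cball 0 R - cball 0 (sqrt x)"
            by (simp add: not_le conj_commute)
        qed
        have sub: "cball 0 (sqrt x) \<subseteq> cball (0::complex) R"
          using 3 R real_sqrt_le_mono[of x "R\<^sup>2"] by auto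
        have "emeasure lborel (cball 0 R - cball 0 (sqrt x) :: complex set) =
          ennreal (pi * R\<^sup>2) - ennreal (pi * x)"
          using 3 R by (subst emeasure_Diff[OF _ _ _ sub]) (auto simp: circ)
        also have "\<dots> = ennreal (pi * (R\<^sup>2 - x))"
          using 3 by (simp add: ennreal_minus right_diff_distrib)
        finally show ?thesis using 3 eq by simp
      qed
    qed
    finally show ?thesis .
  qed
  have NN: "emeasure N {x<..} = ennreal (if x < 0 then pi * R\<^sup>2 else if x > R\<^sup>2 then 0 else pi * (R\<^sup>2 - x))" for x
  proof -
    have "emeasure N {x<..} = (\<integral>\<^sup>+y. ennreal pi * (indicator ({0..R\<^sup>2} \<inter> {x<..}) y) \<partial>lborel)"
      unfolding N_def by (subst emeasure_density) (auto simp: indicator_inter_arith mult.assoc)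
    also have "\<dots> = ennreal pi * emeasure lborel ({0..R\<^sup>2} \<inter> {x<..})"
      by (subst nn_integral_cmult_indicator) auto
    also have "\<dots> = ennreal (if x < 0 then pi * R\<^sup>2 else if x > R\<^sup>2 then 0 else pi * (R\<^sup>2 - x))"
    proof -
      consider "x < 0" | "x > R\<^sup>2" "x \<ge> 0" | "0 \<le> x" "x \<le> R\<^sup>2" by linarith
      then show ?thesis
      proof cases
        case 1
        then have "{0..R\<^sup>2} \<inter> {x<..} = {0..R\<^sup>2}" by auto
        then show ?thesis using 1 by (simp add: ennreal_mult)
      next
        case 2
        then have "{0..R\<^sup>2} \<inter> {x<..} = {}" by auto
        then show ?thesis using 2 by (metis emeasure_empty ennreal_0 mult_zero_right not_le)
      next
        case 3
        then have "{0..R\<^sup>2} \<inter> {x<..} = {x<..R\<^sup>2}" by auto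
        then show ?thesis using 3 by (simp add: ennreal_mult)
      qed
    qed
    finally show ?thesis .
  qed
  have "M = N"
    by (rule measure_eqI_lessThan) (auto simp: MM NN, auto simp: M_def N_def)
  have "(\<integral>\<^sup>+z. indicator (cball 0 R) z * ennreal (norm z ^ (2 * n)) \<partial>(lborel :: complex measure)) =
     (\<integral>\<^sup>+x. ennreal (x ^ n) \<partial>M)"
    unfolding M_def
    by (subst nn_integral_distr, simp, simp, subst nn_integral_density)
       (auto simp: power_mult intro!: borel_measurable_indicator)
  also have "\<dots> = (\<integral>\<^sup>+x. ennreal pi * (ennreal (x ^ n) * indicator {0..R\<^sup>2} x) \<partial>lborel)"
    unfolding \<open>M = N\<close> N_def by (subst nn_integral_density) (auto simp: mult_ac)
  also have "\<dots> = ennreal pi * (\<integral>\<^sup>+x. ennreal (x ^ n) * indicator {0..R\<^sup>2} x \<partial>lborel)"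
    by (subst nn_integral_cmult) auto
  also have "(\<integral>\<^sup>+x. ennreal (x ^ n) * indicator {0..R\<^sup>2} x \<partial>lborel) =
      ennreal ((R\<^sup>2) ^ Suc n / Suc n - 0 ^ Suc n / Suc n)"
    by (rule nn_integral_FTC_Icc) (auto intro!: derivative_eq_intros simp del: power_Suc)
  also have "(R\<^sup>2) ^ Suc n = R ^ (2 * n + 2)"
    using power_mult[of R 2 "Suc n"] by simp
  also have "ennreal pi * ennreal (R ^ (2 * n + 2) / Suc n - 0 ^ Suc n / Suc n) = ennreal (pi * R ^ (2 * n + 2) / (n + 1))"
    by (subst ennreal_mult'[symmetric]) (simp_all add: add.commute)
  finally show ?thesis .
qed

lemma distr_lborel_rotate:
  fixes c :: complex
  assumes "norm c = 1"
  shows "distr lborel borel ((*) c) = lborel"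
proof (rule measure_eqI)
  fix A assume "A \<in> sets (distr lborel borel ((*) c))"
  then have A[measurable]: "A \<in> sets borel" by simp
  have "emeasure (distr lborel borel ((*) c)) A = emeasure lborel ((*) c -` A)"
    by (subst emeasure_distr) auto
  also have "\<dots> = (\<integral>\<^sup>+z. indicator ((*) c -` A) z \<partial>lborel)"
    by (rule nn_integral_indicator[symmetric]) (use measurable_sets_borel[of "(*) c" borel A] in simp)
  also have "\<dots> = (\<integral>\<^sup>+z. indicator A (c * z) \<partial>lborel)"
    by (intro nn_integral_cong) (auto simp: indicator_def)
  also have "\<dots> = emeasure lborel A"
    by (subst lborel_rotate[OF assms]) auto
  finally show "emeasure (distr lborel borel ((*) c)) A = emeasure lborel A" .
qed simp

text \<open>Rotation by the angle \<open>pi / (j - k)\<close> preserves the disc and the measure but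
  multiplies the integrand by \<open>cis pi = -1\<close>, so the integral equals its own
  negative.\<close>

lemma integral_cball_orthogonal:
  assumes "j \<noteq> k"
  shows "(\<integral>z. indicator (cball 0 R) z *\<^sub>R (z ^ j * cnj z ^ k) \<partial>lborel) = (0::complex)"
proof -
  define h where "h = (\<lambda>z. indicator (cball 0 R) z *\<^sub>R (z ^ j * cnj z ^ k))"
  have [measurable]: "h \<in> borel_measurable borel"
    unfolding h_def
    by (rule borel_measurable_scaleR[OF borel_measurable_indicator borel_measurable_continuous_onI])
       (auto intro!: continuous_intros)
  define t where "t = pi / (real j - real k)"
  define c where "c = cis t"
  have nc: "norm c = 1" by (simp add: c_def)
  define w where "w = c ^ j * cnj c ^ k"
  have "(\<integral>z. h z \<partial>lborel) = (\<integral>z. h z \<partial>distr lborel borel ((*) c))"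
    by (simp add: distr_lborel_rotate nc)
  also have "\<dots> = (\<integral>z. h (c * z) \<partial>lborel)"
    by (subst integral_distr) auto
  also have "\<dots> = (\<integral>z. w * h z \<partial>lborel)"
    by (intro Bochner_Integration.integral_cong refl)
       (simp add: h_def w_def indicator_def norm_mult nc power_mult_distrib)
  also have "\<dots> = w * (\<integral>z. h z \<partial>lborel)" by simp
  finally have *: "(1 - w) * (\<integral>z. h z \<partial>lborel) = 0" by (simp add: algebra_simps)
  have "w = cis (real j * t + - (real k * t))"
    unfolding w_def c_def cis_cnj by (simp add: Complex.DeMoivre cis_mult)
  also have "real j * t + - (real k * t) = (real j - real k) * t"
    by (simp add: left_diff_distrib)
  also have "\<dots> = pi"
    using assms by (simp add: t_def)
  finally have "w = -1" by simp
  then show ?thesis using * by (simp add: h_def)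
qed

lemma integrable_cball:
  fixes f :: "complex \<Rightarrow> 'a::{banach,second_countable_topology}"
  assumes "continuous_on (cball 0 R) f"
  shows "integrable lborel (\<lambda>z. indicator (cball 0 R) z *\<^sub>R f z)"
  using borel_integrable_compact[OF compact_cball assms] by simp

lemma integral_cball_polynomial:
  fixes d :: "nat \<Rightarrow> complex"
  assumes R: "R \<ge> 0"
  shows "(\<integral>z. indicator (cball 0 R) z *\<^sub>R (norm (\<Sum>j<n. d j * z ^ j))\<^sup>2 \<partial>lborel) =
    (\<Sum>j<n. (norm (d j))\<^sup>2 * (pi * R ^ (2 * j + 2) / (j + 1)))"
proof -
  let ?i = "\<lambda>z. indicator (cball (0::complex) R) z :: real"
  let ?m = "\<lambda>j. pi * R ^ (2 * j + 2) / (real j + 1)"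
  have diag: "(\<integral>z. ?i z *\<^sub>R (z ^ j * cnj z ^ j) \<partial>lborel) = of_real (?m j)" for j
  proof -
    have "(\<integral>z. ?i z * norm z ^ (2 * j) \<partial>lborel) = ?m j"
    proof (rule integral_eq_nn_integral[THEN trans])
      have "integrable lborel (\<lambda>z. ?i z *\<^sub>R norm z ^ (2 * j))"
        by (intro integrable_cball continuous_intros)
      then show "(\<lambda>z. ?i z * norm z ^ (2 * j)) \<in> borel_measurable lborel" by auto
      have "(\<integral>\<^sup>+z. ennreal (?i z * norm z ^ (2 * j)) \<partial>lborel) =
         (\<integral>\<^sup>+z. indicator (cball 0 R) z * ennreal (norm z ^ (2 * j)) \<partial>(lborel :: complex measure))"
        by (intro nn_integral_cong) (auto simp: indicator_def)
      then show "enn2real (\<integral>\<^sup>+z. ennreal (?i z * norm z ^ (2 * j)) \<partial>lborel) = ?m j"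
        using R by (simp add: integral_cball_norm_power add.commute)
    qed (use R in auto)
    moreover have "?i z *\<^sub>R (z ^ j * cnj z ^ j) = of_real (?i z * norm z ^ (2 * j))" for z
      by (simp add: scaleR_conv_of_real power_mult flip: power_mult_distrib complex_norm_square)
    ultimately show ?thesis by (simp only: integral_complex_of_real)
  qed
  have int: "integrable lborel (\<lambda>z. ?i z *\<^sub>R (c * (z ^ j * cnj z ^ k)))" for c j k
    by (intro integrable_cball continuous_intros)
  have "of_real (\<integral>z. ?i z *\<^sub>R (norm (\<Sum>j<n. d j * z ^ j))\<^sup>2 \<partial>lborel) =
     (\<integral>z. complex_of_real (?i z *\<^sub>R (norm (\<Sum>j<n. d j * z ^ j))\<^sup>2) \<partial>lborel)"
    by (rule integral_complex_of_real[symmetric])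
  also have "\<dots> = (\<integral>z. (\<Sum>j<n. \<Sum>k<n. ?i z *\<^sub>R (d j * cnj (d k) * (z ^ j * cnj z ^ k))) \<partial>lborel)"
  proof (intro Bochner_Integration.integral_cong refl)
    fix z
    have "complex_of_real ((norm (\<Sum>j<n. d j * z ^ j))\<^sup>2) = (\<Sum>j<n. d j * z ^ j) * (\<Sum>k<n. cnj (d k) * cnj z ^ k)"
      by (simp add: complex_norm_square del: of_real_power)
    also have "\<dots> = (\<Sum>j<n. \<Sum>k<n. d j * cnj (d k) * (z ^ j * cnj z ^ k))"
      by (simp add: sum_product algebra_simps)
    finally show "complex_of_real (?i z *\<^sub>R (norm (\<Sum>j<n. d j * z ^ j))\<^sup>2) =
       (\<Sum>j<n. \<Sum>k<n. ?i z *\<^sub>R (d j * cnj (d k) * (z ^ j * cnj z ^ k)))"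
      by (simp add: scaleR_conv_of_real flip: sum_distrib_left)
  qed
  also have "\<dots> = (\<Sum>j<n. \<Sum>k<n. \<integral>z. ?i z *\<^sub>R (d j * cnj (d k) * (z ^ j * cnj z ^ k)) \<partial>lborel)"
    by (simp only: Bochner_Integration.integral_sum Bochner_Integration.integrable_sum int)
  also have "\<dots> = (\<Sum>j<n. \<Sum>k<n. if j = k then of_real ((norm (d j))\<^sup>2 * ?m j) else 0)"
  proof (intro sum.cong refl)
    fix j k
    have "(\<integral>z. ?i z *\<^sub>R (d j * cnj (d k) * (z ^ j * cnj z ^ k)) \<partial>lborel) =
      d j * cnj (d k) * (\<integral>z. ?i z *\<^sub>R (z ^ j * cnj z ^ k) \<partial>lborel)"
      by (simp flip: mult_scaleR_right)
    then show "(\<integral>z. ?i z *\<^sub>R (d j * cnj (d k) * (z ^ j * cnj z ^ k)) \<partial>lborel) =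
      (if j = k then of_real ((norm (d j))\<^sup>2 * ?m j) else 0)"
      using diag[of j] integral_cball_orthogonal[of j k R]
      by (cases "j = k") (simp_all only: if_True if_False of_real_mult complex_norm_square mult_zero_right refl simp_thms)
  qed
  also have "\<dots> = of_real (\<Sum>j<n. (norm (d j))\<^sup>2 * ?m j)"
    by (simp add: sum.delta')
  finally show ?thesis unfolding of_real_eq_iff by (simp add: add.commute)
qed

text \<open>The Taylor series converges at \<open>(R + D) / 2\<close>, hence absolutely at
  \<open>R\<close>, and its absolute sum \<open>W\<close> there dominates all Taylor polynomials on
  the closed disc. Their area integrals increase to that of \<open>g\<close>, so each partial sum
  stays below the limit.\<close>

lemma integral_cball_holomorphic_ge:
  assumes R: "0 \<le> R" "R < D" and g: "g holomorphic_on ball 0 D"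
  shows "(\<Sum>j<n. (norm ((deriv ^^ j) g 0 / fact j))\<^sup>2 * (pi * R ^ (2 * j + 2) / (j + 1))) \<le>
    (\<integral>z. indicator (cball 0 R) z *\<^sub>R (norm (g z))\<^sup>2 \<partial>lborel)"
proof -
  define d where "d j = (deriv ^^ j) g 0 / fact j" for j
  let ?i = "\<lambda>z. indicator (cball (0::complex) R) z :: real"
  have sums: "(\<lambda>j. d j * z ^ j) sums g z" if "norm z < D" for z
    using holomorphic_power_series[OF g, of z] that by (simp add: d_def)
  have sm: "summable (\<lambda>j. norm (d j) * R ^ j)"
  proof -
    have "summable (\<lambda>j. d j * (of_real ((R + D) / 2) :: complex) ^ j)"
      using sums[of "of_real ((R + D) / 2)"] R unfolding norm_of_real by (simp add: sums_iff)
    then have "summable (\<lambda>j. norm (d j * of_real R ^ j))"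
      by (rule powser_insidea) (unfold norm_of_real, use R in auto)
    then show ?thesis using R by (simp add: norm_mult norm_power)
  qed
  define W where "W = (\<Sum>j. norm (d j) * R ^ j)"
  have gc: "continuous_on (cball 0 R) g"
    by (rule holomorphic_on_imp_continuous_on[OF holomorphic_on_subset[OF g]]) (use R in auto)
  have bound: "norm (\<Sum>j<m. d j * z ^ j) \<le> W" if "norm z \<le> R" for z m
  proof -
    have "norm (\<Sum>j<m. d j * z ^ j) \<le> (\<Sum>j<m. norm (d j) * norm z ^ j)"
      by (rule order_trans[OF norm_sum]) (simp add: norm_mult norm_power)
    also have "\<dots> \<le> (\<Sum>j<m. norm (d j) * R ^ j)"
      using that by (intro sum_mono mult_left_mono power_mono) auto
    also have "\<dots> \<le> W"
      unfolding W_def using R by (intro sum_le_suminf sm) auto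
    finally show ?thesis .
  qed
  have "(\<lambda>m. \<integral>z. ?i z *\<^sub>R (norm (\<Sum>j<m. d j * z ^ j))\<^sup>2 \<partial>lborel) \<longlonglongrightarrow> (\<integral>z. ?i z *\<^sub>R (norm (g z))\<^sup>2 \<partial>lborel)"
  proof (rule integral_dominated_convergence[where w = "\<lambda>z. ?i z *\<^sub>R W\<^sup>2"])
    show "(\<lambda>z. ?i z *\<^sub>R (norm (g z))\<^sup>2) \<in> borel_measurable lborel"
      by (rule borel_measurable_integrable) (intro integrable_cball continuous_intros gc)
    show "(\<lambda>z. ?i z *\<^sub>R (norm (\<Sum>j<m. d j * z ^ j))\<^sup>2) \<in> borel_measurable lborel" for m
      by (rule borel_measurable_integrable) (intro integrable_cball continuous_intros)
    show "integrable lborel (\<lambda>z. ?i z *\<^sub>R W\<^sup>2)"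
      by (intro integrable_cball continuous_intros)
    show "AE z in lborel. (\<lambda>m. ?i z *\<^sub>R (norm (\<Sum>j<m. d j * z ^ j))\<^sup>2) \<longlonglongrightarrow> ?i z *\<^sub>R (norm (g z))\<^sup>2"
    proof (rule AE_I2)
      fix z
      show "(\<lambda>m. ?i z *\<^sub>R (norm (\<Sum>j<m. d j * z ^ j))\<^sup>2) \<longlonglongrightarrow> ?i z *\<^sub>R (norm (g z))\<^sup>2"
      proof (cases "norm z \<le> R")
        case True
        then have "(\<lambda>m. \<Sum>j<m. d j * z ^ j) \<longlonglongrightarrow> g z"
          using sums[of z] R by (simp add: sums_def)
        then show ?thesis by (intro tendsto_intros)
      qed (simp add: indicator_def)
    qed
    show "AE z in lborel. norm (?i z *\<^sub>R (norm (\<Sum>j<m. d j * z ^ j))\<^sup>2) \<le> ?i z *\<^sub>R W\<^sup>2" for m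
      using bound by (intro AE_I2) (auto simp: indicator_def intro!: power_mono)
  qed
  then have lim: "(\<lambda>m. \<Sum>j<m. (norm (d j))\<^sup>2 * (pi * R ^ (2 * j + 2) / (j + 1))) \<longlonglongrightarrow>
      (\<integral>z. ?i z *\<^sub>R (norm (g z))\<^sup>2 \<partial>lborel)"
    by (simp only: integral_cball_polynomial[OF R(1)])
  show ?thesis
    unfolding d_def[symmetric]
  proof (rule LIMSEQ_le_const[OF lim], intro exI[of _ n] allI impI)
    fix m assume "n \<le> m"
    then show "(\<Sum>j<n. (norm (d j))\<^sup>2 * (pi * R ^ (2 * j + 2) / (j + 1))) \<le>
      (\<Sum>j<m. (norm (d j))\<^sup>2 * (pi * R ^ (2 * j + 2) / (j + 1)))"
      using R by (intro sum_mono2) auto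
  qed
qed

section \<open>The lattice, its fundamental cell and integration over the torus\<close>

text \<open>Discreteness of the lattice enters as positivity of the infimum
  \<open>min_length\<close>. In the application it is supplied by the sewing radii, which are
  positive and below half of it.\<close>

locale torus =
  fixes \<tau> :: complex
  assumes Im_pos: "0 < Im \<tau>" and min_length_pos: "0 < min_length \<tau>"
begin

abbreviation "\<Lambda> \<equiv> period_lattice \<tau>"
abbreviation "D \<equiv> min_length \<tau>"
abbreviation "\<omega>\<^sub>1 \<equiv> 2 * complex_of_real pi * \<i>"
abbreviation "\<omega>\<^sub>2 \<equiv> 2 * complex_of_real pi * \<i> * \<tau>"

lemma lattice_0 [simp]: "0 \<in> \<Lambda>"
  unfolding period_lattice_def by (auto intro!: exI[of _ 0])

lemma lattice_1 [simp]: "\<omega>\<^sub>1 \<in> \<Lambda>"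
  unfolding period_lattice_def by (rule CollectI, rule exI[of _ 0], rule exI[of _ 1], simp)

lemma lattice_2 [simp]: "\<omega>\<^sub>2 \<in> \<Lambda>"
  unfolding period_lattice_def by (rule CollectI, rule exI[of _ 1], rule exI[of _ 0], simp)

lemma lattice_diff: "w \<in> \<Lambda> \<Longrightarrow> w' \<in> \<Lambda> \<Longrightarrow> w - w' \<in> \<Lambda>"
proof -
  assume "w \<in> \<Lambda>" "w' \<in> \<Lambda>"
  then obtain m n m' n' :: int where "w = of_int m * \<omega>\<^sub>2 + of_int n * \<omega>\<^sub>1" "w' = of_int m' * \<omega>\<^sub>2 + of_int n' * \<omega>\<^sub>1"
    by (auto simp: period_lattice_def)
  then have "w - w' = of_int (m - m') * \<omega>\<^sub>2 + of_int (n - n') * \<omega>\<^sub>1"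
    by (simp add: algebra_simps)
  then show ?thesis unfolding period_lattice_def by blast
qed

lemma lattice_minus: "w \<in> \<Lambda> \<Longrightarrow> - w \<in> \<Lambda>"
  using lattice_diff[of 0 w] by simp

lemma lattice_add: "w \<in> \<Lambda> \<Longrightarrow> w' \<in> \<Lambda> \<Longrightarrow> w + w' \<in> \<Lambda>"
  using lattice_diff[of w "- w'"] lattice_minus by simp

lemma norm_lattice: "w \<in> \<Lambda> \<Longrightarrow> w \<noteq> 0 \<Longrightarrow> D \<le> norm w"
  unfolding min_length_def by (intro cInf_lower bdd_belowI[of _ 0]) auto

text \<open>Two distinct lattice points are at least \<open>D\<close> apart. This makes every later
  choice of a lattice point near \<open>z\<close> unambiguous.\<close>

lemma lattice_near_unique:
  assumes "w \<in> \<Lambda>" "w' \<in> \<Lambda>" "norm (z - w) + norm (z - w') < D"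
  shows "w = w'"
proof (rule ccontr)
  assume "w \<noteq> w'"
  then have "D \<le> norm (w - w')" using norm_lattice[OF lattice_diff] assms by simp
  also have "\<dots> \<le> norm (z - w) + norm (z - w')"
    using norm_triangle_ineq4[of "z - w'" "z - w"] by (simp add: norm_minus_commute)
  finally show False using assms by simp
qed

lemma far_from_lattice:
  assumes "norm z + \<rho> < D" "\<rho> \<le> norm z" "w \<in> \<Lambda>"
  shows "\<rho> \<le> norm (z - w)"
  using lattice_near_unique[of 0 w z] assms by (cases "w = 0") force+

text \<open>Real coordinates with respect to the lattice basis. The coefficient of the period
  \<open>\<omega>\<^sub>2\<close> plays a double role: up to sign it is also the quasi-period of the
  function \<open>P\<close> below.\<close>

definition t_coord :: "complex \<Rightarrow> real" where "t_coord z = - Re z / (2 * pi * Im \<tau>)"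
definition s_coord :: "complex \<Rightarrow> real" where "s_coord z = Im z / (2 * pi) - t_coord z * Re \<tau>"

lemma coord_add:
  "t_coord (z + w) = t_coord z + t_coord w" "s_coord (z + w) = s_coord z + s_coord w"
  by (simp_all add: t_coord_def s_coord_def add_divide_distrib diff_divide_distrib algebra_simps)

lemma coord_diff:
  "t_coord (z - w) = t_coord z - t_coord w" "s_coord (z - w) = s_coord z - s_coord w"
  by (simp_all add: t_coord_def s_coord_def add_divide_distrib diff_divide_distrib algebra_simps)

lemma coord_inverse: "z = of_real (t_coord z) * \<omega>\<^sub>2 + of_real (s_coord z) * \<omega>\<^sub>1"
  using Im_pos by (simp add: complex_eq_iff t_coord_def s_coord_def field_simps)

lemma coord_of:
  "t_coord (of_real t * \<omega>\<^sub>2 + of_real s * \<omega>\<^sub>1) = t" "s_coord (of_real t * \<omega>\<^sub>2 + of_real s * \<omega>\<^sub>1) = s"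
  using Im_pos by (simp_all add: t_coord_def s_coord_def field_simps)

lemma lattice_iff: "z \<in> \<Lambda> \<longleftrightarrow> t_coord z \<in> \<int> \<and> s_coord z \<in> \<int>"
proof
  assume "z \<in> \<Lambda>"
  then obtain m n :: int where "z = of_real (of_int m) * \<omega>\<^sub>2 + of_real (of_int n) * \<omega>\<^sub>1"
    by (auto simp: period_lattice_def)
  then have "t_coord z = of_int m" "s_coord z = of_int n"
    using coord_of[of "of_int m" "of_int n"] by simp_all
  then show "t_coord z \<in> \<int> \<and> s_coord z \<in> \<int>" by simp
next
  assume "t_coord z \<in> \<int> \<and> s_coord z \<in> \<int>"
  then obtain m n where "t_coord z = of_int m" "s_coord z = of_int n"
    by (auto elim!: Ints_cases)
  then have "z = of_int m * \<omega>\<^sub>2 + of_int n * \<omega>\<^sub>1"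
    using coord_inverse[of z] by simp
  then show "z \<in> \<Lambda>" unfolding period_lattice_def by blast
qed

definition cell :: "complex set" where
  "cell = {z. 0 \<le> t_coord z \<and> t_coord z < 1 \<and> 0 \<le> s_coord z \<and> s_coord z < 1}"

lemma cell_measurable [measurable]: "cell \<in> sets borel"
proof -
  have "cell = {z \<in> space borel. 0 \<le> t_coord z \<and> t_coord z < 1 \<and> 0 \<le> s_coord z \<and> s_coord z < 1}"
    by (simp add: cell_def)
  also have "\<dots> \<in> sets borel"
    unfolding t_coord_def s_coord_def by measurable
  finally show ?thesis .
qed

lemma norm_cell: "z \<in> cell \<Longrightarrow> norm z \<le> norm \<omega>\<^sub>2 + norm \<omega>\<^sub>1"
proof -
  assume z: "z \<in> cell"
  have "norm z \<le> norm (of_real (t_coord z) * \<omega>\<^sub>2) + norm (of_real (s_coord z) * \<omega>\<^sub>1)"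
    by (subst coord_inverse[of z]) (rule norm_triangle_ineq)
  also have "\<dots> \<le> 1 * norm \<omega>\<^sub>2 + 1 * norm \<omega>\<^sub>1"
    unfolding norm_mult[of "of_real _"] norm_of_real
    using z by (intro add_mono mult_right_mono) (auto simp: cell_def)
  finally show ?thesis by simp
qed

lemma emeasure_cell: "emeasure lborel cell < \<infinity>"
  by (rule emeasure_bounded_finite) (use norm_cell in \<open>auto simp: bounded_iff\<close>)

lemma cell_tiles: "\<exists>!w. w \<in> \<Lambda> \<and> z - w \<in> cell"
proof (rule ex1I)
  let ?w = "of_int \<lfloor>t_coord z\<rfloor> * \<omega>\<^sub>2 + of_int \<lfloor>s_coord z\<rfloor> * \<omega>\<^sub>1"
  have c: "t_coord ?w = of_int \<lfloor>t_coord z\<rfloor>" "s_coord ?w = of_int \<lfloor>s_coord z\<rfloor>"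
    using coord_of[of "of_int \<lfloor>t_coord z\<rfloor>" "of_int \<lfloor>s_coord z\<rfloor>"] by simp_all
  show "?w \<in> \<Lambda> \<and> z - ?w \<in> cell"
    unfolding cell_def mem_Collect_eq coord_diff c lattice_iff
    by (auto simp: c) linarith+
  fix w assume w: "w \<in> \<Lambda> \<and> z - w \<in> cell"
  then obtain m n :: int where mn: "t_coord w = of_int m" "s_coord w = of_int n"
    by (auto simp: lattice_iff elim!: Ints_cases)
  have "m = \<lfloor>t_coord z\<rfloor>" "n = \<lfloor>s_coord z\<rfloor>"
    using w mn by (auto simp: cell_def coord_diff intro!: floor_unique[symmetric])
  then show "w = ?w" using coord_inverse[of w] mn by simp
qed

lemma lattice_enumeration: obtains p :: "nat \<Rightarrow> complex" where "bij_betw p UNIV \<Lambda>"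
proof -
  have "\<Lambda> = (\<lambda>(m::int, n::int). of_int m * \<omega>\<^sub>2 + of_int n * \<omega>\<^sub>1) ` UNIV"
    by (auto simp: period_lattice_def image_iff)
  then have "countable \<Lambda>" by (metis countable_image uncountable_def countableI_type)
  moreover have "infinite \<Lambda>"
  proof
    assume "finite \<Lambda>"
    moreover have "range (\<lambda>n::nat. of_nat n * \<omega>\<^sub>1) \<subseteq> \<Lambda>"
    proof safe
      fix n show "of_nat n * \<omega>\<^sub>1 \<in> \<Lambda>"
      proof (induction n)
        case (Suc n)
        then show ?case using lattice_add[OF Suc lattice_1] by (simp add: distrib_right add.commute)
      qed simp
    qed
    ultimately have "finite (range (\<lambda>n::nat. of_nat n * \<omega>\<^sub>1))" by (rule finite_subset[rotated])
    moreover have "inj (\<lambda>n::nat. of_nat n * \<omega>\<^sub>1)" by (auto simp: inj_on_def)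
    ultimately show False by (simp add: finite_image_iff)
  qed
  ultimately show ?thesis using that bij_betw_from_nat_into by blast
qed

text \<open>The translates of the cell partition the plane. Inserting the sum of their indicators
  under the integral and translating each summand back folds the plane onto the cell.\<close>

lemma nn_integral_unfold:
  assumes p: "bij_betw p UNIV \<Lambda>" and [measurable]: "g \<in> borel_measurable borel"
  shows "(\<integral>\<^sup>+z. g z \<partial>lborel) = (\<integral>\<^sup>+z. indicator cell z * (\<Sum>n. g (z + p n)) \<partial>lborel)"
proof -
  have one: "(\<Sum>n. indicator cell (z - p n)) = (1 :: ennreal)" for z
  proof -
    obtain w where w: "w \<in> \<Lambda>" "z - w \<in> cell" "\<And>w'. w' \<in> \<Lambda> \<Longrightarrow> z - w' \<in> cell \<Longrightarrow> w' = w"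
      using cell_tiles[of z] by blast
    obtain k where k: "w = p k" using p w(1) by (auto simp: bij_betw_def)
    have "indicator cell (z - p n) = (if n = k then 1 else 0 :: ennreal)" for n
    proof (cases "n = k")
      case False
      then have "p n \<noteq> w" using p k by (auto simp: bij_betw_def inj_on_def)
      then have "z - p n \<notin> cell" using w(3)[of "p n"] p by (auto simp: bij_betw_def)
      then show ?thesis using False by simp
    qed (use w(2) k in simp)
    then show ?thesis using suminf_finite[of "{k}" "\<lambda>n. if n = k then 1 else 0 :: ennreal"] by simp
  qed
  have "(\<integral>\<^sup>+z. g z \<partial>lborel) = (\<integral>\<^sup>+z. (\<Sum>n. g z * indicator cell (z - p n)) \<partial>lborel)"
    by (simp add: one ennreal_suminf_cmult)
  also have "\<dots> = (\<Sum>n. \<integral>\<^sup>+z. g z * indicator cell (z - p n) \<partial>lborel)"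
    by (rule nn_integral_suminf) measurable
  also have "\<dots> = (\<Sum>n. \<integral>\<^sup>+z. g (z + p n) * indicator cell z \<partial>lborel)"
  proof (intro suminf_cong)
    fix n
    show "(\<integral>\<^sup>+z. g z * indicator cell (z - p n) \<partial>lborel) = (\<integral>\<^sup>+z. g (z + p n) * indicator cell z \<partial>lborel)"
      using lborel_translate[of "\<lambda>z. g z * indicator cell (z - p n)" "p n"] by simp
  qed
  also have "\<dots> = (\<integral>\<^sup>+z. (\<Sum>n. g (z + p n) * indicator cell z) \<partial>lborel)"
    by (rule nn_integral_suminf[symmetric]) measurable
  also have "\<dots> = (\<integral>\<^sup>+z. indicator cell z * (\<Sum>n. g (z + p n)) \<partial>lborel)"
    by (simp add: ennreal_suminf_multc mult.commute)
  finally show ?thesis .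
qed

text \<open>When \<open>B\<close> contains at most one point of each lattice coset, the folded sum
  has at most one nonzero term. The sets in question are a small disc in the area theorem and a
  translated cell in \<open>integral_cell_shift\<close>.\<close>

lemma nn_integral_periodic:
  assumes [measurable]: "g \<in> borel_measurable borel" "B \<in> sets borel"
    and per: "\<And>z w. w \<in> \<Lambda> \<Longrightarrow> g (z + w) = g z"
    and inj: "\<And>z w. z \<in> B \<Longrightarrow> z + w \<in> B \<Longrightarrow> w \<in> \<Lambda> \<Longrightarrow> w = 0"
  shows "(\<integral>\<^sup>+z. indicator B z * g z \<partial>lborel) =
    (\<integral>\<^sup>+z. indicator cell z * (indicator {z. \<exists>w\<in>\<Lambda>. z + w \<in> B} z * g z) \<partial>lborel)"
proof -
  obtain p :: "nat \<Rightarrow> complex" where p: "bij_betw p UNIV \<Lambda>" by (rule lattice_enumeration)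
  have pn: "p n \<in> \<Lambda>" for n using p by (auto simp: bij_betw_def)
  have "(\<Sum>n. indicator B (z + p n) * g (z + p n)) = indicator {z. \<exists>w\<in>\<Lambda>. z + w \<in> B} z * g z" for z
  proof (cases "\<exists>w\<in>\<Lambda>. z + w \<in> B")
    case True
    then obtain w where w: "w \<in> \<Lambda>" "z + w \<in> B" by blast
    obtain k where k: "w = p k" using p w(1) by (auto simp: bij_betw_def)
    have uniq: "n = k" if "z + p n \<in> B" for n
    proof -
      have "p n - w = 0"
        using inj[of "z + w" "p n - w"] w that pn by (simp add: lattice_diff)
      then show ?thesis using p k by (auto simp: bij_betw_def inj_on_def)
    qed
    have "indicator B (z + p n) * g (z + p n) = (if n = k then g z else 0)" for n
    proof (cases "n = k")
      case True
      then have "z + p n \<in> B" using w(2) k by simp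
      then show ?thesis using per[OF pn[of n], of z] True by simp
    next
      case False
      then have "z + p n \<notin> B" using uniq by metis
      then show ?thesis using False by simp
    qed
    then show ?thesis
      using True suminf_finite[of "{k}" "\<lambda>n. if n = k then g z else 0"] by simp
  next
    case False
    then have z: "(\<lambda>n. indicator B (z + p n) * g (z + p n)) = (\<lambda>_. 0)"
      using pn by (auto simp: indicator_def)
    show ?thesis using False unfolding z by simp
  qed
  then show ?thesis
    using nn_integral_unfold[OF p, of "\<lambda>z. indicator B z * g z"] by simp
qed

lemma integral_periodic:
  fixes g :: "complex \<Rightarrow> real"
  assumes [measurable]: "g \<in> borel_measurable borel" "B \<in> sets borel"
    and C[measurable]: "{z. \<exists>w\<in>\<Lambda>. z + w \<in> B} \<in> sets borel"
    and fin: "emeasure lborel B < \<infinity>" and bd: "\<And>z. \<bar>g z\<bar> \<le> K"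
    and per: "\<And>z w. w \<in> \<Lambda> \<Longrightarrow> g (z + w) = g z"
    and inj: "\<And>z w. z \<in> B \<Longrightarrow> z + w \<in> B \<Longrightarrow> w \<in> \<Lambda> \<Longrightarrow> w = 0"
  shows "(\<integral>z. indicator B z * g z \<partial>lborel) =
    (\<integral>z. indicator cell z * (indicator {z. \<exists>w\<in>\<Lambda>. z + w \<in> B} z * g z) \<partial>lborel)"
proof -
  let ?C = "{z. \<exists>w\<in>\<Lambda>. z + w \<in> B}"
  have int: "integrable lborel (\<lambda>z. indicator S z * h z)"
    if [measurable]: "S \<in> sets borel" "h \<in> borel_measurable borel" and "emeasure lborel S < \<infinity>"
      and "\<And>z. \<bar>h z\<bar> \<le> K" for S and h :: "complex \<Rightarrow> real"
  proof (rule Bochner_Integration.integrable_bound[of _ "\<lambda>z. K * indicator S z"])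
    show "integrable lborel (\<lambda>z. K * indicator S z)"
      using that by (intro integrable_mult_right integrable_real_indicator) auto
    show "AE z in lborel. norm (indicator S z * h z) \<le> norm (K * indicator S z)"
      by (intro AE_I2) (auto simp: indicator_def intro: order_trans[OF that(4) abs_ge_self])
  qed measurable
  have K: "0 \<le> K" using bd[of 0] by linarith
  have eq: "(\<integral>\<^sup>+z. ennreal (indicator B z * h z) \<partial>lborel) =
      (\<integral>\<^sup>+z. ennreal (indicator cell z * (indicator ?C z * h z)) \<partial>lborel)"
    if [measurable]: "h \<in> borel_measurable borel" and "\<And>z w. w \<in> \<Lambda> \<Longrightarrow> h (z + w) = h z" for h
  proof -
    have [simp]: "ennreal (indicator S z * x) = indicator S z * ennreal x" for S and z :: complex and x
      by (simp add: indicator_def)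
    show ?thesis
      using nn_integral_periodic[of "\<lambda>z. ennreal (h z)" B] inj that(2) by simp
  qed
  show ?thesis
  proof (subst (1 2) real_lebesgue_integral_def)
    show "integrable lborel (\<lambda>z. indicator B z * g z)"
      using fin bd by (intro int) auto
    show "integrable lborel (\<lambda>z. indicator cell z * (indicator ?C z * g z))"
    proof (rule int)
      show "(\<lambda>z. indicator ?C z * g z) \<in> borel_measurable borel" by measurable
      show "\<bar>indicator ?C z * g z\<bar> \<le> K" for z
        using bd[of z] K by (cases "z \<in> ?C") auto
    qed (use emeasure_cell in auto)
    show "enn2real (\<integral>\<^sup>+z. ennreal (indicator B z * g z) \<partial>lborel) - enn2real (\<integral>\<^sup>+z. ennreal (- (indicator B z * g z)) \<partial>lborel) =
      enn2real (\<integral>\<^sup>+z. ennreal (indicator cell z * (indicator ?C z * g z)) \<partial>lborel) -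
      enn2real (\<integral>\<^sup>+z. ennreal (- (indicator cell z * (indicator ?C z * g z))) \<partial>lborel)"
      using eq[of g] eq[of "\<lambda>z. - g z"] per by simp
  qed
qed

text \<open>A translate of the cell is again a system of representatives modulo the lattice, so
  integration over the torus is translation invariant.\<close>

lemma integral_cell_shift:
  fixes g :: "complex \<Rightarrow> real"
  assumes [measurable]: "g \<in> borel_measurable borel"
    and bd: "\<And>z. \<bar>g z\<bar> \<le> K"
    and per: "\<And>z w. w \<in> \<Lambda> \<Longrightarrow> g (z + w) = g z"
  shows "(\<integral>z. indicator cell z * g (z + d) \<partial>lborel) = (\<integral>z. indicator cell z * g z \<partial>lborel)"
proof -
  let ?B = "{z. z - d \<in> cell}"
  have [measurable]: "?B \<in> sets borel" by measurable
  have C: "{z. \<exists>w\<in>\<Lambda>. z + w \<in> ?B} = UNIV"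
  proof -
    have "\<exists>w\<in>\<Lambda>. z + w - d \<in> cell" for z
    proof -
      obtain w where w: "w \<in> \<Lambda>" "z - d - w \<in> cell" using cell_tiles[of "z - d"] by blast
      then show ?thesis using lattice_minus[of w] by (intro bexI[of _ "- w"]) (auto simp: algebra_simps)
    qed
    then show ?thesis by auto
  qed
  have "(\<integral>z. indicator cell z * g (z + d) \<partial>lborel) = (\<integral>z. indicator ?B z * g z \<partial>distr lborel borel ((+) d))"
    by (subst integral_distr) (auto simp: indicator_def add.commute)
  also have "\<dots> = (\<integral>z. indicator ?B z * g z \<partial>lborel)"
    by (simp add: lborel_distr_plus)
  also have "\<dots> = (\<integral>z. indicator cell z * (indicator {z. \<exists>w\<in>\<Lambda>. z + w \<in> ?B} z * g z) \<partial>lborel)"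
  proof (rule integral_periodic[OF _ _ _ _ bd per])
    have "emeasure lborel ?B = emeasure (distr lborel borel ((+) d)) ?B"
      by (simp add: lborel_distr_plus)
    also have "\<dots> = emeasure lborel cell"
      by (subst emeasure_distr) auto
    finally show "emeasure lborel ?B < \<infinity>" using emeasure_cell by simp
    show "w = 0" if "z \<in> ?B" "z + w \<in> ?B" "w \<in> \<Lambda>" for z w
    proof -
      have "\<exists>!w. w \<in> \<Lambda> \<and> z - d - w \<in> cell" by (rule cell_tiles)
      moreover have "z - d - (- w) = z + w - d" by simp
      ultimately show ?thesis using that lattice_minus[of w] lattice_0
        by (metis (no_types, lifting) diff_zero mem_Collect_eq neg_equal_0_iff_equal)
    qed
    show "{z. \<exists>w\<in>\<Lambda>. z + w \<in> ?B} \<in> sets borel" unfolding C by simp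
  qed simp_all
  also have "\<dots> = (\<integral>z. indicator cell z * g z \<partial>lborel)" unfolding C by simp
  finally show ?thesis .
qed

lemma periodic_bounded:
  fixes v :: "complex \<Rightarrow> 'a::real_normed_vector"
  assumes cont: "continuous_on UNIV v" and per: "\<And>z w. w \<in> \<Lambda> \<Longrightarrow> v (z + w) = v z"
  obtains M where "\<And>z. norm (v z) \<le> M"
proof -
  let ?B = "cball (0::complex) (norm \<omega>\<^sub>2 + norm \<omega>\<^sub>1)"
  have "compact (v ` ?B)"
    by (intro compact_continuous_image continuous_on_subset[OF cont]) auto
  then obtain M where M: "\<And>z. z \<in> ?B \<Longrightarrow> norm (v z) \<le> M"
    using compact_imp_bounded[of "v ` ?B"] by (meson bounded_iff imageI)
  have "norm (v z) \<le> M" for z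
  proof -
    obtain w where w: "w \<in> \<Lambda>" "z - w \<in> cell" using cell_tiles[of z] by blast
    have "v z = v (z - w)" using per[OF w(1), of "z - w"] by simp
    then show ?thesis using M[of "z - w"] norm_cell[OF w(2)] unfolding mem_cball_0 by simp
  qed
  then show ?thesis using that by blast
qed

section \<open>The null Lagrangian on the torus\<close>

lemma has_derivative_symmetric_quotient:
  fixes v :: "complex \<Rightarrow> complex"
  assumes "(v has_derivative L) (at z)" and h: "h \<longlonglongrightarrow> 0" "\<And>n. h n > (0::real)" and d: "d \<noteq> 0"
  shows "(\<lambda>n. (v (z + of_real (h n) * d) - v (z - of_real (h n) * d)) / of_real (2 * h n)) \<longlonglongrightarrow> L d"
proof -
  have lin: "linear L" using assms(1) has_derivative_linear by blast
  have one: "(\<lambda>n. (v (z + of_real (h n) * d) - v z) /\<^sub>R h n) \<longlonglongrightarrow> L d" if d: "d \<noteq> 0" for d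
  proof -
    have "((\<lambda>k. norm (v (z + k) - v z - L k) / norm k) \<longlongrightarrow> 0) (at 0)"
      using assms(1) by (simp add: has_derivative_at)
    moreover have "filterlim (\<lambda>n. of_real (h n) * d) (at 0) sequentially"
    proof -
      have "(\<lambda>n. of_real (h n) * d) \<longlonglongrightarrow> of_real 0 * d"
        by (intro tendsto_intros h(1))
      moreover have "of_real (h n) * d \<noteq> 0" for n using h(2)[of n] d by simp
      ultimately show ?thesis by (auto simp: filterlim_at)
    qed
    ultimately have "(\<lambda>n. norm (v (z + of_real (h n) * d) - v z - L (of_real (h n) * d)) / norm (of_real (h n) * d)) \<longlonglongrightarrow> 0"
      by (rule filterlim_compose)
    then have "(\<lambda>n. norm d * (norm (v (z + of_real (h n) * d) - v z - L (of_real (h n) * d)) / norm (of_real (h n) * d))) \<longlonglongrightarrow> norm d * 0"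
      by (intro tendsto_intros)
    also have "(\<lambda>n. norm d * (norm (v (z + of_real (h n) * d) - v z - L (of_real (h n) * d)) / norm (of_real (h n) * d))) =
      (\<lambda>n. norm ((v (z + of_real (h n) * d) - v z) /\<^sub>R h n - L d))"
    proof
      fix n
      have "L (of_real (h n) * d) = h n *\<^sub>R L d"
        using linear_scale[OF lin, of "h n" d] by (simp add: scaleR_conv_of_real)
      moreover have "X /\<^sub>R r - Y = (X - r *\<^sub>R Y) /\<^sub>R r" if "r > 0" for X Y :: complex and r
        using that by (simp add: scaleR_conv_of_real field_simps)
      ultimately have eq: "(v (z + of_real (h n) * d) - v z) /\<^sub>R h n - L d = (v (z + of_real (h n) * d) - v z - L (of_real (h n) * d)) /\<^sub>R h n"
        using h(2)[of n] by metis
      have "\<bar>d'\<bar> * (N / (r * \<bar>d'\<bar>)) = inverse r * N" if "r > 0" "d' \<noteq> 0" for d' r N :: real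
        using that by (simp add: field_simps)
      from this[OF h(2)[of n], of "norm d" "norm (v (z + of_real (h n) * d) - v z - L (of_real (h n) * d))"]
      show "norm d * (norm (v (z + of_real (h n) * d) - v z - L (of_real (h n) * d)) / norm (of_real (h n) * d)) =
        norm ((v (z + of_real (h n) * d) - v z) /\<^sub>R h n - L d)"
        unfolding eq norm_scaleR norm_mult norm_of_real using h(2)[of n] d by simp
    qed
    finally have lim0: "(\<lambda>n. norm ((v (z + of_real (h n) * d) - v z) /\<^sub>R h n - L d)) \<longlonglongrightarrow> norm d * 0" .
    show ?thesis
      by (rule LIM_zero_cancel, rule tendsto_norm_zero_cancel) (use lim0 in simp)
  qed
  have "(\<lambda>n. ((v (z + of_real (h n) * d) - v z) /\<^sub>R h n - (v (z + of_real (h n) * (- d)) - v z) /\<^sub>R h n) / 2) \<longlonglongrightarrow> (L d - L (- d)) / 2"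
    by (intro tendsto_intros one) (use d in auto)
  moreover have "(L d - L (- d)) / 2 = L d"
    using linear_neg[OF lin] by simp
  moreover have "((v (z + of_real (h n) * d) - v z) /\<^sub>R h n - (v (z + of_real (h n) * (- d)) - v z) /\<^sub>R h n) / 2 =
      (v (z + of_real (h n) * d) - v (z - of_real (h n) * d)) / of_real (2 * h n)" for n
    using h(2)[of n] by (simp add: scaleR_conv_of_real field_simps)
  ultimately show ?thesis by (simp only:)
qed

text \<open>
  The Jacobian of \<open>w = v + \<kappa> Re z\<close> is a null Lagrangian: its integral over a cell vanishes. With
  symmetric difference quotients in place of derivatives this is translation invariance alone, so
  no regularity beyond the Lipschitz condition is needed.
\<close>

lemma null_lagrangian:
  fixes v \<alpha> \<beta> :: "complex \<Rightarrow> complex" and \<kappa> :: complex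
  assumes per: "\<And>z w. w \<in> \<Lambda> \<Longrightarrow> v (z + w) = v z"
    and cont: "continuous_on UNIV v"
    and lip: "\<And>z d. norm d \<le> 1 \<Longrightarrow> norm (v (z + d) - v z) \<le> K * norm d"
    and deriv: "AE z in lborel. (v has_derivative (\<lambda>h. \<alpha> z * h + \<beta> z * cnj h)) (at z)"
  obtains q M where "q \<in> borel_measurable borel" "\<And>z. \<bar>q z\<bar> \<le> M" "\<And>z w. w \<in> \<Lambda> \<Longrightarrow> q (z + w) = q z"
    "AE z in lborel. q z = (norm (\<alpha> z + \<kappa> / 2))\<^sup>2 - (norm (\<beta> z + \<kappa> / 2))\<^sup>2"
    "(\<integral>z. indicator cell z * q z \<partial>lborel) = 0"
proof -
  obtain V where V: "\<And>z. norm (v z) \<le> V" using periodic_bounded[OF cont per] by metis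
  have [measurable]: "v \<in> borel_measurable borel"
    using cont by (rule borel_measurable_continuous_onI)
  have vc [continuous_intros]: "continuous_on UNIV (\<lambda>z. v (z + p))" for p
    by (intro continuous_on_compose2[OF cont]) (auto intro!: continuous_intros)
  have vc' [continuous_intros]: "continuous_on UNIV (\<lambda>z. v (z - p))" for p
    using vc[of "- p"] by simp
  have K: "K \<ge> 0" using lip[of 1 0] norm_ge_zero[of "v (0+1) - v 0"] by (simp del: norm_ge_zero)
  \<comment> \<open>\<open>J p d\<close> pairs two translates of \<open>v\<close>. By translation
    invariance it depends only on \<open>d - p\<close>, and since the pairing is antisymmetric it is
    odd in that difference. \<open>l d\<close> pairs a translate with a constant and does not depend
    on \<open>d\<close> at all.\<close>
  define J where "J p d = (\<integral>z. indicator cell z * Im (cnj (v (z + p)) * v (z + d)) \<partial>lborel)" for p d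
  define l where "l d = (\<integral>z. indicator cell z * Im (cnj \<kappa> * v (z + d)) \<partial>lborel)" for d
  have perJ: "v (z + w + d) = v (z + d)" if "w \<in> \<Lambda>" for z w d
    using per[OF that, of "z + d"] by (simp add: add_ac)
  have bdV: "\<bar>Im (cnj (v x) * v y)\<bar> \<le> V * V" for x y
    using abs_Im_le_cmod[of "cnj (v x) * v y"] mult_mono[OF V[of x] V[of y]] order_trans[OF norm_ge_zero V]
    by (auto simp: norm_mult intro: order_trans)
  have bdl: "\<bar>Im (cnj \<kappa> * v y)\<bar> \<le> norm \<kappa> * V" for y
    using abs_Im_le_cmod[of "cnj \<kappa> * v y"] mult_left_mono[OF V[of y], of "norm \<kappa>"]
    by (auto simp: norm_mult intro: order_trans)
  have Jshift: "J p d = J 0 (d - p)" for p d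
    using integral_cell_shift[of "\<lambda>z. Im (cnj (v z) * v (z + (d - p)))" "V * V" p] bdV per perJ
    by (simp add: J_def)
  have Janti: "J 0 (- d) = - J 0 d" for d
  proof -
    have "J 0 (- d) = J d 0" by (simp add: Jshift[of d 0])
    also have "\<dots> = (\<integral>z. - (indicator cell z * Im (cnj (v z) * v (z + d))) \<partial>lborel)"
      unfolding J_def by (intro Bochner_Integration.integral_cong) (auto simp: algebra_simps)
    also have "\<dots> = - J 0 d" unfolding J_def by simp
    finally show ?thesis .
  qed
  have lshift: "l d = l 0" for d
    using integral_cell_shift[of "\<lambda>z. Im (cnj \<kappa> * v z)" "norm \<kappa> * V" d] bdl per
    by (simp add: l_def)
  have intg: "integrable lborel (\<lambda>z. indicator cell z * h z)"
    if [measurable]: "h \<in> borel_measurable borel" and "\<And>z. \<bar>h z\<bar> \<le> B" for h :: "complex \<Rightarrow> real" and B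
  proof (rule Bochner_Integration.integrable_bound[of _ "\<lambda>z. B * indicator cell z"])
    show "integrable lborel (\<lambda>z. B * indicator cell z)"
      using emeasure_cell by (intro integrable_mult_right integrable_real_indicator) auto
    show "AE z in lborel. norm (indicator cell z * h z) \<le> norm (B * indicator cell z)"
      by (intro AE_I2) (auto simp: indicator_def intro: order_trans[OF that(2) abs_ge_self])
  qed measurable
  have intJ: "integrable lborel (\<lambda>z. indicator cell z * Im (cnj (v (z + p)) * v (z + d)))" for p d
    by (rule intg[OF borel_measurable_continuous_onI bdV]) (intro continuous_intros)
  have intl: "integrable lborel (\<lambda>z. indicator cell z * Im (cnj \<kappa> * v (z + d)))" for d
    by (rule intg[OF borel_measurable_continuous_onI bdl]) (intro continuous_intros)
  define h where "h n = 1 / real (Suc n)" for n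
  have h: "h \<longlonglongrightarrow> 0" "0 < h n" "h n \<le> 1" for n
    unfolding h_def using LIMSEQ_inverse_real_of_nat by (auto simp: inverse_eq_divide field_simps)
  define a where "a n z = (v (z + of_real (h n)) - v (z - of_real (h n))) / of_real (2 * h n)" for n z
  define b where "b n z = (v (z + of_real (h n) * \<i>) - v (z - of_real (h n) * \<i>)) / of_real (2 * h n)" for n z
  \<comment> \<open>This is the Jacobian \<open>Im (cnj w_x * w_y)\<close> of
    \<open>w = v + \<kappa> Re z\<close> with difference quotients for partial derivatives:
    \<open>\<kappa> Re z\<close> adds \<kappa> to the derivative in direction 1 and nothing to the
    one in direction \<open>\<i>\<close>.\<close>
  define Q where "Q n z = Im (cnj (a n z + \<kappa>) * b n z)" for n z
  have [measurable]: "Q n \<in> borel_measurable borel" for n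
    unfolding Q_def a_def b_def using h(2)[of n]
    by (intro borel_measurable_continuous_onI continuous_intros) auto
  have quot: "norm ((v (z + of_real (h n) * d) - v (z - of_real (h n) * d)) / of_real (2 * h n)) \<le> K" if "norm d = 1" for d z n
  proof -
    have "norm (v (z + of_real (h n) * d) - v z) \<le> K * h n" "norm (v (z - of_real (h n) * d) - v z) \<le> K * h n"
      using lip[of "of_real (h n) * d" z] lip[of "- (of_real (h n) * d)" z] h(2,3)[of n] that by (auto simp: norm_mult)
    then have "norm (v (z + of_real (h n) * d) - v (z - of_real (h n) * d)) \<le> 2 * (K * h n)"
      using norm_triangle_ineq4[of "v (z + of_real (h n) * d) - v z" "v (z - of_real (h n) * d) - v z"] by simp
    then show ?thesis using h(2,3)[of n] by (simp add: norm_divide field_simps)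
  qed
  have Qb: "\<bar>Q n z\<bar> \<le> (K + norm \<kappa>) * K" for n z
  proof -
    have "\<bar>Q n z\<bar> \<le> norm (a n z + \<kappa>) * norm (b n z)"
      unfolding Q_def using abs_Im_le_cmod[of "cnj (a n z + \<kappa>) * b n z"]
      by (simp only: norm_mult complex_mod_cnj)
    also have "\<dots> \<le> (K + norm \<kappa>) * K"
      using quot[of 1 z n] quot[of \<i> z n] norm_triangle_ineq[of "a n z" \<kappa>] K
      by (intro mult_mono) (auto simp: a_def b_def)
    finally show ?thesis .
  qed
  have Q0: "(\<integral>z. indicator cell z * Q n z \<partial>lborel) = 0" for n
  proof -
    let ?h = "of_real (h n) :: complex"
    have hn: "h n \<noteq> 0" using h(2)[of n] by simp
    have "indicator cell z * Q n z =
      ((indicator cell z * Im (cnj (v (z + ?h)) * v (z + ?h * \<i>)) - indicator cell z * Im (cnj (v (z + ?h)) * v (z + - (?h * \<i>))))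
       - (indicator cell z * Im (cnj (v (z + - ?h)) * v (z + ?h * \<i>)) - indicator cell z * Im (cnj (v (z + - ?h)) * v (z + - (?h * \<i>))))) / (2 * h n)\<^sup>2 +
      (indicator cell z * Im (cnj \<kappa> * v (z + ?h * \<i>)) - indicator cell z * Im (cnj \<kappa> * v (z + - (?h * \<i>)))) / (2 * h n)" for z
    proof -
      have "Im (cnj ((x - x') / of_real r + \<kappa>) * ((y - y') / of_real r)) =
        ((Im (cnj x * y) - Im (cnj x * y')) - (Im (cnj x' * y) - Im (cnj x' * y'))) / r\<^sup>2 + (Im (cnj \<kappa> * y) - Im (cnj \<kappa> * y')) / r"
        if "r \<noteq> 0" for x x' y y' and r :: real
        using that by (simp add: power2_eq_square diff_divide_distrib add_divide_distrib algebra_simps)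
      from this[of "2 * h n"] show ?thesis
        using hn by (cases "z \<in> cell") (simp_all add: Q_def a_def b_def)
    qed
    then have "(\<integral>z. indicator cell z * Q n z \<partial>lborel) =
      ((J ?h (?h * \<i>) - J ?h (- (?h * \<i>))) - (J (- ?h) (?h * \<i>) - J (- ?h) (- (?h * \<i>)))) / (2 * h n)\<^sup>2 +
      (l (?h * \<i>) - l (- (?h * \<i>))) / (2 * h n)"
      unfolding J_def l_def
      by (simp only: Bochner_Integration.integral_add Bochner_Integration.integral_diff integral_divide_zero
        Bochner_Integration.integrable_add Bochner_Integration.integrable_diff Bochner_Integration.integrable_divide_zero intJ intl)
    \<comment> \<open>Up to sign the four shift differences are only \<open>h * \<i> - h\<close> and
      \<open>h * \<i> + h\<close>. Each occurs twice, and oddness of \<open>J 0\<close> makes the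
      occurrences cancel.\<close>
    also have "\<dots> = 0"
    proof -
      have "J ?h (?h * \<i>) = J 0 (?h * \<i> - ?h)" "J ?h (- (?h * \<i>)) = - J 0 (?h * \<i> + ?h)"
        "J (- ?h) (?h * \<i>) = J 0 (?h * \<i> + ?h)" "J (- ?h) (- (?h * \<i>)) = - J 0 (?h * \<i> - ?h)"
        using Jshift[of ?h "?h * \<i>"] Jshift[of ?h "- (?h * \<i>)"] Jshift[of "- ?h" "?h * \<i>"] Jshift[of "- ?h" "- (?h * \<i>)"]
          Janti[of "?h * \<i> + ?h"] Janti[of "?h * \<i> - ?h"]
        by (simp_all only: minus_add_distrib minus_diff_eq diff_conv_add_uminus minus_minus add.commute)
      then show ?thesis using lshift[of "?h * \<i>"] lshift[of "- (?h * \<i>)"] by simp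
    qed
    finally show ?thesis .
  qed
  define M where "M = (K + norm \<kappa>) * K"
  \<comment> \<open>The quotients converge only almost everywhere. Clipping the limit at their
    common bound \<open>M\<close> yields a function that is bounded, measurable and periodic at
    every point.\<close>
  define q where "q z = max (- M) (min M (lim (\<lambda>n. Q n z)))" for z
  have Qper: "Q n (z + w) = Q n z" if "w \<in> \<Lambda>" for n z w
    using per[OF that, of "z + of_real (h n)"] per[OF that, of "z - of_real (h n)"]
      per[OF that, of "z + of_real (h n) * \<i>"] per[OF that, of "z - of_real (h n) * \<i>"]
    by (simp add: Q_def a_def b_def algebra_simps)
  have lim: "AE z in lborel. (\<lambda>n. Q n z) \<longlonglongrightarrow> (norm (\<alpha> z + \<kappa> / 2))\<^sup>2 - (norm (\<beta> z + \<kappa> / 2))\<^sup>2"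
    using deriv
  proof eventually_elim
    case (elim z)
    have "a n z = (v (z + of_real (h n) * 1) - v (z - of_real (h n) * 1)) / of_real (2 * h n)" for n
      by (simp add: a_def)
    then have "(\<lambda>n. a n z) \<longlonglongrightarrow> \<alpha> z + \<beta> z"
      using has_derivative_symmetric_quotient[OF elim h(1,2), of 1] by simp
    moreover have "(\<lambda>n. b n z) \<longlonglongrightarrow> \<alpha> z * \<i> - \<beta> z * \<i>"
      using has_derivative_symmetric_quotient[OF elim h(1,2), of \<i>] by (simp add: b_def)
    ultimately have "(\<lambda>n. Q n z) \<longlonglongrightarrow> Im (cnj (\<alpha> z + \<beta> z + \<kappa>) * (\<alpha> z * \<i> - \<beta> z * \<i>))"
      unfolding Q_def by (intro tendsto_intros)
    \<comment> \<open>Since \<open>\<kappa> Re h\<close> is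
      \<open>\<kappa> / 2 * h + \<kappa> / 2 * cnj h\<close>, the two Wirtinger derivatives of
      \<open>w\<close> are \<open>\<alpha> + \<kappa> / 2\<close> and
      \<open>\<beta> + \<kappa> / 2\<close>, and the Jacobian is the difference of their squared
      moduli.\<close>
    also have "Im (cnj (\<alpha> z + \<beta> z + \<kappa>) * (\<alpha> z * \<i> - \<beta> z * \<i>)) = (norm (\<alpha> z + \<kappa> / 2))\<^sup>2 - (norm (\<beta> z + \<kappa> / 2))\<^sup>2"
      unfolding cmod_power2 by (simp add: power2_eq_square algebra_simps)
    finally show ?case .
  qed
  have limq: "AE z in lborel. q z = (norm (\<alpha> z + \<kappa> / 2))\<^sup>2 - (norm (\<beta> z + \<kappa> / 2))\<^sup>2 \<and> (\<lambda>n. Q n z) \<longlonglongrightarrow> q z"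
    using lim
  proof eventually_elim
    case (elim z)
    have "lim (\<lambda>n. Q n z) = (norm (\<alpha> z + \<kappa> / 2))\<^sup>2 - (norm (\<beta> z + \<kappa> / 2))\<^sup>2"
      using elim by (rule limI)
    moreover have "\<bar>(norm (\<alpha> z + \<kappa> / 2))\<^sup>2 - (norm (\<beta> z + \<kappa> / 2))\<^sup>2\<bar> \<le> M"
      using Qb by (intro LIMSEQ_le_const2[OF tendsto_rabs[OF elim]]) (auto simp: M_def)
    ultimately have "q z = (norm (\<alpha> z + \<kappa> / 2))\<^sup>2 - (norm (\<beta> z + \<kappa> / 2))\<^sup>2"
      by (auto simp: q_def abs_le_iff)
    then show ?case using elim by simp
  qed
  have M0: "M \<ge> 0" using K by (simp add: M_def)
  have [measurable]: "q \<in> borel_measurable borel"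
    unfolding q_def by (intro borel_measurable_max borel_measurable_min borel_measurable_const borel_measurable_lim_metric) measurable
  show ?thesis
  proof (rule that[of q M])
    show "\<bar>q z\<bar> \<le> M" for z using M0 by (auto simp: q_def)
    show "q (z + w) = q z" if "w \<in> \<Lambda>" for z w using Qper[OF that] by (simp add: q_def)
    show "AE z in lborel. q z = (norm (\<alpha> z + \<kappa> / 2))\<^sup>2 - (norm (\<beta> z + \<kappa> / 2))\<^sup>2"
      using limq by eventually_elim simp
    have "(\<lambda>n. \<integral>z. indicator cell z * Q n z \<partial>lborel) \<longlonglongrightarrow> (\<integral>z. indicator cell z * q z \<partial>lborel)"
    proof (rule integral_dominated_convergence[where w = "\<lambda>z. indicator cell z * M"])
      show "integrable lborel (\<lambda>z. indicator cell z * M)"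
        using intg[of "\<lambda>_. M" M] M0 by simp
      show "AE z in lborel. (\<lambda>n. indicator cell z * Q n z) \<longlonglongrightarrow> indicator cell z * q z"
        using limq by eventually_elim (auto intro!: tendsto_intros)
      show "AE z in lborel. norm (indicator cell z * Q n z) \<le> indicator cell z * M" for n
        using Qb by (intro AE_I2) (auto simp: indicator_def M_def)
    qed measurable
    then show "(\<integral>z. indicator cell z * q z \<partial>lborel) = 0"
      by (simp add: Q0 LIMSEQ_const_iff)
  qed measurable
qed
end

section \<open>The quasi-periodic function \<open>P\<close> and its Eisenstein coefficients\<close>

text \<open>Bernoulli numbers are defined by a real series, whereas the expansion of
  \<open>P\<close> is complex. Embedding the coefficients respects products, so it carries the one
  quotient to the other.\<close>

lemma fps_nth_of_real_divide:
  "fps_nth (fps_X / (fps_exp (1::complex) - 1)) k = of_real (bernoulli k / fact k)"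
proof -
  let ?F = "fps_X / (fps_exp (1::real) - 1)"
  let ?M = "\<lambda>f::real fps. Abs_fps (\<lambda>n. complex_of_real (fps_nth f n))"
  have nz: "fps_exp (1::'a::field_char_0) - 1 \<noteq> 0"
  proof
    assume "fps_exp (1::'a) - 1 = 0"
    then have "fps_nth (fps_exp (1::'a) - 1) 1 = 0" by simp
    then show False by simp
  qed
  have sd: "subdegree (fps_exp (1::'a::field_char_0) - 1) = 1"
    by (rule subdegreeI) auto
  have dvd: "fps_exp (1::'a::field_char_0) - 1 dvd fps_X"
    using nz by (subst fps_dvd_iff) (simp_all only: sd subdegree_fps_X fps_X_neq_zero not_False_eq_True order_refl)
  have "?F * (fps_exp 1 - 1) = fps_X"
    by (rule dvd_div_mult_self[OF dvd])
  moreover have "?M (f * g) = ?M f * ?M g" for f g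
    by (rule fps_ext) (simp add: fps_mult_nth)
  moreover have "?M (fps_exp 1 - 1) = fps_exp 1 - 1" "?M fps_X = fps_X"
    by (rule fps_ext, simp add: fps_X_def)+
  ultimately have "?M ?F * (fps_exp 1 - 1) = fps_X" by metis
  then have "fps_X / (fps_exp (1::complex) - 1) = ?M ?F"
    using nz by (metis nonzero_mult_div_cancel_right)
  then show ?thesis by (simp add: bernoulli_def)
qed

context torus
begin

definition "q = exp \<omega>\<^sub>2"

lemma q_nz: "q \<noteq> 0" by (simp add: q_def)

lemma norm_q: "norm q < 1"
  using Im_pos by (simp add: q_def)

text \<open>A Lambert series. For \<open>y = exp z\<close> its poles are the lattice points of the
  rows \<open>- (n + 1) * \<omega>\<^sub>2\<close>, and expanding each term geometrically produces
  the divisor sums.\<close>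

definition lam :: "complex \<Rightarrow> complex" where
  "lam y = (\<Sum>n. q ^ Suc n * y / (1 - q ^ Suc n * y))"

lemma lam_term_bound:
  assumes "norm q ^ N * X \<le> 1 / 2" "norm y \<le> X" "N \<le> n" "0 \<le> X"
  shows "norm (q ^ Suc n * y / (1 - q ^ Suc n * y)) \<le> 2 * X * norm q ^ n"
proof -
  have le: "norm (q ^ Suc n * y) \<le> norm q ^ n * X"
  proof -
    have "norm (q ^ Suc n * y) = norm q * (norm q ^ n * norm y)" by (simp add: norm_mult norm_power)
    also have "\<dots> \<le> 1 * (norm q ^ n * X)"
      using assms norm_q by (intro mult_mono mult_left_mono) auto
    finally show ?thesis by simp
  qed
  have "norm q ^ n * X \<le> norm q ^ N * X"
    using assms norm_q by (intro mult_right_mono power_decreasing) auto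
  then have "norm (q ^ Suc n * y) \<le> 1 / 2" using le assms by linarith
  then have "1 / 2 \<le> norm (1 - q ^ Suc n * y)"
    using norm_triangle_ineq2[of 1 "q ^ Suc n * y"] by simp
  then have "norm (q ^ Suc n * y) / norm (1 - q ^ Suc n * y) \<le> (norm q ^ n * X) / (1 / 2)"
    using le assms by (intro frac_le) auto
  then show ?thesis by (simp add: norm_divide mult_ac)
qed

lemma small_power: obtains N where "norm q ^ N * X \<le> 1 / 2"
proof -
  have "(\<lambda>N. norm q ^ N * X) \<longlonglongrightarrow> 0 * X"
    using norm_q by (intro tendsto_intros LIMSEQ_power_zero) auto
  then have "eventually (\<lambda>N. norm q ^ N * X < 1 / 2) sequentially"
    by (rule order_tendstoD) simp
  then obtain N where "norm q ^ N * X < 1 / 2"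
    unfolding eventually_sequentially by blast
  then show ?thesis using that[of N] by simp
qed

lemma summable_lam: "summable (\<lambda>n. q ^ Suc n * y / (1 - q ^ Suc n * y))"
proof -
  obtain N where N: "norm q ^ N * norm y \<le> 1 / 2" by (rule small_power)
  show ?thesis
  proof (rule summable_comparison_test)
    show "\<exists>N. \<forall>n\<ge>N. norm (q ^ Suc n * y / (1 - q ^ Suc n * y)) \<le> 2 * norm y * norm q ^ n"
      using lam_term_bound[OF N order_refl] by (intro exI[of _ N]) auto
    show "summable (\<lambda>n. 2 * norm y * norm q ^ n)"
      using norm_q by (intro summable_mult summable_geometric) auto
  qed
qed

text \<open>In the disc of radius \<open>X\<close> only the first \<open>N\<close> terms can have
  poles, and the hypothesis keeps \<open>y\<close> away from those. The remaining terms have a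
  geometric majorant on the disc and sum to a holomorphic function.\<close>

lemma lam_differentiable:
  assumes y: "\<And>n. q ^ Suc n * y \<noteq> 1"
  shows "lam field_differentiable at y"
proof -
  define X where "X = norm y + 1"
  obtain N where N: "norm q ^ N * X \<le> 1 / 2" by (rule small_power)
  let ?f = "\<lambda>n y. q ^ Suc n * y / (1 - q ^ Suc n * y)"
  define T where "T = (\<lambda>y. \<Sum>n. ?f (n + N) y)"
  have X: "0 \<le> X" "y \<in> ball 0 X" by (auto simp: X_def)
  have "T holomorphic_on ball 0 X"
  proof (rule holomorphic_uniform_sequence)
    show "(\<lambda>y. \<Sum>n<k. ?f (n + N) y) holomorphic_on ball 0 X" for k
    proof (intro holomorphic_intros)
      fix n z assume "z \<in> ball (0::complex) X"
      then have z: "norm z < X" by simp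
      have "norm (q ^ Suc (n + N) * z) \<le> norm q ^ N * X"
      proof -
        have "norm (q ^ Suc (n + N) * z) = norm q ^ Suc n * (norm q ^ N * norm z)"
          by (simp add: norm_mult norm_power power_add)
        also have "\<dots> \<le> 1 * (norm q ^ N * X)"
          using z norm_q X by (intro mult_mono mult_left_mono power_le_one) auto
        finally show ?thesis by simp
      qed
      then have "norm (q ^ Suc (n + N) * z) < 1" using N by linarith
      then show "1 - q ^ Suc (n + N) * z \<noteq> 0" by (metis eq_iff_diff_eq_0 less_irrefl norm_one)
    qed
    fix z assume z: "z \<in> ball (0::complex) X"
    obtain d where d: "d > 0" "cball z d \<subseteq> ball 0 X"
      using z open_ball by (meson open_contains_cball)
    have "uniform_limit (cball z d) (\<lambda>k y. \<Sum>n<k. ?f (n + N) y) T sequentially"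
      unfolding T_def
    proof (rule Weierstrass_m_test)
      show "norm (?f (n + N) x) \<le> 2 * X * norm q ^ (n + N)" if "x \<in> cball z d" for n x
      proof -
        have "norm x \<le> X" using that d(2) by (auto dest!: subsetD)
        then show ?thesis using lam_term_bound[OF N _ _ X(1), of x "n + N"] by simp
      qed
      show "summable (\<lambda>n. 2 * X * norm q ^ (n + N))"
        unfolding power_add mult.assoc[symmetric]
        using norm_q by (intro summable_mult summable_mult2 summable_geometric) auto
    qed
    then show "\<exists>d>0. cball z d \<subseteq> ball 0 X \<and> uniform_limit (cball z d) (\<lambda>k y. \<Sum>n<k. ?f (n + N) y) T sequentially"
      using d by blast
  qed auto
  then have T: "T field_differentiable at y"
    using X(2) holomorphic_on_imp_differentiable_at by blast
  have eq: "lam = (\<lambda>y. T y + (\<Sum>n<N. ?f n y))"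
    unfolding lam_def T_def using suminf_split_initial_segment[OF summable_lam, of _ N] by blast
  have "(\<lambda>y. \<Sum>n<N. ?f n y) field_differentiable at y"
    using y by (intro field_differentiable_sum field_differentiable_divide derivative_intros) 
      (auto intro!: derivative_intros)
  then show ?thesis unfolding eq using T by (intro field_differentiable_add)
qed

lemma lam_shift: "lam (q * y) = lam y - q * y / (1 - q * y)"
proof -
  have "lam (q * y) = (\<Sum>n. q ^ Suc (Suc n) * y / (1 - q ^ Suc (Suc n) * y))"
    by (simp add: lam_def mult_ac)
  also have "\<dots> = lam y - q * y / (1 - q * y)"
    using suminf_split_head[OF summable_lam[of y]] by (simp add: lam_def)
  finally show ?thesis .
qed

lemma exp_eq_q_power: "q ^ n * exp z = 1 \<Longrightarrow> z \<in> \<Lambda>"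
proof -
  assume "q ^ n * exp z = 1"
  then have "exp (of_nat n * \<omega>\<^sub>2 + z) = 1"
    by (simp add: q_def exp_add exp_of_nat_mult)
  then obtain m :: int where m: "Re (of_nat n * \<omega>\<^sub>2 + z) = 0" "Im (of_nat n * \<omega>\<^sub>2 + z) = of_int (2 * m) * pi"
    by (auto simp: exp_eq_1)
  have "z = of_int (- int n) * \<omega>\<^sub>2 + of_int m * \<omega>\<^sub>1"
    using m by (auto simp: complex_eq_iff)
  then show "z \<in> \<Lambda>" unfolding period_lattice_def by blast
qed

text \<open>The Weierstrass zeta function up to a linear term: residue 1 at every lattice point,
  period \<open>\<omega>\<^sub>1\<close>, increment -1 along \<open>\<omega>\<^sub>2\<close>. The
  summand \<open>1 / 2\<close> makes it odd. Periodicity in \<open>\<omega>\<^sub>1\<close> is what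
  singles out the linear term, whose coefficient becomes minus the Eisenstein series of weight
  2.\<close>

definition P :: "complex \<Rightarrow> complex" where
  "P z = 1 / (exp z - 1) + 1 / 2 - lam (exp z) + lam (exp (- z))"

lemma open_compl_lattice: "open (- \<Lambda>)"
proof -
  have "\<forall>x\<in>\<Lambda>. \<forall>y\<in>\<Lambda>. dist y x < D \<longrightarrow> y = x"
    using norm_lattice[OF lattice_diff] by (metis dist_norm eq_iff_diff_eq_0 not_le)
  then have "closed \<Lambda>"
    by (rule discrete_imp_closed[OF min_length_pos])
  then show ?thesis by (rule open_Compl)
qed

lemma lam_exp_differentiable:
  assumes "z \<notin> \<Lambda> - {0}"
  shows "(\<lambda>z. lam (exp z)) field_differentiable at z" "(\<lambda>z. lam (exp (- z))) field_differentiable at z"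
proof -
  have *: "q ^ Suc n * exp w \<noteq> 1" if "w \<in> {z, - z}" for n w
  proof
    assume eq: "q ^ Suc n * exp w = 1"
    then have "w \<in> \<Lambda>" by (rule exp_eq_q_power)
    then have "w = 0" using that assms lattice_minus[of w] by auto
    then have "norm (q ^ Suc n) = 1" using eq by simp
    then show False using norm_q power_less_one_iff[of "norm q" "Suc n"] by (simp add: norm_power del: power_Suc)
  qed
  have "lam \<circ> exp field_differentiable at z"
    by (rule field_differentiable_compose[OF field_differentiable_within_exp lam_differentiable]) (use * in blast)
  then show "(\<lambda>z. lam (exp z)) field_differentiable at z" by (simp add: o_def)
  have "lam \<circ> (\<lambda>z. exp (- z)) field_differentiable at z"
    by (rule field_differentiable_compose[OF _ lam_differentiable])
       (use * in \<open>auto intro!: derivative_intros field_differentiable_compose[of uminus _ exp, unfolded o_def] field_differentiable_within_exp\<close>)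
  then show "(\<lambda>z. lam (exp (- z))) field_differentiable at z" by (simp add: o_def)
qed

lemma exp_ne_1: "z \<notin> \<Lambda> \<Longrightarrow> exp z \<noteq> 1"
  using exp_eq_q_power[of 0 z] by auto

lemma P_holomorphic: "P holomorphic_on - \<Lambda>"
proof -
  have "P field_differentiable at z" if "z \<in> - \<Lambda>" for z
    unfolding P_def using that exp_ne_1[of z]
    by (intro field_differentiable_add field_differentiable_diff field_differentiable_divide lam_exp_differentiable
         field_differentiable_const field_differentiable_within_exp) auto
  then show ?thesis
    using open_compl_lattice by (simp add: holomorphic_on_open field_differentiable_def)
qed

lemma P_shift1: "P (z + of_int n * \<omega>\<^sub>1) = P z"
proof -
  have "exp (of_int n * \<omega>\<^sub>1) = 1"
    by (auto simp: exp_eq_1)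
  then have e: "exp (z + of_int n * \<omega>\<^sub>1) = exp z"
    unfolding exp_add by simp
  then have "exp (- (z + of_int n * \<omega>\<^sub>1)) = exp (- z)"
    unfolding exp_minus by simp
  with e show ?thesis by (simp add: P_def)
qed

lemma P_shift2:
  assumes "z \<notin> \<Lambda>"
  shows "P (z + \<omega>\<^sub>2) = P z - 1"
proof -
  define x where "x = exp z"
  have x0: "x \<noteq> 0" by (simp add: x_def)
  have x1: "x \<noteq> 1" using exp_ne_1[OF assms] by (simp add: x_def)
  have qx: "q * x \<noteq> 1" using exp_eq_q_power[of 1 z] assms by (auto simp: x_def)
  have e: "exp (z + \<omega>\<^sub>2) = q * x" "exp (- (z + \<omega>\<^sub>2)) = inverse x / q" "exp (- z) = inverse x"
    by (simp_all add: exp_add exp_minus q_def x_def exp_diff divide_inverse)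
  have "lam (inverse x) = lam (q * (inverse x / q))" using q_nz by simp
  also have "\<dots> = lam (inverse x / q) - inverse x / (1 - inverse x)"
    unfolding lam_shift using q_nz by simp
  also have "inverse x / (1 - inverse x) = 1 / (x - 1)"
    using x0 x1 by (simp add: field_simps)
  finally have l: "lam (inverse x / q) = lam (inverse x) + 1 / (x - 1)" by simp
  \<comment> \<open>The shift moves one term into or out of each Lambert series. This identity
    evaluates what fails to cancel, and its right-hand side is the quasi-period.\<close>
  have "1 / (q * x - 1) + q * x / (1 - q * x) = -1"
    using qx by (simp add: divide_simps) (simp add: algebra_simps)
  then show ?thesis
    unfolding P_def e l lam_shift x_def[symmetric] by (simp add: algebra_simps)
qed

lemma P_quasi_periodic:
  assumes z: "z \<notin> \<Lambda>" and w: "w \<in> \<Lambda>"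
  shows "P (z + w) = P z - of_real (t_coord w)"
proof -
  have "\<forall>z. z \<notin> \<Lambda> \<longrightarrow> P (z + of_int m * \<omega>\<^sub>2) = P z - of_int m" for m
  proof (induction m rule: int_induct[where k = 0])
    case (step1 i)
    show ?case
    proof (intro allI impI)
      fix z assume z: "z \<notin> \<Lambda>"
      have z2: "z + \<omega>\<^sub>2 \<notin> \<Lambda>" using z lattice_diff[OF _ lattice_2, of "z + \<omega>\<^sub>2"] by auto
      have "P (z + of_int (i + 1) * \<omega>\<^sub>2) = P (z + \<omega>\<^sub>2 + of_int i * \<omega>\<^sub>2)" by (simp add: algebra_simps)
      also have "\<dots> = P z - of_int (i + 1)" using step1 z z2 P_shift2 by simp
      finally show "P (z + of_int (i + 1) * \<omega>\<^sub>2) = P z - of_int (i + 1)" .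
    qed
  next
    case (step2 i)
    show ?case
    proof (intro allI impI)
      fix z assume z: "z \<notin> \<Lambda>"
      have z2: "z - \<omega>\<^sub>2 \<notin> \<Lambda>" using z lattice_add[OF _ lattice_2, of "z - \<omega>\<^sub>2"] by auto
      have "P (z + of_int (i - 1) * \<omega>\<^sub>2) = P (z - \<omega>\<^sub>2 + of_int i * \<omega>\<^sub>2)" by (simp add: algebra_simps)
      also have "\<dots> = P (z - \<omega>\<^sub>2) - of_int i" using step2 z2 by simp
      also have "P (z - \<omega>\<^sub>2) = P z + 1" using P_shift2[OF z2] by simp
      finally show "P (z + of_int (i - 1) * \<omega>\<^sub>2) = P z - of_int (i - 1)" by simp
    qed
  qed simp
  moreover obtain m n :: int where mn: "w = of_int m * \<omega>\<^sub>2 + of_int n * \<omega>\<^sub>1"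
    using w by (auto simp: period_lattice_def)
  moreover have "t_coord w = of_int m" using coord_of(1)[of "of_int m" "of_int n"] mn by simp
  moreover have "P (z + w) = P (z + of_int m * \<omega>\<^sub>2)"
    using P_shift1[of "z + of_int m * \<omega>\<^sub>2" n] mn by (simp add: add.assoc)
  ultimately show ?thesis using z by simp
qed
definition lambert_sum :: "nat \<Rightarrow> complex" where
  "lambert_sum j = (\<Sum>n. of_nat (divisor_sum j (Suc n)) * q ^ Suc n)"

text \<open>Since \<open>(n + 1) * (d + 1)\<close> is at least \<open>n + (d + 1)\<close>, the
  double series is dominated by the product of two geometric series with ratios
  \<open>norm q\<close> and \<open>norm q * exp x\<close>.\<close>

lemma lambert_double_summable:
  assumes r: "norm q * exp x < 1"
  shows "(\<lambda>(n, d). norm q ^ (Suc n * Suc d) * exp (real (Suc d) * x)) summable_on (UNIV :: (nat \<times> nat) set)"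
proof (rule summable_on_comparison_test)
  let ?r = "norm q * exp x"
  have g: "(\<lambda>n. norm q ^ n) summable_on UNIV" "(\<lambda>d. ?r ^ Suc d) summable_on UNIV"
    using norm_q r by (auto intro!: summable_nonneg_imp_summable_on summable_geometric simp: summable_Suc_iff)
  have "(\<lambda>p. norm (case p of (n, d) \<Rightarrow> norm q ^ n * ?r ^ Suc d)) summable_on UNIV \<times> UNIV"
    unfolding Infinite_Sum.abs_summable_on_Sigma_iff prod.case
  proof (intro conjI ballI)
    fix n :: nat
    have eq: "(\<lambda>d. norm (norm q ^ n * ?r ^ Suc d)) = (\<lambda>d. norm q ^ n * ?r ^ Suc d)"
      by (auto simp: abs_mult)
    show "(\<lambda>d. norm (norm q ^ n * ?r ^ Suc d)) summable_on UNIV"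
      unfolding eq by (rule summable_on_cmult_right[OF g(2)])
  next
    have eq: "(\<lambda>n. norm (\<Sum>\<^sub>\<infinity>d. norm (norm q ^ n * ?r ^ Suc d))) = (\<lambda>n. norm q ^ n * \<bar>\<Sum>\<^sub>\<infinity>d. ?r ^ Suc d\<bar>)"
    proof
      fix n
      have "(\<Sum>\<^sub>\<infinity>d. norm (norm q ^ n * ?r ^ Suc d)) = norm q ^ n * (\<Sum>\<^sub>\<infinity>d. ?r ^ Suc d)"
        by (subst infsum_cmult_right'[symmetric]) (auto simp: abs_mult intro!: infsum_cong)
      then show "norm (\<Sum>\<^sub>\<infinity>d. norm (norm q ^ n * ?r ^ Suc d)) = norm q ^ n * \<bar>\<Sum>\<^sub>\<infinity>d. ?r ^ Suc d\<bar>"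
        by (simp add: abs_mult)
    qed
    show "(\<lambda>n. norm (\<Sum>\<^sub>\<infinity>d. norm (norm q ^ n * ?r ^ Suc d))) summable_on UNIV"
      unfolding eq by (rule summable_on_cmult_left[OF g(1)])
  qed
  then have "(\<lambda>p. norm (case p of (n, d) \<Rightarrow> norm q ^ n * ?r ^ Suc d)) summable_on UNIV" by simp
  also have "(\<lambda>p. norm (case p of (n, d) \<Rightarrow> norm q ^ n * ?r ^ Suc d)) = (\<lambda>(n, d). norm q ^ n * ?r ^ Suc d)"
    by (auto simp: abs_mult fun_eq_iff)
  finally show "(\<lambda>(n, d). norm q ^ n * ?r ^ Suc d) summable_on (UNIV :: (nat \<times> nat) set)" .
  fix p :: "nat \<times> nat"
  obtain n d where p: "p = (n, d)" by (cases p)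
  have "norm q ^ (Suc n * Suc d) = norm q ^ (n * Suc d) * norm q ^ Suc d"
    by (simp add: power_add mult_ac)
  also have "\<dots> \<le> norm q ^ n * norm q ^ Suc d"
    using norm_q by (intro mult_right_mono power_decreasing) auto
  finally have "norm q ^ (Suc n * Suc d) * exp (real (Suc d) * x) \<le> norm q ^ n * norm q ^ Suc d * exp (real (Suc d) * x)"
    by (intro mult_right_mono) auto
  also have "exp (real (Suc d) * x) = exp x ^ Suc d" by (rule exp_of_nat_mult)
  finally show "(case p of (n, d) \<Rightarrow> norm q ^ (Suc n * Suc d) * exp (real (Suc d) * x)) \<le>
    (case p of (n, d) \<Rightarrow> norm q ^ n * ?r ^ Suc d)"
    unfolding p prod.case exp_of_nat_mult power_mult_distrib by (simp only: mult.assoc)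
qed (auto split: prod.split)

lemma lambert_triple_summable:
  assumes r: "norm q * exp (norm z) < 1"
  shows "(\<lambda>x. norm (case x of (p, j) \<Rightarrow> (case p of (n, d) \<Rightarrow> q ^ (Suc n * Suc d) * ((of_nat (Suc d) * z) ^ j / fact j))))
    summable_on (UNIV :: (nat \<times> nat) set) \<times> (UNIV :: nat set)"
  unfolding Infinite_Sum.abs_summable_on_Sigma_iff prod.case
proof (intro conjI ballI)
  have hs: "((\<lambda>j. norm (case p of (n, d) \<Rightarrow> q ^ (Suc n * Suc d) * ((of_nat (Suc d) * z) ^ j / fact j)))
      has_sum (case p of (n, d) \<Rightarrow> norm q ^ (Suc n * Suc d) * exp (real (Suc d) * norm z))) UNIV" for p :: "nat \<times> nat"
  proof -
    obtain n d where p: "p = (n, d)" by (cases p)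
    have "(\<lambda>j. (real (Suc d) * norm z) ^ j /\<^sub>R fact j) sums exp (real (Suc d) * norm z)"
      by (rule exp_converges)
    then have "(\<lambda>j. norm q ^ (Suc n * Suc d) * ((real (Suc d) * norm z) ^ j /\<^sub>R fact j)) sums (norm q ^ (Suc n * Suc d) * exp (real (Suc d) * norm z))"
      by (rule sums_mult)
    then have "((\<lambda>j. norm q ^ (Suc n * Suc d) * ((real (Suc d) * norm z) ^ j /\<^sub>R fact j)) has_sum (norm q ^ (Suc n * Suc d) * exp (real (Suc d) * norm z))) UNIV"
      by (intro sums_nonneg_imp_has_sum) auto
    also have "(\<lambda>j. norm q ^ (Suc n * Suc d) * ((real (Suc d) * norm z) ^ j /\<^sub>R fact j)) = 
       (\<lambda>j. norm (q ^ (Suc n * Suc d) * ((of_nat (Suc d) * z) ^ j / fact j)))"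
      unfolding norm_mult norm_power norm_divide norm_of_nat norm_fact by (simp add: divide_inverse_commute)
    finally show ?thesis by (simp only: p prod.case)
  qed
  show "(\<lambda>j. norm (case p of (n, d) \<Rightarrow> q ^ (Suc n * Suc d) * ((of_nat (Suc d) * z) ^ j / fact j))) summable_on UNIV"
    for p :: "nat \<times> nat"
    using hs[of p] has_sum_imp_summable by blast
  have "(\<lambda>p. norm (\<Sum>\<^sub>\<infinity>j. norm (case p of (n, d) \<Rightarrow> q ^ (Suc n * Suc d) * ((of_nat (Suc d) * z) ^ j / fact j)))) =
     (\<lambda>(n, d). norm q ^ (Suc n * Suc d) * exp (real (Suc d) * norm z))"
    unfolding infsumI[OF hs] by (auto simp: fun_eq_iff abs_mult)
  then show "(\<lambda>p::nat \<times> nat. norm (\<Sum>\<^sub>\<infinity>j. norm (case p of (n, d) \<Rightarrow> q ^ (Suc n * Suc d) * ((of_nat (Suc d) * z) ^ j / fact j)))) summable_on UNIV"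
    using lambert_double_summable[OF r] by simp
qed

lemma lambert_small: obtains x :: real where "x > 0" "norm q * exp x < 1"
proof -
  have "((\<lambda>x. norm q * exp x) \<longlongrightarrow> norm q * exp 0) (at_right 0)"
    by (intro tendsto_intros)
  then have "eventually (\<lambda>x. norm q * exp x < 1) (at_right (0::real))"
    by (rule order_tendstoD) (use norm_q in simp)
  moreover have "eventually (\<lambda>x::real. x > 0) (at_right 0)" by (rule eventually_at_right_less)
  ultimately have "eventually (\<lambda>x. norm q * exp x < 1 \<and> x > 0) (at_right (0::real))"
    by (rule eventually_conj)
  then show ?thesis using that eventually_happens'[OF trivial_limit_at_right_real] by blast
qed

text \<open>Pairs are grouped by the product \<open>N = (n + 1) * (d + 1)\<close>, with
  \<open>d + 1\<close> running through the divisors of \<open>N\<close>. Summability is inherited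
  from the triple series at a small positive \<open>x\<close>, whose part of fixed index
  \<open>j\<close> differs only by the factor \<open>x ^ j / fact j\<close>.\<close>

lemma lambert_sum_double:
  "((\<lambda>(n, d). q ^ (Suc n * Suc d) * of_nat (Suc d) ^ j) has_sum lambert_sum j) (UNIV :: (nat \<times> nat) set)"
proof -
  obtain x :: real where x: "x > 0" "norm q * exp x < 1" by (rule lambert_small)
  define f where "f = (\<lambda>(n, d). q ^ (Suc n * Suc d) * of_nat (Suc d) ^ j)"
  have "(\<lambda>(j, p). (case p of (n, d) \<Rightarrow> q ^ (Suc n * Suc d) * ((of_nat (Suc d) * complex_of_real x) ^ j / fact j)))
    summable_on (UNIV :: nat set) \<times> (UNIV :: (nat \<times> nat) set)"
    using abs_summable_summable[OF lambert_triple_summable[of "complex_of_real x"]] x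
    by (subst summable_on_swap) (simp add: case_prod_unfold)
  from summable_on_SigmaD1[OF this UNIV_I[of j]]
  have "(\<lambda>(n, d). q ^ (Suc n * Suc d) * ((of_nat (Suc d) * complex_of_real x) ^ j / fact j)) summable_on (UNIV :: (nat \<times> nat) set)"
    by (simp add: case_prod_unfold)
  then have "(\<lambda>p. (case p of (n, d) \<Rightarrow> q ^ (Suc n * Suc d) * ((of_nat (Suc d) * complex_of_real x) ^ j / fact j)) * (fact j / complex_of_real x ^ j)) summable_on (UNIV :: (nat \<times> nat) set)"
    by (rule summable_on_cmult_left)
  also have "(\<lambda>p. (case p of (n, d) \<Rightarrow> q ^ (Suc n * Suc d) * ((of_nat (Suc d) * complex_of_real x) ^ j / fact j)) * (fact j / complex_of_real x ^ j)) = f"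
    using x by (auto simp: f_def fun_eq_iff power_mult_distrib simp del: of_nat_Suc)
  finally have sf: "f summable_on UNIV" .
  let ?S = "Sigma {1::nat..} (\<lambda>N. {d. d dvd N})"
  have bij: "bij_betw (\<lambda>(n, d). (Suc n * Suc d, Suc d)) UNIV ?S"
  proof (rule bij_betwI[where g = "\<lambda>(N, d). (N div d - 1, d - 1)"])
    show "(\<lambda>(N, d). (N div d - 1, d - 1)) \<in> ?S \<rightarrow> UNIV" by simp
    show "(case case x of (n, d) \<Rightarrow> (Suc n * Suc d, Suc d) of (N, d) \<Rightarrow> (N div d - 1, d - 1)) = x" for x :: "nat \<times> nat"
      by (cases x) (simp del: mult_Suc mult_Suc_right)
    show "(case case x of (N, d) \<Rightarrow> (N div d - 1, d - 1) of (n, d) \<Rightarrow> (Suc n * Suc d, Suc d)) = x" if "x \<in> ?S" for x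
    proof -
      obtain N d where Nd: "x = (N, d)" "N \<ge> 1" "d dvd N" using \<open>x \<in> ?S\<close> by auto
      then have "d > 0" "N div d > 0" using dvd_imp_le[of d N] by (auto intro: Nat.gr0I simp: div_greater_zero_iff)
      then have "Suc (N div d - 1) = N div d" "Suc (d - 1) = d" by simp_all
      then show ?thesis using Nd by (simp only: prod.case dvd_div_mult_self)
    qed
    show "(\<lambda>(n, d). (Suc n * Suc d, Suc d)) \<in> UNIV \<rightarrow> ?S"
    proof
      fix p :: "nat \<times> nat"
      obtain n d where p: "p = (n, d)" by (cases p)
      have "1 \<le> Suc n * Suc d" by simp
      then show "(case p of (n, d) \<Rightarrow> (Suc n * Suc d, Suc d)) \<in> ?S"
        unfolding p prod.case by (auto simp del: mult_Suc mult_Suc_right)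
    qed
  qed
  define g where "g = (\<lambda>(N::nat, d::nat). q ^ N * of_nat d ^ j)"
  have fg: "f = (\<lambda>p. g ((\<lambda>(n, d). (Suc n * Suc d, Suc d)) p))"
    by (auto simp: f_def g_def fun_eq_iff simp del: of_nat_Suc mult_Suc mult_Suc_right)
  have "(f has_sum infsum f UNIV) UNIV" using sf by simp
  then have gs: "(g has_sum infsum f UNIV) ?S"
    unfolding fg using has_sum_reindex_bij_betw[OF bij, of g] by blast
  have "((\<lambda>N. of_nat (divisor_sum j N) * q ^ N) has_sum infsum f UNIV) {1..}"
  proof (rule has_sum_SigmaD[OF gs])
    fix N :: nat assume "N \<in> {1..}"
    then have fin: "finite {d. d dvd N}" by auto
    have "of_nat (divisor_sum j N) * q ^ N = (\<Sum>d | d dvd N. g (N, d))"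
      by (simp add: g_def divisor_sum_def sum_distrib_left mult.commute)
    then show "((\<lambda>d. g (N, d)) has_sum of_nat (divisor_sum j N) * q ^ N) {d. d dvd N}"
      by (rule has_sum_finiteI[OF fin])
  qed
  moreover have "bij_betw Suc UNIV {1..}"
    by (rule bij_betwI[where g = "\<lambda>n. n - 1"]) auto
  ultimately have "((\<lambda>n. of_nat (divisor_sum j (Suc n)) * q ^ Suc n) has_sum infsum f UNIV) UNIV"
    using has_sum_reindex_bij_betw[of Suc UNIV "{1..}" "\<lambda>N. of_nat (divisor_sum j N) * q ^ N" "infsum f UNIV"] by blast
  then have "lambert_sum j = infsum f UNIV"
    unfolding lambert_sum_def by (metis has_sum_imp_sums sums_unique)
  then show ?thesis using sf by (simp add: f_def)
qed

text \<open>One absolutely convergent triple sum in two orders: summing first over \<open>j\<close>,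
  the index of the exponential series, and then over \<open>d\<close> gives the terms of
  \<open>lam\<close>; summing first over the pairs \<open>(n, d)\<close> gives the power series in
  \<open>z\<close>.\<close>

lemma lam_exp_sums:
  assumes r: "norm q * exp (norm z) < 1"
  shows "(\<lambda>j. lambert_sum j / fact j * z ^ j) sums lam (exp z)"
proof -
  define a where "a = (\<lambda>p j. (case p of (n, d) \<Rightarrow> q ^ (Suc n * Suc d) * ((of_nat (Suc d) * z) ^ j / fact j)))"
  have sa: "(\<lambda>(p, j). a p j) summable_on (UNIV :: (nat \<times> nat) set) \<times> UNIV"
    using abs_summable_summable[OF lambert_triple_summable[OF r]] by (simp add: a_def)
  have inner: "(a p has_sum (case p of (n, d) \<Rightarrow> q ^ (Suc n * Suc d) * exp (of_nat (Suc d) * z))) UNIV" for p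
  proof -
    obtain n d where p: "p = (n, d)" by (cases p)
    have "(\<lambda>j. (of_nat (Suc d) * z) ^ j /\<^sub>R fact j) sums exp (of_nat (Suc d) * z)" by (rule exp_converges)
    then have "(\<lambda>j. (of_nat (Suc d) * z) ^ j / fact j) sums exp (of_nat (Suc d) * z)"
      by (simp add: scaleR_conv_of_real divide_inverse_commute del: of_nat_Suc)
    from sums_mult[OF this, of "q ^ (Suc n * Suc d)"]
    have "a p sums (q ^ (Suc n * Suc d) * exp (of_nat (Suc d) * z))"
      by (simp only: a_def p prod.case)
    moreover have "a p summable_on UNIV" by (rule summable_on_SigmaD1[OF sa UNIV_I])
    ultimately show ?thesis
      by (metis (no_types, lifting) has_sum_infsum has_sum_imp_sums sums_unique2 p prod.case)
  qed
  define I where "I = infsum (\<lambda>(p, j). a p j) (UNIV \<times> UNIV)"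
  have hI: "((\<lambda>(p, j). a p j) has_sum I) (UNIV \<times> UNIV)" using sa by (simp add: I_def)
  have "((\<lambda>p. case p of (n, d) \<Rightarrow> q ^ (Suc n * Suc d) * exp (of_nat (Suc d) * z)) has_sum I) (UNIV \<times> UNIV)"
    using has_sum_SigmaD[OF hI, of "\<lambda>p. case p of (n, d) \<Rightarrow> q ^ (Suc n * Suc d) * exp (of_nat (Suc d) * z)"] inner by simp
  then have "((\<lambda>n. q ^ Suc n * exp z / (1 - q ^ Suc n * exp z)) has_sum I) UNIV"
  proof (rule has_sum_SigmaD)
    fix n :: nat
    let ?y = "q ^ Suc n * exp z"
    have "norm ?y \<le> norm q * exp (norm z)"
    proof -
      have "norm ?y = norm q ^ n * (norm q * exp (Re z))" by (simp add: norm_mult norm_power)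
      also have "\<dots> \<le> 1 * (norm q * exp (norm z))"
        using norm_q complex_Re_le_cmod[of z] by (intro mult_mono power_le_one mult_left_mono) auto
      finally show ?thesis by simp
    qed
    then have y: "norm ?y < 1" using r by linarith
    have "(\<lambda>d. ?y ^ d) sums (1 / (1 - ?y))" by (rule geometric_sums[OF y])
    from sums_mult[OF this, of ?y] have "(\<lambda>d. ?y ^ Suc d) sums (?y / (1 - ?y))" by simp
    moreover have "summable (\<lambda>d. norm (?y ^ Suc d))"
      unfolding norm_power using y by (subst summable_Suc_iff) (intro summable_geometric, simp)
    ultimately have "((\<lambda>d. ?y ^ Suc d) has_sum (?y / (1 - ?y))) UNIV"
      by (intro norm_summable_imp_has_sum)
    also have "(\<lambda>d. ?y ^ Suc d) = (\<lambda>d. case (n, d) of (n, d) \<Rightarrow> q ^ (Suc n * Suc d) * exp (of_nat (Suc d) * z))"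
      unfolding prod.case power_mult_distrib power_mult exp_of_nat_mult ..
    finally show "((\<lambda>d. case (n, d) of (n, d) \<Rightarrow> q ^ (Suc n * Suc d) * exp (of_nat (Suc d) * z)) has_sum (?y / (1 - ?y))) UNIV" .
  qed
  then have I: "I = lam (exp z)"
    unfolding lam_def by (metis has_sum_imp_sums sums_unique)
  have "((\<lambda>(j, p). a p j) has_sum I) (UNIV \<times> UNIV)"
    using hI by (subst has_sum_swap) (simp only: prod.case)
  then have "((\<lambda>j. lambert_sum j / fact j * z ^ j) has_sum I) UNIV"
  proof (rule has_sum_SigmaD)
    fix j :: nat
    from has_sum_cmult_right[OF lambert_sum_double[of j], of "z ^ j / fact j"]
    show "((\<lambda>p. case (j, p) of (j, p) \<Rightarrow> a p j) has_sum (lambert_sum j / fact j * z ^ j)) UNIV"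
      by (simp add: a_def case_prod_unfold power_mult_distrib mult_ac del: of_nat_Suc)
  qed
  then show ?thesis unfolding I by (rule has_sum_imp_sums)
qed
lemma has_fps_expansion_eventually_sums:
  fixes f :: "complex \<Rightarrow> complex"
  assumes "f has_fps_expansion F"
  shows "eventually (\<lambda>z. (\<lambda>n. fps_nth F n * z ^ n) sums f z) (nhds 0)"
proof -
  have "eventually (\<lambda>z. z \<in> eball 0 (fps_conv_radius F)) (nhds (0::complex))"
    using assms by (intro eventually_nhds_in_open) (auto simp: has_fps_expansion_def zero_ereal_def)
  moreover have "eventually (\<lambda>z. eval_fps F z = f z) (nhds 0)"
    using assms by (simp add: has_fps_expansion_def)
  ultimately show ?thesis
  proof eventually_elim
    case (elim z)
    then show ?case using sums_eval_fps[of z F] by simp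
  qed
qed

text \<open>The value 0 at the origin is the one that removes the singularity, because
  \<open>P\<close> is odd.\<close>

definition reg :: "complex \<Rightarrow> complex" where
  "reg z = (if z = 0 then 0 else P z - 1 / z)"

lemma P_minus: "z \<notin> \<Lambda> \<Longrightarrow> P (- z) = - P z"
proof -
  assume "z \<notin> \<Lambda>"
  then have "exp z \<noteq> 1" by (rule exp_ne_1)
  then have "1 / (exp (- z) - 1) + 1 / 2 = - (1 / (exp z - 1) + 1 / 2)"
    by (simp add: exp_minus divide_simps) (simp add: algebra_simps)
  then show ?thesis by (simp add: P_def)
qed

lemma near_0_notin_lattice: "norm z < D \<Longrightarrow> z \<noteq> 0 \<Longrightarrow> z \<notin> \<Lambda>"
  using norm_lattice[of z] by auto

lemma eventually_near_0: "eventually (\<lambda>z. norm z < r) (nhds (0::complex))" if "r > 0"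
  using eventually_nhds_ball[OF that, of "0::complex"] by simp

text \<open>The first summand of \<open>P\<close> contributes the Bernoulli series. The two Lambert
  series enter at \<open>z\<close> and \<open>- z\<close> with opposite signs and so reinforce each
  other in odd degrees. Even coefficients are left open here; parity settles them in
  \<open>reg_has_fps_expansion\<close>.\<close>

lemma reg_fps_exists: "\<exists>R. reg has_fps_expansion R \<and>
   (\<forall>n. odd n \<longrightarrow> fps_nth R n = of_real (bernoulli (Suc n) / fact (Suc n)) - 2 * lambert_sum n / fact n)"
proof -
  define F :: "complex fps" where "F = fps_X / (fps_exp 1 - 1)"
  have Fn: "fps_nth F k = of_real (bernoulli k / fact k)" for k
    unfolding F_def by (rule fps_nth_of_real_divide)
  have nz: "fps_exp (1::complex) - 1 \<noteq> 0"
  proof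
    assume "fps_exp (1::complex) - 1 = 0"
    then have "fps_nth (fps_exp (1::complex) - 1) 1 = 0" by simp
    then show False by simp
  qed
  have sd: "subdegree (fps_exp (1::complex) - 1) = 1"
    by (rule subdegreeI) auto
  have mult: "F * (fps_exp 1 - 1) = fps_X"
    unfolding F_def by (rule dvd_div_mult_self)
      (simp only: fps_dvd_iff[OF nz fps_X_neq_zero] sd subdegree_fps_X order_refl)
  have "fps_nth (F * (fps_exp 1 - 1)) 1 = 1" "fps_nth (F * (fps_exp 1 - 1)) 2 = 0"
    unfolding mult by simp_all
  then have F0: "fps_nth F 0 = 1" and F1: "fps_nth F 1 = - 1 / 2"
    by (simp_all add: fps_mult_nth numeral_2_eq_2 field_simps add_eq_0_iff)
  let ?B = "\<lambda>z::complex. if z = 0 then 1 else z / (exp z - 1)"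
  have "?B has_fps_expansion F"
    unfolding F_def
  proof (rule has_fps_expansion_divide)
    show "(\<lambda>x::complex. x) has_fps_expansion fps_X" by (rule has_fps_expansion_fps_X)
    show "(\<lambda>x::complex. exp x - 1) has_fps_expansion fps_exp 1 - 1"
      using has_fps_expansion_exp[of "1::complex"] by (intro fps_expansion_intros)
    show "subdegree (fps_exp (1::complex) - 1) \<le> subdegree (fps_X :: complex fps)"
      unfolding sd by simp
    show "(1::complex) = fps_nth fps_X (subdegree (fps_exp (1::complex) - 1)) / fps_nth (fps_exp 1 - 1) (subdegree (fps_exp (1::complex) - 1))"
      unfolding sd by simp
  qed (rule nz)
  then have "eventually (\<lambda>z. (\<lambda>n. fps_nth F n * z ^ n) sums ?B z) (nhds 0)"
    by (rule has_fps_expansion_eventually_sums)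
  then have "eventually (\<lambda>z. (\<lambda>n. fps_nth F (Suc n) * z ^ n) sums (if z = 0 then - 1 / 2 else (?B z - 1) / z)) (nhds 0)"
  proof eventually_elim
    case (elim z)
    show ?case
    proof (cases "z = 0")
      case True
      then show ?thesis using powser_sums_zero[of "\<lambda>n. fps_nth F (Suc n)"] F1 by simp
    next
      case False
      have "(\<lambda>n. fps_nth F (Suc n) * z ^ Suc n) sums (?B z - 1)"
        using elim sums_Suc_iff[of "\<lambda>n. fps_nth F n * z ^ n" "?B z - 1"] by (simp add: F0)
      from sums_divide[OF this, of z] show ?thesis using False by simp
    qed
  qed
  then have B: "eventually (\<lambda>z. (\<lambda>n. fps_nth F (Suc n) * z ^ n) sums (if z = 0 then - 1 / 2 else (?B z - 1) / z)) (nhds 0)" .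
  obtain x :: real where x: "x > 0" "norm q * exp x < 1" by (rule lambert_small)
  define R where "R = Abs_fps (\<lambda>n. fps_nth F (Suc n) + (if n = 0 then 1 / 2 else 0) - lambert_sum n / fact n + (-1) ^ n * (lambert_sum n / fact n))"
  have "eventually (\<lambda>z. (\<lambda>n. fps_nth R n * z ^ n) sums reg z) (nhds 0)"
    using B eventually_near_0[OF x(1)] eventually_near_0[OF min_length_pos]
  proof eventually_elim
    case (elim z)
    have "norm q * exp (norm z) \<le> norm q * exp x" using elim(2) by (intro mult_left_mono) auto
    then have r: "norm q * exp (norm z) < 1" "norm q * exp (norm (- z)) < 1" using x(2) by simp_all
    have half: "(\<lambda>n. (if n = 0 then 1 / 2 else 0) * z ^ n) sums (1 / 2)"
      using sums_single[of 0 "\<lambda>_. 1 / 2 :: complex"] by (simp add: if_distrib[of "\<lambda>x. x * _"] cong: if_cong)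
    have "(\<lambda>n. fps_nth F (Suc n) * z ^ n + (if n = 0 then 1 / 2 else 0) * z ^ n - lambert_sum n / fact n * z ^ n + lambert_sum n / fact n * (- z) ^ n)
      sums ((if z = 0 then - 1 / 2 else (?B z - 1) / z) + 1 / 2 - lam (exp z) + lam (exp (- z)))"
      by (intro sums_add sums_diff elim(1) half lam_exp_sums r)
    also have "(\<lambda>n. fps_nth F (Suc n) * z ^ n + (if n = 0 then 1 / 2 else 0) * z ^ n - lambert_sum n / fact n * z ^ n + lambert_sum n / fact n * (- z) ^ n)
       = (\<lambda>n. fps_nth R n * z ^ n)"
      unfolding power_minus[of z] by (simp add: R_def fun_eq_iff algebra_simps)
    also have "(if z = 0 then - 1 / 2 else (?B z - 1) / z) + 1 / 2 - lam (exp z) + lam (exp (- z)) = reg z"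
    proof (cases "z = 0")
      case False
      then have "exp z \<noteq> 1" using exp_ne_1 near_0_notin_lattice elim(3) by blast
      then have "(z / (exp z - 1) - 1) / z = 1 / (exp z - 1) - 1 / z"
        using False by (simp add: diff_divide_distrib)
      then show ?thesis using False by (simp add: reg_def P_def)
    qed (simp add: reg_def)
    finally show ?case .
  qed
  then have "reg has_fps_expansion R" by (rule has_fps_expansionI)
  moreover have "fps_nth R n = of_real (bernoulli (Suc n) / fact (Suc n)) - 2 * lambert_sum n / fact n" if "odd n" for n
    using that by (cases "n = 0") (auto simp: R_def Fn)
  ultimately show ?thesis by blast
qed

text \<open>Comparing the series of \<open>reg\<close> with that of \<open>- reg (- z)\<close> makes
  the even coefficients vanish, in accordance with the convention that Eisenstein series of odd
  weight are zero.\<close>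

lemma reg_has_fps_expansion: "reg has_fps_expansion Abs_fps (\<lambda>n. - eisenstein (Suc n) \<tau>)"
proof -
  obtain R where R: "reg has_fps_expansion R"
    "\<And>n. odd n \<Longrightarrow> fps_nth R n = of_real (bernoulli (Suc n) / fact (Suc n)) - 2 * lambert_sum n / fact n"
    using reg_fps_exists by blast
  have "eventually (\<lambda>z. (\<lambda>n. fps_nth R n * z ^ n) sums reg z) (nhds 0)"
    by (rule has_fps_expansion_eventually_sums[OF R(1)])
  moreover have "filterlim uminus (nhds 0) (nhds (0::complex))"
    using tendsto_minus[OF filterlim_ident, of "0::complex"] by simp
  ultimately have "eventually (\<lambda>z. (\<lambda>n. fps_nth R n * (- z) ^ n) sums reg (- z)) (nhds 0)"
    by (rule eventually_compose_filterlim)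
  then have "eventually (\<lambda>z. (\<lambda>n. fps_nth (Abs_fps (\<lambda>n. - ((- 1) ^ n * fps_nth R n))) n * z ^ n) sums reg z) (nhds 0)"
    using eventually_near_0[OF min_length_pos]
  proof eventually_elim
    case (elim z)
    have "reg (- z) = - reg z"
      using near_0_notin_lattice[OF elim(2)] P_minus[of z] by (auto simp: reg_def)
    then have "(\<lambda>n. - (fps_nth R n * (- z) ^ n)) sums reg z"
      using sums_minus[OF elim(1)] by simp
    also have "(\<lambda>n. - (fps_nth R n * (- z) ^ n)) = (\<lambda>n. fps_nth (Abs_fps (\<lambda>n. - ((- 1) ^ n * fps_nth R n))) n * z ^ n)"
      unfolding power_minus[of z] by (simp add: fun_eq_iff)
    finally show ?case .
  qed
  then have "reg has_fps_expansion Abs_fps (\<lambda>n. - ((- 1) ^ n * fps_nth R n))"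
    by (rule has_fps_expansionI)
  then have "R = Abs_fps (\<lambda>n. - ((- 1) ^ n * fps_nth R n))"
    using R(1) fps_expansion_unique_complex by blast
  then have Rn: "fps_nth R n = - ((- 1) ^ n * fps_nth R n)" for n
    by (metis fps_nth_Abs_fps)
  have "R = Abs_fps (\<lambda>n. - eisenstein (Suc n) \<tau>)"
  proof (rule fps_ext)
    fix n
    show "fps_nth R n = fps_nth (Abs_fps (\<lambda>n. - eisenstein (Suc n) \<tau>)) n"
    proof (cases "even n")
      case True
      then have "fps_nth R n = - fps_nth R n" using Rn[of n] by simp
      then show ?thesis using True by (simp add: eisenstein_def)
    next
      case False
      then show ?thesis using R(2)[OF False]
        by (simp add: eisenstein_def lambert_sum_def q_def del: of_nat_Suc fact_Suc)
    qed
  qed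
  then show ?thesis using R(1) by simp
qed

lemma higher_deriv_reg: "(deriv ^^ n) reg 0 = - fact n * eisenstein (Suc n) \<tau>"
  using fps_nth_fps_expansion[OF reg_has_fps_expansion, of n] by (simp add: field_simps)

lemma reg_holomorphic: "reg holomorphic_on ball 0 D"
proof -
  obtain s where s: "open s" "0 \<in> s" "reg holomorphic_on s"
    using has_fps_expansion_imp_holomorphic[OF reg_has_fps_expansion] by metis
  have "reg holomorphic_on ball 0 D - {0}"
  proof (rule holomorphic_transform)
    show "(\<lambda>z. P z - 1 / z) holomorphic_on ball 0 D - {0}"
      by (intro holomorphic_intros holomorphic_on_subset[OF P_holomorphic]) (use near_0_notin_lattice in auto)
  qed (auto simp: reg_def)
  then have "reg holomorphic_on (ball 0 D - {0}) \<union> s"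
    using s by (intro holomorphic_on_Un) auto
  then show ?thesis by (rule holomorphic_on_subset) (use s in auto)
qed

lemma P_eq_reg: "z \<noteq> 0 \<Longrightarrow> P z = 1 / z + reg z"
  by (simp add: reg_def)
end

section \<open>The area theorem on the torus\<close>

lemma holomorphic_lipschitz_cball:
  assumes "f holomorphic_on A" "open A" "cball c r \<subseteq> A"
  obtains L where "L-lipschitz_on (cball c r) f"
proof -
  have "continuous_on (cball c r) (deriv f)"
    by (rule holomorphic_on_imp_continuous_on, rule holomorphic_on_subset[OF holomorphic_deriv[OF assms(1,2)] assms(3)])
  then have "bounded (deriv f ` cball c r)"
    by (intro compact_imp_bounded compact_continuous_image) auto
  then obtain B where B: "\<And>z. z \<in> cball c r \<Longrightarrow> norm (deriv f z) \<le> B"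
    by (meson bounded_iff imageI)
  have "norm (f x - f y) \<le> max B 0 * norm (x - y)" if "x \<in> cball c r" "y \<in> cball c r" for x y
  proof (rule field_differentiable_bound[of "cball c r" f "deriv f"])
    show "(f has_field_derivative deriv f z) (at z within cball c r)" if "z \<in> cball c r" for z
      using holomorphic_derivI[OF assms(1,2)] assms(3) that by (blast intro: has_field_derivative_at_within)
    show "norm (deriv f z) \<le> max B 0" if "z \<in> cball c r" for z using B[OF that] by simp
  qed (use that in auto)
  then show ?thesis by (intro that[of "max B 0"] lipschitz_onI) (auto simp: dist_norm)
qed

text \<open>
  On the circle of radius \<open>R\<close> the principal part \<open>1 / z ^ l\<close> agrees with the antiholomorphic
  function \<open>(cnj z / R\<^sup>2) ^ l\<close>, which continues it into the disc.
\<close>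

definition fill :: "real \<Rightarrow> complex \<Rightarrow> complex" where
  "fill R z = (if norm z \<le> R then cnj z / of_real (R\<^sup>2) else 1 / z)"

text \<open>For points on opposite sides of the circle the estimate rests on an identity: the
  squared modulus of \<open>cnj x * y - R\<^sup>2\<close> minus \<open>R\<^sup>2\<close> times the
  squared distance of \<open>x\<close> and \<open>y\<close> is the product of
  \<open>(norm x)\<^sup>2 - R\<^sup>2\<close> and \<open>(norm y)\<^sup>2 - R\<^sup>2\<close>, which
  is then not positive.\<close>

lemma fill_lipschitz:
  assumes R: "R > 0"
  shows "norm (fill R x - fill R y) \<le> norm (x - y) / R\<^sup>2"
proof -
  have mixed: "norm (cnj x / of_real (R\<^sup>2) - 1 / y) \<le> norm (x - y) / R\<^sup>2" if x: "norm x \<le> R" and y: "norm y > R" for x y :: complex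
  proof -
    have y0: "y \<noteq> 0" using y R by auto
    have id: "(norm (cnj x * y - of_real (R\<^sup>2)))\<^sup>2 - (R * norm (x - y))\<^sup>2 = ((norm x)\<^sup>2 - R\<^sup>2) * ((norm y)\<^sup>2 - R\<^sup>2)"
      unfolding power_mult_distrib cmod_power2 by (simp add: power2_eq_square) algebra
    also have "\<dots> \<le> 0"
      using power_mono[OF x norm_ge_zero, of 2] power_mono[of R "norm y" 2] y R
      by (intro mult_nonpos_nonneg) simp_all
    finally have "(norm (cnj x * y - of_real (R\<^sup>2)))\<^sup>2 \<le> (R * norm (x - y))\<^sup>2" by linarith
    then have le: "norm (cnj x * y - of_real (R\<^sup>2)) \<le> R * norm (x - y)"
      by (rule power2_le_imp_le) (use R in simp)
    have "cnj x / of_real (R\<^sup>2) - 1 / y = (cnj x * y - of_real (R\<^sup>2)) / (of_real (R\<^sup>2) * y)"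
      using y0 R by (simp add: field_simps)
    then have "norm (cnj x / of_real (R\<^sup>2) - 1 / y) = norm (cnj x * y - of_real (R\<^sup>2)) / (R\<^sup>2 * norm y)"
      by (simp only: norm_divide norm_mult norm_of_real abs_power2)
    also have "\<dots> \<le> (R * norm (x - y)) / (R\<^sup>2 * R)"
      using le y R by (intro frac_le mult_left_mono) auto
    also have "\<dots> = norm (x - y) / R\<^sup>2" using R by simp
    finally show ?thesis .
  qed
  consider "norm x \<le> R" "norm y \<le> R" | "norm x \<le> R" "norm y > R" | "norm x > R" "norm y \<le> R"
    | "norm x > R" "norm y > R" by linarith
  then show ?thesis
  proof cases
    case 1
    then have "norm (fill R x - fill R y) = norm (cnj (x - y)) / R\<^sup>2"
      by (simp add: fill_def norm_divide norm_power flip: diff_divide_distrib del: complex_mod_cnj)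
    then show ?thesis by (simp only: complex_mod_cnj order_refl)
  next
    case 2
    then show ?thesis using mixed[of x y] by (simp add: fill_def)
  next
    case 3
    then show ?thesis using mixed[of y x] by (simp add: fill_def norm_minus_commute)
  next
    case 4
    then have nz: "x \<noteq> 0" "y \<noteq> 0" using R by auto
    then have "fill R x - fill R y = (y - x) / (x * y)"
      using 4 by (simp add: fill_def field_simps)
    then have "norm (fill R x - fill R y) = norm (x - y) / (norm x * norm y)"
      by (simp add: norm_divide norm_mult norm_minus_commute)
    also have "\<dots> \<le> norm (x - y) / (R * R)"
      using 4 R by (intro divide_left_mono mult_mono mult_pos_pos) auto
    finally show ?thesis by (simp add: power2_eq_square)
  qed
qed

lemma norm_fill: "R > 0 \<Longrightarrow> norm (fill R z) \<le> 1 / R"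
proof (cases "norm z \<le> R")
  case True
  assume R: "R > 0"
  have "norm (fill R z) = norm z / R\<^sup>2"
    using True by (simp add: fill_def norm_divide del: of_real_power)
  also have "\<dots> \<le> R / R\<^sup>2" using True by (intro divide_right_mono) auto
  finally show ?thesis using R by (simp add: power2_eq_square)
qed (auto simp: fill_def norm_divide intro!: frac_le)

lemma AE_norm_diff_ne: "R > 0 \<Longrightarrow> AE z in lborel. norm (z - w) \<noteq> R" for w :: complex
proof (rule AE_I')
  assume R: "R > 0"
  have "emeasure lborel (cball w R - ball w R) = 0"
    using R by (subst emeasure_Diff) (auto simp: emeasure_cball emeasure_ball)
  then show "cball w R - ball w R \<in> null_sets lborel" by auto
qed (auto simp: dist_norm norm_minus_commute)

context torus
begin

text \<open>Removing the increments of \<open>F\<close> and replacing its principal part inside the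
  discs by the antiholomorphic filling gives a periodic Lipschitz function. With the linear term
  restored, its Jacobian is the squared modulus of \<open>F'\<close> outside the discs, and inside
  that of \<open>G'\<close> minus that of the derivative of the filling. Its integral vanishes, so
  the part over one disc is at most 0, and both terms of that part are known sums of
  squares.\<close>

lemma area_theorem:
  fixes F G :: "complex \<Rightarrow> complex" and a :: "nat \<Rightarrow> complex"
  assumes R: "0 < R" "2 * R < D"
    and F: "F holomorphic_on - \<Lambda>"
    and per: "\<And>z w. z \<notin> \<Lambda> \<Longrightarrow> w \<in> \<Lambda> \<Longrightarrow> F (z + w) = F z + of_real (t_coord w) * c"
    and G: "G holomorphic_on ball 0 D"
    and FG: "\<And>z. z \<noteq> 0 \<Longrightarrow> norm z < D \<Longrightarrow> F z = (\<Sum>l<L. a l / z ^ Suc l) + G z"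
  shows "(\<Sum>k<N. (real k + 1) * (norm ((deriv ^^ Suc k) G 0 / fact (Suc k)))\<^sup>2 * R ^ (2 * k + 2)) \<le>
     (\<Sum>l<L. (real l + 1) * (norm (a l))\<^sup>2 / R ^ (2 * l + 2))"
proof -
  \<comment> \<open>For this value \<open>\<kappa> * Re w\<close> equals
    \<open>t_coord w * c\<close>, so that \<open>V\<close> is periodic.
    \<open>null_lagrangian\<close> restores the subtracted term in the Jacobian.\<close>
  define \<kappa> where "\<kappa> = - c / of_real (2 * pi * Im \<tau>)"
  define V where "V z = F z - \<kappa> * of_real (Re z)" for z
  define p where "p y = (\<Sum>l<L. a l * y ^ Suc l)" for y
  define W where "W y = G y + p (fill R y) - \<kappa> * of_real (Re y)" for y
  have Vper: "V (z + w) = V z" if "z \<notin> \<Lambda>" "w \<in> \<Lambda>" for z w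
    using per[OF that] Im_pos by (simp add: V_def \<kappa>_def t_coord_def field_simps)
  have WV: "W y = V y" if "R \<le> norm y" "norm y < D" for y
  proof -
    have y: "y \<noteq> 0" using that R by auto
    have "fill R y = 1 / y"
    proof (cases "norm y = R")
      case True
      then have "cnj y * y = of_real (R\<^sup>2)"
        by (metis complex_norm_square mult.commute)
      then show ?thesis using True y R by (simp add: fill_def field_simps)
    qed (use that in \<open>simp add: fill_def\<close>)
    then show ?thesis using FG[OF y] that by (simp add: W_def V_def p_def power_one_over field_simps)
  qed
  define inside where "inside z \<longleftrightarrow> (\<exists>w\<in>\<Lambda>. norm (z - w) \<le> R)" for z
  define near where "near z = (SOME w. w \<in> \<Lambda> \<and> norm (z - w) \<le> R)" for z
  define v where "v z = (if inside z then W (z - near z) else V z)" for z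
  have near: "inside z \<and> near z = w" if "w \<in> \<Lambda>" "norm (z - w) \<le> R" for z w
  proof -
    have "\<exists>w. w \<in> \<Lambda> \<and> norm (z - w) \<le> R" using that by blast
    from someI_ex[OF this] have "near z \<in> \<Lambda>" "norm (z - near z) \<le> R" by (auto simp: near_def)
    moreover have "norm (z - near z) + norm (z - w) < D"
      using calculation that R by linarith
    ultimately show ?thesis using lattice_near_unique that by (auto simp: inside_def)
  qed
  \<comment> \<open>The local formula by \<open>W\<close> is valid up to the radius
    \<open>D - R\<close>, beyond the circle of radius \<open>R\<close>. Near the circle, regularity
    of \<open>v\<close> therefore reduces to that of \<open>W\<close>.\<close>
  have v1: "v z = W (z - w)" if w: "w \<in> \<Lambda>" "norm (z - w) < D - R" for z w
  proof (cases "norm (z - w) \<le> R")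
    case True
    then show ?thesis using near[OF w(1)] by (simp add: v_def)
  next
    case False
    have "\<not> inside z"
    proof
      assume "inside z"
      then obtain w' where w': "w' \<in> \<Lambda>" "norm (z - w') \<le> R" by (auto simp: inside_def)
      then have "norm (z - w) + norm (z - w') < D" using w by linarith
      then have "w = w'" using lattice_near_unique w w' by blast
      then show False using w' False by simp
    qed
    moreover have "z \<noteq> w" using False R by auto
    then have "z - w \<notin> \<Lambda>"
      using near_0_notin_lattice[of "z - w"] w R by simp
    then have "V (z - w + w) = V (z - w)" by (rule Vper[OF _ w(1)])
    moreover have "W (z - w) = V (z - w)" using WV[of "z - w"] False w R by auto
    ultimately show ?thesis by (simp add: v_def)
  qed
  have notin: "z \<notin> \<Lambda>" if "\<not> inside z" for z
    using that R by (force simp: inside_def)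
  have vper: "v (z + w) = v z" if w: "w \<in> \<Lambda>" for z w
  proof (cases "inside z")
    case True
    then obtain w' where w': "w' \<in> \<Lambda>" "norm (z - w') \<le> R" by (auto simp: inside_def)
    then have "v z = W (z - w')" using R by (intro v1) auto
    moreover have "v (z + w) = W (z + w - (w' + w))"
      by (rule v1[OF lattice_add[OF w'(1) w]]) (use w' R in simp)
    ultimately show ?thesis by simp
  next
    case False
    have "\<not> inside (z + w)"
    proof
      assume "inside (z + w)"
      then obtain w' where w': "w' \<in> \<Lambda>" "norm (z + w - w') \<le> R" by (auto simp: inside_def)
      then have "norm (z - (w' - w)) \<le> R" by (simp add: algebra_simps)
      then show False using False lattice_diff[OF w'(1) w] by (auto simp: inside_def)
    qed
    then show ?thesis using False Vper[OF notin[OF False] w] by (simp add: v_def)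
  qed
  have p_hol: "p holomorphic_on UNIV" unfolding p_def by (intro holomorphic_intros)
  obtain Lp where Lp: "Lp-lipschitz_on (cball 0 (1 / R)) p"
    by (rule holomorphic_lipschitz_cball[OF p_hol open_UNIV subset_UNIV])
  have pf: "(Lp * (1 / R\<^sup>2))-lipschitz_on X (\<lambda>y. p (fill R y))" for X
  proof -
    have A: "(1 / R\<^sup>2)-lipschitz_on X (fill R)"
      using fill_lipschitz[OF R(1)] R by (intro lipschitz_onI) (auto simp: dist_norm)
    have B: "Lp-lipschitz_on (fill R ` X) p"
      by (rule lipschitz_on_subset[OF Lp]) (use norm_fill[OF R(1)] in auto)
    show ?thesis using lipschitz_on_compose2[OF A B] by simp
  qed
  have re: "(norm \<kappa>)-lipschitz_on X (\<lambda>y. \<kappa> * of_real (Re y))" for X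
  proof (rule lipschitz_onI)
    fix x y :: complex
    have "norm (\<kappa> * of_real (Re x) - \<kappa> * of_real (Re y)) = norm \<kappa> * \<bar>Re (x - y)\<bar>"
      by (simp flip: right_diff_distrib of_real_diff add: norm_mult)
    also have "\<dots> \<le> norm \<kappa> * norm (x - y)" by (intro mult_left_mono abs_Re_le_cmod) auto
    finally show "dist (\<kappa> * of_real (Re x)) (\<kappa> * of_real (Re y)) \<le> norm \<kappa> * dist x y" by (simp add: dist_norm)
  qed simp
  have W_lip: "\<exists>L. L-lipschitz_on (cball y u) W" if sub: "cball y u \<subseteq> ball 0 D" for y u
  proof -
    obtain L where L: "L-lipschitz_on (cball y u) G"
      by (rule holomorphic_lipschitz_cball[OF G open_ball sub])
    then show ?thesis
      unfolding W_def using lipschitz_on_diff[OF lipschitz_on_add[OF L pf] re] by blast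
  qed
  have V_lip: "\<exists>L. L-lipschitz_on (cball y u) V" if sub: "cball y u \<subseteq> - \<Lambda>" for y u
  proof -
    obtain L where L: "L-lipschitz_on (cball y u) F"
      by (rule holomorphic_lipschitz_cball[OF F open_compl_lattice sub])
    then show ?thesis
      unfolding V_def using lipschitz_on_diff[OF L re] by blast
  qed
  have open_out: "open {z. \<not> inside z}"
  proof -
    have "{z. \<not> inside z} = {z. R < infdist z \<Lambda>}"
    proof -
      have "inside z \<longleftrightarrow> infdist z \<Lambda> \<le> R" for z
      proof
        assume "inside z"
        then show "infdist z \<Lambda> \<le> R" unfolding inside_def dist_norm[symmetric] using infdist_le2 by blast
      next
        assume "infdist z \<Lambda> \<le> R"
        moreover have "closed \<Lambda>" using open_compl_lattice by (simp add: closed_def)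
        then obtain w where "w \<in> \<Lambda>" "infdist z \<Lambda> = dist z w"
          using infdist_attains_inf[of \<Lambda> z] lattice_0 by blast
        ultimately show "inside z" by (auto simp: inside_def dist_norm)
      qed
      then show ?thesis by (auto simp: not_le[symmetric])
    qed
    then show ?thesis by (simp add: open_Collect_less continuous_on_infdist)
  qed
  have loc: "\<exists>u>0. \<exists>L. L-lipschitz_on (cball z u) v" for z
  proof (cases "inside z")
    case True
    then obtain w where w: "w \<in> \<Lambda>" "norm (z - w) \<le> R" by (auto simp: inside_def)
    define u where "u = (D - 2 * R) / 2"
    have u: "u > 0" using R by (simp add: u_def)
    have sub: "cball (z - w) u \<subseteq> ball 0 (D - R)"
    proof
      fix y assume "y \<in> cball (z - w) u"
      then have "norm y \<le> norm (z - w) + u"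
        using norm_triangle_ineq[of "z - w" "y - (z - w)"] by (simp add: dist_norm norm_minus_commute)
      then show "y \<in> ball 0 (D - R)" using w R by (simp add: u_def field_simps)
    qed
    have "cball (z - w) u \<subseteq> ball 0 D"
      by (rule order_trans[OF sub]) (use R in auto)
    then obtain L where L: "L-lipschitz_on (cball (z - w) u) W"
      using W_lip by blast
    have "L-lipschitz_on (cball z u) v"
    proof (rule lipschitz_onI)
      fix x y assume xy: "x \<in> cball z u" "y \<in> cball z u"
      have shift: "x - w \<in> cball (z - w) u" "y - w \<in> cball (z - w) u"
        using xy by (auto simp: dist_norm)
      then have "norm (x - w) < D - R" "norm (y - w) < D - R" using sub by (auto simp: subset_eq)
      then have "v x = W (x - w)" "v y = W (y - w)" by (auto intro: v1 w)
      then show "dist (v x) (v y) \<le> L * dist x y"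
        using lipschitz_onD[OF L shift] by (simp add: dist_norm)
    qed (use L lipschitz_on_nonneg in blast)
    then show ?thesis using u by blast
  next
    case False
    then obtain u where u: "u > 0" "cball z u \<subseteq> {z. \<not> inside z}"
      using open_out open_contains_cball by (metis mem_Collect_eq)
    then have "cball z u \<subseteq> - \<Lambda>" using notin by auto
    then obtain L where L: "L-lipschitz_on (cball z u) V" using V_lip by blast
    have "v x = V x" if "x \<in> cball z u" for x using u(2) that by (auto simp: v_def)
    then have "L-lipschitz_on (cball z u) v"
      using L by (auto simp: lipschitz_on_def)
    then show ?thesis using u by blast
  qed
  \<comment> \<open>The disc of radius \<open>M\<close> contains the cell and all its translates by
    vectors of norm at most 1. A Lipschitz constant for this compact disc serves the whole plane by
    periodicity.\<close>
  define M where "M = norm \<omega>\<^sub>2 + norm \<omega>\<^sub>1 + 1"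
  obtain K where K: "K-lipschitz_on (cball 0 M) v"
  proof -
    have ll: "local_lipschitz {0::real} (cball 0 M) (\<lambda>_. v)"
    proof (rule local_lipschitzI)
      fix t :: real and z assume "z \<in> cball (0::complex) M"
      obtain u L where "u > 0" "L-lipschitz_on (cball z u) v" using loc by blast
      then show "\<exists>u>0. \<exists>L. \<forall>t\<in>cball t u \<inter> {0}. L-lipschitz_on (cball z u \<inter> cball 0 M) v"
        by (meson Int_lower1 lipschitz_on_subset)
    qed
    obtain K where "\<And>t. t \<in> {0::real} \<Longrightarrow> K-lipschitz_on (cball 0 M) v"
      by (rule local_lipschitz_compact_implies_lipschitz[OF ll]) auto
    then show ?thesis using that by blast
  qed
  have lip: "norm (v (z + d) - v z) \<le> K * norm d" if "norm d \<le> 1" for z d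
  proof -
    obtain w where w: "w \<in> \<Lambda>" "z - w \<in> cell" using cell_tiles[of z] by blast
    have "norm (z - w) \<le> M - 1" using norm_cell[OF w(2)] by (simp add: M_def)
    then have "norm (z - w) \<le> M" "norm (z - w + d) \<le> M"
      using that norm_triangle_ineq[of "z - w" d] by linarith+
    then have "dist (v (z - w + d)) (v (z - w)) \<le> K * dist (z - w + d) (z - w)"
      using lipschitz_onD[OF K] by simp
    moreover have "v (z - w + d) = v (z + d)" "v (z - w) = v z"
      using vper[OF lattice_minus[OF w(1)], of "z + d"] vper[OF lattice_minus[OF w(1)], of z]
      by (simp_all add: algebra_simps)
    ultimately show ?thesis by (simp add: dist_norm)
  qed
  have cont: "continuous_on UNIV v"
  proof (rule continuous_at_imp_continuous_on, intro ballI)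
    fix z
    obtain u L where "u > 0" "L-lipschitz_on (cball z u) v" using loc by blast
    then show "isCont v z"
      by (metis lipschitz_on_continuous_on continuous_on_interior interior_cball centre_in_ball)
  qed
  \<comment> \<open>\<open>pd\<close> is the derivative of the filled principal part with respect to
    \<open>cnj y\<close>. \<alpha> and \<beta> are the two Wirtinger derivatives of
    \<open>v\<close>; both contain \<open>- \<kappa> / 2\<close> from the subtracted linear
    term.\<close>
  define pd where "pd y = (\<Sum>l<L. a l * (of_nat (Suc l) * cnj y ^ l / of_real (R\<^sup>2) ^ Suc l))" for y
  define \<alpha> where "\<alpha> z = (if inside z then deriv G (z - near z) else deriv F z) - \<kappa> / 2" for z
  define \<beta> where "\<beta> z = (if inside z then pd (z - near z) else 0) - \<kappa> / 2" for z
  have Re_eq: "of_real (Re h) = (h + cnj h) / 2" for h :: complex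
    by (simp add: complex_eq_iff)
  have dRe: "((\<lambda>y. \<kappa> * of_real (Re y)) has_derivative (\<lambda>h. \<kappa> / 2 * h + \<kappa> / 2 * cnj h)) (at z)" for z
  proof -
    have d: "((\<lambda>y. \<kappa> * of_real (Re y)) has_derivative (\<lambda>h. \<kappa> * of_real (Re h))) (at z)"
      by (intro derivative_intros)
    have eq: "(\<lambda>h. \<kappa> * of_real (Re h)) = (\<lambda>h. \<kappa> / 2 * h + \<kappa> / 2 * cnj h)"
      by (simp add: Re_eq fun_eq_iff algebra_simps)
    show ?thesis by (rule has_derivative_eq_rhs[OF d eq])
  qed
  have dW: "(W has_derivative (\<lambda>h. (deriv G y - \<kappa> / 2) * h + (pd y - \<kappa> / 2) * cnj h)) (at y)" if y: "norm y < R" for y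
  proof -
    have g: "(G has_derivative (\<lambda>h. deriv G y * h)) (at y)"
      using holomorphic_derivI[OF G open_ball, of y] y R by (simp add: has_field_derivative_def)
    have "((\<lambda>y. \<Sum>l<L. a l * (cnj y / of_real (R\<^sup>2)) ^ Suc l) has_derivative
        (\<lambda>h. \<Sum>l<L. a l * (of_nat (Suc l) * (cnj h / of_real (R\<^sup>2)) * (cnj y / of_real (R\<^sup>2)) ^ l))) (at y)"
      using R by (intro derivative_eq_intros refl | simp)+
    also have "(\<lambda>h. \<Sum>l<L. a l * (of_nat (Suc l) * (cnj h / of_real (R\<^sup>2)) * (cnj y / of_real (R\<^sup>2)) ^ l)) = (\<lambda>h. pd y * cnj h)"
      unfolding pd_def sum_distrib_right by (intro ext sum.cong refl) (simp add: power_divide)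
    finally have pp: "((\<lambda>y. p (cnj y / of_real (R\<^sup>2))) has_derivative (\<lambda>h. pd y * cnj h)) (at y)"
      by (simp add: p_def)
    have "((\<lambda>y. G y + p (cnj y / of_real (R\<^sup>2)) - \<kappa> * of_real (Re y)) has_derivative
        (\<lambda>h. deriv G y * h + pd y * cnj h - (\<kappa> / 2 * h + \<kappa> / 2 * cnj h))) (at y)"
      by (intro has_derivative_add has_derivative_diff g pp dRe)
    also have "(\<lambda>h. deriv G y * h + pd y * cnj h - (\<kappa> / 2 * h + \<kappa> / 2 * cnj h)) = (\<lambda>h. (deriv G y - \<kappa> / 2) * h + (pd y - \<kappa> / 2) * cnj h)"
      by (simp add: fun_eq_iff algebra_simps)
    finally show ?thesis
      by (rule has_derivative_transform_within_open[where s = "ball 0 R"]) (use y in \<open>auto simp: W_def fill_def\<close>)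
  qed
  have AE_off: "AE z in lborel. \<forall>w\<in>\<Lambda>. norm (z - w) \<noteq> R"
  proof (subst AE_ball_countable)
    obtain pt :: "nat \<Rightarrow> complex" where "bij_betw pt UNIV \<Lambda>" by (rule lattice_enumeration)
    then show "countable \<Lambda>" by (metis bij_betw_def countable_image countableI_type)
  qed (use AE_norm_diff_ne[OF R(1)] in blast)
  have der: "AE z in lborel. (v has_derivative (\<lambda>h. \<alpha> z * h + \<beta> z * cnj h)) (at z)"
    using AE_off
  proof eventually_elim
    case (elim z)
    show ?case
    proof (cases "inside z")
      case True
      then obtain w where w: "w \<in> \<Lambda>" "norm (z - w) \<le> R" by (auto simp: inside_def)
      then have lt: "norm (z - w) < R" using elim by force
      have "((\<lambda>x. W (x - w)) has_derivative (\<lambda>h. (deriv G (z - w) - \<kappa> / 2) * h + (pd (z - w) - \<kappa> / 2) * cnj h)) (at z)"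
        by (rule has_derivative_compose[of "\<lambda>x. x - w" "\<lambda>h. h", OF _ dW[OF lt]]) (auto intro!: derivative_eq_intros)
      also have "(\<lambda>h. (deriv G (z - w) - \<kappa> / 2) * h + (pd (z - w) - \<kappa> / 2) * cnj h) = (\<lambda>h. \<alpha> z * h + \<beta> z * cnj h)"
        using near[OF w] by (simp add: \<alpha>_def \<beta>_def)
      finally show ?thesis
      proof (rule has_derivative_transform_within_open[where s = "ball w R"])
        fix x assume "x \<in> ball w R"
        then have "norm (x - w) < D - R" using R by (simp add: dist_norm norm_minus_commute)
        then show "W (x - w) = v x" using v1[OF w(1)] by simp
      qed (use lt in \<open>auto simp: dist_norm norm_minus_commute\<close>)
    next
      case False
      have "(F has_derivative (\<lambda>h. deriv F z * h)) (at z)"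
        using holomorphic_derivI[OF F open_compl_lattice, of z] notin[OF False] by (simp add: has_field_derivative_def)
      then have "(V has_derivative (\<lambda>h. deriv F z * h - (\<kappa> / 2 * h + \<kappa> / 2 * cnj h))) (at z)"
        unfolding V_def by (intro has_derivative_diff dRe)
      also have "(\<lambda>h. deriv F z * h - (\<kappa> / 2 * h + \<kappa> / 2 * cnj h)) = (\<lambda>h. \<alpha> z * h + \<beta> z * cnj h)"
        using False by (simp add: \<alpha>_def \<beta>_def fun_eq_iff algebra_simps)
      finally show ?thesis
        by (rule has_derivative_transform_within_open[OF _ open_out]) (use False in \<open>auto simp: v_def\<close>)
    qed
  qed
  obtain q B where q: "q \<in> borel_measurable borel" "\<And>z. \<bar>q z\<bar> \<le> B" "\<And>z w. w \<in> \<Lambda> \<Longrightarrow> q (z + w) = q z"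
    "AE z in lborel. q z = (norm (\<alpha> z + \<kappa> / 2))\<^sup>2 - (norm (\<beta> z + \<kappa> / 2))\<^sup>2"
    "(\<integral>z. indicator cell z * q z \<partial>lborel) = 0"
  proof (rule null_lagrangian[OF vper cont lip der, of \<kappa>])
    fix q B
    assume "q \<in> borel_measurable borel" "\<And>z. \<bar>q z\<bar> \<le> B" "\<And>z w. w \<in> \<Lambda> \<Longrightarrow> q (z + w) = q z"
      "AE z in lborel. q z = (norm (\<alpha> z + \<kappa> / 2))\<^sup>2 - (norm (\<beta> z + \<kappa> / 2))\<^sup>2"
      "(\<integral>z. indicator cell z * q z \<partial>lborel) = 0"
    then show thesis by (rule that)
  qed
  note [measurable] = q(1)
  define C where "C = {z. \<exists>w\<in>\<Lambda>. z + w \<in> cball 0 R}"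
  have C_inside: "z \<in> C \<longleftrightarrow> inside z" for z
  proof
    assume "z \<in> C"
    then obtain w where "w \<in> \<Lambda>" "norm (z + w) \<le> R" by (auto simp: C_def)
    then show "inside z" using lattice_minus[of w] by (auto simp: inside_def intro!: bexI[of _ "- w"])
  next
    assume "inside z"
    then obtain w where "w \<in> \<Lambda>" "norm (z - w) \<le> R" by (auto simp: inside_def)
    then show "z \<in> C" using lattice_minus[of w] by (auto simp: C_def intro!: bexI[of _ "- w"])
  qed
  have [measurable]: "C \<in> sets borel"
  proof -
    have "closed (- {z. \<not> inside z})" using open_out by (simp add: closed_def)
    also have "- {z. \<not> inside z} = C" using C_inside by auto
    finally show ?thesis by simp
  qed
  have qint: "integrable lborel (\<lambda>z. indicator S z * (h z * q z))"
    if [measurable]: "S \<in> sets borel" "h \<in> borel_measurable borel" and "emeasure lborel S < \<infinity>" "\<And>z. \<bar>h z\<bar> \<le> 1" for S and h :: "complex \<Rightarrow> real"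
  proof (rule Bochner_Integration.integrable_bound[of _ "\<lambda>z. B * indicator S z"])
    show "integrable lborel (\<lambda>z. B * indicator S z)"
      using that by (intro integrable_mult_right integrable_real_indicator) auto
    have "\<bar>h z * q z\<bar> \<le> \<bar>B\<bar>" for z
      using mult_mono[OF that(4)[of z] q(2)[of z]] by (simp add: abs_mult)
    then show "AE z in lborel. norm (indicator S z * (h z * q z)) \<le> norm (B * indicator S z)"
      by (intro AE_I2) (auto simp: indicator_def)
  qed measurable
  have "(\<integral>z. indicator (cball 0 R) z * q z \<partial>lborel) = (\<integral>z. indicator cell z * (indicator C z * q z) \<partial>lborel)"
    unfolding C_def
  proof (rule integral_periodic[OF q(1) _ _ _ q(2,3)])
    show "{z. \<exists>w\<in>\<Lambda>. z + w \<in> cball 0 R} \<in> sets borel" unfolding C_def[symmetric] by measurable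
    show "emeasure lborel (cball (0::complex) R) < \<infinity>" by (rule emeasure_bounded_finite) simp
    fix z w :: complex assume "z \<in> cball 0 R" "z + w \<in> cball 0 R" "w \<in> \<Lambda>"
    then have "norm (z - 0) + norm (z - (- w)) < D" using R by simp
    then have "0 = - w" using \<open>w \<in> \<Lambda>\<close> by (intro lattice_near_unique[of 0 "- w" z]) (auto intro: lattice_minus)
    then show "w = 0" by simp
  qed auto
  \<comment> \<open>Outside the discs \<beta> is \<open>- \<kappa> / 2\<close>, so \<open>q\<close>
    is a squared modulus there: this is the nonnegative area of the complement.\<close>
  also have "\<dots> \<le> (\<integral>z. indicator cell z * q z \<partial>lborel)"
  proof (rule integral_mono_AE)
    show "integrable lborel (\<lambda>z. indicator cell z * (indicator C z * q z))"
      using emeasure_cell by (intro qint) (auto simp: indicator_def)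
    show "integrable lborel (\<lambda>z. indicator cell z * q z)"
      using qint[of cell "\<lambda>_. 1"] emeasure_cell by simp
    show "AE z in lborel. indicator cell z * (indicator C z * q z) \<le> indicator cell z * q z"
      using q(4)
    proof eventually_elim
      case (elim z)
      show ?case
      proof (cases "inside z")
        case False
        then have "q z \<ge> 0" using elim by (simp add: \<beta>_def)
        then show ?thesis by (auto simp: indicator_def)
      qed (simp add: C_inside)
    qed
  qed
  finally have le0: "(\<integral>z. indicator (cball 0 R) z * q z \<partial>lborel) \<le> 0" using q(5) by simp
  have cG: "continuous_on (cball 0 R) (\<lambda>z. (norm (deriv G z))\<^sup>2)"
    by (intro continuous_intros holomorphic_on_imp_continuous_on holomorphic_on_subset[OF holomorphic_deriv[OF G open_ball]]) (use R in auto)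
  have cp: "continuous_on (cball 0 R) (\<lambda>z. (norm (pd z))\<^sup>2)"
    unfolding pd_def using R by (intro continuous_intros) auto
  have "(\<integral>z. indicator (cball 0 R) z * q z \<partial>lborel) =
     (\<integral>z. indicator (cball 0 R) z *\<^sub>R (norm (deriv G z))\<^sup>2 - indicator (cball 0 R) z *\<^sub>R (norm (pd z))\<^sup>2 \<partial>lborel)"
  proof (rule integral_cong_AE)
    show "(\<lambda>z. indicator (cball 0 R) z *\<^sub>R (norm (deriv G z))\<^sup>2 - indicator (cball 0 R) z *\<^sub>R (norm (pd z))\<^sup>2) \<in> borel_measurable lborel"
      by (intro borel_measurable_integrable Bochner_Integration.integrable_diff integrable_cball cG cp)
    show "AE z in lborel. indicator (cball 0 R) z * q z =
      indicator (cball 0 R) z *\<^sub>R (norm (deriv G z))\<^sup>2 - indicator (cball 0 R) z *\<^sub>R (norm (pd z))\<^sup>2"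
      using q(4)
    proof eventually_elim
      case (elim z)
      show ?case
      proof (cases "norm z \<le> R")
        case True
        then have "inside z" "near z = 0" using near[of 0 z] by simp_all
        then show ?thesis using elim True by (simp add: \<alpha>_def \<beta>_def)
      qed simp
    qed
  qed (use borel_measurable_indicator in measurable)
  also have "\<dots> = (\<integral>z. indicator (cball 0 R) z *\<^sub>R (norm (deriv G z))\<^sup>2 \<partial>lborel) - (\<integral>z. indicator (cball 0 R) z *\<^sub>R (norm (pd z))\<^sup>2 \<partial>lborel)"
    by (intro Bochner_Integration.integral_diff integrable_cball cG cp)
  finally have le1: "(\<integral>z. indicator (cball 0 R) z *\<^sub>R (norm (deriv G z))\<^sup>2 \<partial>lborel) \<le> (\<integral>z. indicator (cball 0 R) z *\<^sub>R (norm (pd z))\<^sup>2 \<partial>lborel)"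
    using le0 by simp
  define b where "b l = cnj (a l) * of_nat (Suc l) / of_real (R\<^sup>2) ^ Suc l" for l
  have "norm (pd z) = norm (\<Sum>l<L. b l * z ^ l)" for z
  proof -
    have "pd z = cnj (\<Sum>l<L. b l * z ^ l)"
      unfolding pd_def b_def by (simp add: mult_ac)
    then show ?thesis by (simp only: complex_mod_cnj)
  qed
  then have "(\<integral>z. indicator (cball 0 R) z *\<^sub>R (norm (pd z))\<^sup>2 \<partial>lborel) = (\<Sum>j<L. (norm (b j))\<^sup>2 * (pi * R ^ (2 * j + 2) / real (j + 1)))"
    using integral_cball_polynomial[of R b L] R by simp
  also have "\<dots> = pi * (\<Sum>l<L. (real l + 1) * (norm (a l))\<^sup>2 / R ^ (2 * l + 2))"
    unfolding sum_distrib_left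
  proof (intro sum.cong refl)
    fix l
    have "(norm (b l))\<^sup>2 = (norm (a l) * (real l + 1) / R ^ (2 * l + 2))\<^sup>2"
      using R by (simp add: b_def norm_mult norm_divide norm_power power_mult[symmetric] del: of_nat_Suc) (simp add: add.commute power2_eq_square)
    also have "\<dots> * (pi * R ^ (2 * l + 2) / real (l + 1)) = pi * ((real l + 1) * (norm (a l))\<^sup>2 / R ^ (2 * l + 2))"
    proof -
      have "(x * y / r)\<^sup>2 * (pi * r / y) = pi * (y * x\<^sup>2 / r)" if "y > 0" "r > 0" for x y r :: real
        using that by (simp add: power2_eq_square field_simps)
      from this[of "real l + 1" "R ^ (2 * l + 2)" "norm (a l)"] show ?thesis using R by (simp add: add.commute)
    qed
    finally show "(norm (b l))\<^sup>2 * (pi * R ^ (2 * l + 2) / real (l + 1)) = pi * ((real l + 1) * (norm (a l))\<^sup>2 / R ^ (2 * l + 2))" .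
  qed
  finally have rhs: "(\<integral>z. indicator (cball 0 R) z *\<^sub>R (norm (pd z))\<^sup>2 \<partial>lborel) = pi * (\<Sum>l<L. (real l + 1) * (norm (a l))\<^sup>2 / R ^ (2 * l + 2))" .
  have "pi * (\<Sum>k<N. (real k + 1) * (norm ((deriv ^^ Suc k) G 0 / fact (Suc k)))\<^sup>2 * R ^ (2 * k + 2)) =
     (\<Sum>j<N. (norm ((deriv ^^ j) (deriv G) 0 / fact j))\<^sup>2 * (pi * R ^ (2 * j + 2) / real (j + 1)))"
    unfolding sum_distrib_left
  proof (intro sum.cong refl)
    fix k
    have eq: "(deriv ^^ k) (deriv G) 0 / fact k = of_nat (Suc k) * ((deriv ^^ Suc k) G 0 / fact (Suc k))"
      by (simp add: funpow_Suc_right del: funpow.simps of_nat_Suc)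
    have "(norm ((deriv ^^ k) (deriv G) 0 / fact k))\<^sup>2 = ((real k + 1) * norm ((deriv ^^ Suc k) G 0 / fact (Suc k)))\<^sup>2"
      unfolding eq norm_mult norm_of_nat by (simp only: of_nat_Suc add.commute)
    moreover have "pi * (y * x\<^sup>2 * r) = (y * x)\<^sup>2 * (pi * r / y)" if "y > 0" for x y r :: real
      using that by (simp add: power2_eq_square field_simps)
    ultimately show "pi * ((real k + 1) * (norm ((deriv ^^ Suc k) G 0 / fact (Suc k)))\<^sup>2 * R ^ (2 * k + 2)) =
       (norm ((deriv ^^ k) (deriv G) 0 / fact k))\<^sup>2 * (pi * R ^ (2 * k + 2) / real (k + 1))"
      by (simp add: add.commute)
  qed
  also have "\<dots> \<le> (\<integral>z. indicator (cball 0 R) z *\<^sub>R (norm (deriv G z))\<^sup>2 \<partial>lborel)"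
    by (rule integral_cball_holomorphic_ge[OF _ _ holomorphic_deriv[OF G open_ball]]) (use R in auto)
  also note le1
  also note rhs
  finally show ?thesis by (simp only: mult_le_cancel_left_pos[OF pi_gt_zero])
qed
end

section \<open>The Grunsky inequality for the moment matrix\<close>

lemma higher_deriv_sum:
  fixes L :: nat
  assumes "\<And>l. l < L \<Longrightarrow> g l holomorphic_on S" "open S" "z \<in> S"
  shows "(deriv ^^ n) (\<lambda>z. \<Sum>l<L. c l * g l z) z = (\<Sum>l<L. c l * (deriv ^^ n) (g l) z)"
  using assms(1)
proof (induction L)
  case (Suc L)
  have g: "g L holomorphic_on S" using Suc.prems by simp
  have "(deriv ^^ n) (\<lambda>z. \<Sum>l<Suc L. c l * g l z) z = (deriv ^^ n) (\<lambda>z. (\<Sum>l<L. c l * g l z) + c L * g L z) z"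
    by simp
  also have "\<dots> = (deriv ^^ n) (\<lambda>z. \<Sum>l<L. c l * g l z) z + (deriv ^^ n) (\<lambda>z. c L * g L z) z"
    using Suc.prems by (intro higher_deriv_add[OF _ _ assms(2,3)] holomorphic_intros) auto
  also have "(deriv ^^ n) (\<lambda>z. c L * g L z) z = c L * (deriv ^^ n) (g L) z"
    by (rule higher_deriv_cmult[OF g assms(3,2)])
  finally show ?case using Suc by simp
qed (simp add: higher_deriv_const)

lemma higher_deriv_inverse:
  assumes "z \<noteq> (0::complex)"
  shows "(deriv ^^ n) (\<lambda>z. 1 / z) z = (- 1) ^ n * fact n / z ^ Suc n"
  using assms
proof (induction n arbitrary: z)
  case (Suc n)
  have "eventually (\<lambda>w. w \<in> - {0}) (nhds z)"
    using Suc.prems by (intro eventually_nhds_in_open) auto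
  then have ev: "eventually (\<lambda>w. (deriv ^^ n) (\<lambda>z. 1 / z) w = (- 1) ^ n * fact n / w ^ Suc n) (nhds z)"
    by eventually_elim (use Suc.IH in auto)
  have "(deriv ^^ Suc n) (\<lambda>z. 1 / z) z = deriv ((deriv ^^ n) (\<lambda>z. 1 / z)) z" by simp
  also have "\<dots> = deriv (\<lambda>w. (- 1) ^ n * fact n / w ^ Suc n) z"
    by (rule deriv_cong_ev[OF ev refl])
  also have "\<dots> = (- 1) ^ Suc n * fact (Suc n) / z ^ Suc (Suc n)"
    using Suc.prems
    by (intro DERIV_imp_deriv) (rule derivative_eq_intros refl | simp)+
  finally show ?case .
qed simp

context torus
begin

lemma eisenstein_odd: "odd k \<Longrightarrow> eisenstein k \<tau> = 0"
  by (simp add: eisenstein_def)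

lemma higher_deriv_P_near_0:
  assumes "z \<noteq> 0" "norm z < D"
  shows "(deriv ^^ n) P z = (- 1) ^ n * fact n / z ^ Suc n + (deriv ^^ n) reg z"
proof -
  have op: "open (ball (0::complex) D - {0})" by auto
  have z: "z \<in> ball 0 D - {0}" using assms by auto
  have hol: "reg holomorphic_on ball 0 D - {0}" "(\<lambda>z::complex. 1 / z) holomorphic_on ball 0 D - {0}"
    "P holomorphic_on ball 0 D - {0}"
    using near_0_notin_lattice
    by (auto intro!: holomorphic_intros holomorphic_on_subset[OF reg_holomorphic] holomorphic_on_subset[OF P_holomorphic])
  have "(deriv ^^ n) P z = (deriv ^^ n) (\<lambda>z. 1 / z + reg z) z"
    by (rule higher_deriv_transform_within_open[OF hol(3) _ op z])
       (use P_eq_reg hol in \<open>auto intro!: holomorphic_on_add\<close>)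
  also have "\<dots> = (deriv ^^ n) (\<lambda>z. 1 / z) z + (deriv ^^ n) reg z"
    by (rule higher_deriv_add[OF hol(2,1) op z])
  finally show ?thesis using higher_deriv_inverse[OF assms(1)] by simp
qed

lemma lattice_shift_iff: "w \<in> \<Lambda> \<Longrightarrow> z + w \<in> \<Lambda> \<longleftrightarrow> z \<in> \<Lambda>"
  using lattice_diff[of "z + w" w] lattice_add[of z w] by auto

lemma higher_deriv_P_periodic:
  assumes z: "z \<notin> \<Lambda>" and w: "w \<in> \<Lambda>"
  shows "(deriv ^^ n) P (z + w) = (deriv ^^ n) P z - (if n = 0 then of_real (t_coord w) else 0)"
proof -
  have z': "z \<in> - \<Lambda>" using z by simp
  have "(deriv ^^ n) P (z + w) = (deriv ^^ n) (\<lambda>x. P (1 * x + w)) z"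
    using higher_deriv_compose_linear'[OF P_holomorphic open_compl_lattice open_compl_lattice z', of 1 w n]
      lattice_shift_iff[OF w] by simp
  also have "\<dots> = (deriv ^^ n) (\<lambda>x. P x - of_real (t_coord w)) z"
  proof (rule higher_deriv_transform_within_open[OF _ _ open_compl_lattice z'])
    show "(\<lambda>x. P (1 * x + w)) holomorphic_on - \<Lambda>"
      by (rule holomorphic_on_compose_gen[of "\<lambda>x. 1 * x + w" _ P, unfolded o_def, OF _ P_holomorphic])
         (use lattice_shift_iff[OF w] in \<open>auto intro!: holomorphic_intros\<close>)
    show "(\<lambda>x. P x - of_real (t_coord w)) holomorphic_on - \<Lambda>"
      by (intro holomorphic_intros P_holomorphic)
  qed (use P_quasi_periodic[OF _ w] in auto)
  also have "\<dots> = (deriv ^^ n) P z - (deriv ^^ n) (\<lambda>x. of_real (t_coord w)) z"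
    by (rule higher_deriv_diff[OF P_holomorphic _ open_compl_lattice z']) auto
  finally show ?thesis by (simp add: higher_deriv_const)
qed

text \<open>
  The Grunsky inequality of the torus: the area theorem for the elliptic function with principal
  part \<open>\<Sum>l. a l / z ^ (l + 1)\<close>, written in coordinates in which both norms are the standard ones.
\<close>

lemma grunsky:
  fixes y :: "nat \<Rightarrow> complex"
  assumes R: "0 < R" "2 * R < D"
  shows "(\<Sum>k<N. (norm (\<Sum>l<L. of_real (R ^ (k + l + 2) / sqrt (real (Suc k * Suc l))) * moment_C (Suc k) (Suc l) \<tau> * y l))\<^sup>2)
    \<le> (\<Sum>l<L. (norm (y l))\<^sup>2)"
proof -
  \<comment> \<open>The scaling of \<open>a\<close> turns the right-hand side of the area theorem
    into the sum of the squares of \<open>y\<close>. The factor in \<open>b\<close> normalizes the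
    derivative of order \<open>l\<close> of \<open>P\<close> to the principal part
    \<open>1 / z ^ Suc l\<close>. Only the term with \<open>l = 0\<close> is not elliptic, whence
    \<open>c\<close>.\<close>
  define a where "a l = of_real (R ^ Suc l / sqrt (Suc l)) * y l" for l
  define b where "b l = a l * ((- 1) ^ l / fact l)" for l
  define F where "F z = (\<Sum>l<L. b l * (deriv ^^ l) P z)" for z
  define G where "G z = (\<Sum>l<L. b l * (deriv ^^ l) reg z)" for z
  define c where "c = - (if L = 0 then 0 else a 0)"
  have "(\<Sum>k<N. (real k + 1) * (norm ((deriv ^^ Suc k) G 0 / fact (Suc k)))\<^sup>2 * R ^ (2 * k + 2)) \<le>
     (\<Sum>l<L. (real l + 1) * (norm (a l))\<^sup>2 / R ^ (2 * l + 2))"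
  proof (rule area_theorem[of R F c G a L N], rule R, rule R)
    show "F holomorphic_on - \<Lambda>"
      unfolding F_def by (intro holomorphic_intros holomorphic_higher_deriv P_holomorphic open_compl_lattice)
    show "G holomorphic_on ball 0 D"
      unfolding G_def by (intro holomorphic_intros holomorphic_higher_deriv reg_holomorphic open_ball)
    show "F (z + w) = F z + of_real (t_coord w) * c" if "z \<notin> \<Lambda>" "w \<in> \<Lambda>" for z w
    proof -
      have "F (z + w) = F z - (\<Sum>l<L. b l * (if l = 0 then of_real (t_coord w) else 0))"
        unfolding F_def higher_deriv_P_periodic[OF that]
        by (simp add: right_diff_distrib sum_subtractf)
      also have "(\<Sum>l<L. b l * (if l = 0 then of_real (t_coord w) else 0)) = (\<Sum>l<L. if l = 0 then b l * of_real (t_coord w) else 0)"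
        by (intro sum.cong) auto
      also have "\<dots> = (if 0 \<in> {..<L} then b 0 * of_real (t_coord w) else 0)"
        by (rule sum.delta) simp
      also have "\<dots> = - of_real (t_coord w) * c"
        by (simp add: c_def b_def)
      finally show ?thesis by simp
    qed
    show "F z = (\<Sum>l<L. a l / z ^ Suc l) + G z" if "z \<noteq> 0" "norm z < D" for z
    proof -
      have "b l * ((- 1) ^ l * fact l / z ^ Suc l) = a l / z ^ Suc l" for l
      proof -
        have "(- 1) ^ l * (- 1) ^ l = (1::complex)" by (simp flip: power_add power_mult_distrib)
        then have "b l * ((- 1) ^ l * fact l / z ^ Suc l) = a l * 1 / z ^ Suc l"
          unfolding b_def by (simp add: field_simps)
        then show ?thesis by simp
      qed
      then show ?thesis
        unfolding F_def G_def higher_deriv_P_near_0[OF that]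
        by (simp only: distrib_left sum.distrib)
    qed
  qed
  also have "(\<Sum>l<L. (real l + 1) * (norm (a l))\<^sup>2 / R ^ (2 * l + 2)) = (\<Sum>l<L. (norm (y l))\<^sup>2)"
  proof (intro sum.cong refl)
    fix l
    have "(R ^ Suc l)\<^sup>2 = R ^ (2 * l + 2)"
      using power_mult[of R "Suc l" 2] by (simp only: mult_Suc mult.commute[of _ 2] add.commute[of 2] mult_Suc_right)
    then have "(norm (a l))\<^sup>2 = R ^ (2 * l + 2) / (real l + 1) * (norm (y l))\<^sup>2"
      unfolding a_def norm_mult norm_of_real power_mult_distrib power2_abs power_divide
      by (simp del: power_Suc add: add.commute)
    then show "(real l + 1) * (norm (a l))\<^sup>2 / R ^ (2 * l + 2) = (norm (y l))\<^sup>2"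
      using R by (simp add: field_simps)
  qed
  also have "(\<Sum>k<N. (real k + 1) * (norm ((deriv ^^ Suc k) G 0 / fact (Suc k)))\<^sup>2 * R ^ (2 * k + 2)) =
    (\<Sum>k<N. (norm (\<Sum>l<L. of_real (R ^ (k + l + 2) / sqrt (real (Suc k * Suc l))) * moment_C (Suc k) (Suc l) \<tau> * y l))\<^sup>2)"
  proof (intro sum.cong refl)
    fix k
    have coeff: "of_real (R ^ (k + l + 2) / sqrt (real (Suc k * Suc l))) * moment_C (Suc k) (Suc l) \<tau> * y l =
       - of_real (R ^ Suc k * sqrt (Suc k)) * (b l * (deriv ^^ (Suc k + l)) reg 0 / fact (Suc k))" for l
    \<comment> \<open>The sign in \<open>moment_C\<close> is \<open>(- 1) ^ k\<close>, whereas the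
      coefficients \<open>b\<close> bring in \<open>(- 1) ^ l\<close>. They differ only for odd
      \<open>k + l\<close>, where the Eisenstein series vanishes.\<close>
    proof (cases "even (k + l)")
      case False
      then have "odd (Suc k + Suc l)" "odd (Suc (Suc k + l))" by simp_all
      then have "eisenstein (Suc k + Suc l) \<tau> = 0" "eisenstein (Suc (Suc k + l)) \<tau> = 0"
        by (blast intro: eisenstein_odd)+
      then show ?thesis by (simp only: moment_C_def higher_deriv_reg mult_zero_right mult_zero_left div_0)
    next
      case True
      then have s: "(- 1) ^ l = ((- 1) ^ k :: complex)" by (simp add: minus_one_power_iff)
      have sq: "sqrt (real (Suc k * Suc l)) = sqrt (Suc k) * sqrt (Suc l)" by (simp only: of_nat_mult real_sqrt_mult)
      have "of_real (R ^ (k + l + 2) / sqrt (real (Suc k * Suc l))) * moment_C (Suc k) (Suc l) \<tau> * y l =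
         of_real (R ^ (k + l + 2) / (sqrt (Suc k) * sqrt (Suc l))) * ((- 1) ^ k * (fact (Suc k + l) / (fact k * fact l)) * eisenstein (Suc (Suc k + l)) \<tau>) * y l"
        unfolding sq by (simp add: moment_C_def)
      also have "of_real (R ^ (k + l + 2) / (sqrt (Suc k) * sqrt (Suc l))) = (of_real (R ^ Suc k * R ^ Suc l * sqrt (Suc k) / (Suc k * sqrt (Suc l))) :: complex)"
      proof -
        have "x / (s * t) = x * s / (s * s * t)" if "s > 0" for x s t :: real using that by simp
        from this[of "sqrt (Suc k)" "R ^ (k + l + 2)" "sqrt (Suc l)"]
        have "R ^ (k + l + 2) / (sqrt (Suc k) * sqrt (Suc l)) = R ^ (k + l + 2) * sqrt (Suc k) / (Suc k * sqrt (Suc l))"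
          by (simp del: of_nat_Suc)
        moreover have "R ^ (k + l + 2) = R ^ Suc k * R ^ Suc l" by (simp add: power_add)
        ultimately show ?thesis by (simp only:)
      qed
      finally have eq: "of_real (R ^ (k + l + 2) / sqrt (real (Suc k * Suc l))) * moment_C (Suc k) (Suc l) \<tau> * y l =
        of_real (R ^ Suc k * R ^ Suc l * sqrt (Suc k) / (Suc k * sqrt (Suc l))) * ((- 1) ^ k * (fact (Suc k + l) / (fact k * fact l)) * eisenstein (Suc (Suc k + l)) \<tau>) * y l" .
      have gen: "of_real (A * B * S / (K * T)) * (m * (f / (g * h)) * E) * z =
         - of_real (A * S) * (of_real (B / T) * z * (m / h) * (- f * E) / (of_real K * g))" for A B S K T :: real and m f g h E z :: complex
        by (simp add: divide_inverse mult_ac)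
      have "(fact (Suc k) :: complex) = of_real (real (Suc k)) * fact k" by (simp add: algebra_simps)
      then show ?thesis
        unfolding eq gen higher_deriv_reg b_def a_def s by (simp only:)
    qed
    have "(deriv ^^ Suc k) G 0 = (\<Sum>l<L. b l * (deriv ^^ Suc k) ((deriv ^^ l) reg) 0)"
      unfolding G_def
      by (rule higher_deriv_sum[of L _ "ball 0 D"]) (use min_length_pos in \<open>auto intro!: holomorphic_higher_deriv reg_holomorphic\<close>)
    also have "\<dots> = (\<Sum>l<L. b l * (deriv ^^ (Suc k + l)) reg 0)"
      by (simp only: funpow_add o_apply)
    finally have "(\<Sum>l<L. of_real (R ^ (k + l + 2) / sqrt (real (Suc k * Suc l))) * moment_C (Suc k) (Suc l) \<tau> * y l) =
       - of_real (R ^ Suc k * sqrt (Suc k)) * ((deriv ^^ Suc k) G 0 / fact (Suc k))"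
      unfolding coeff by (simp only: sum_distrib_left sum_divide_distrib)
    then have "(norm (\<Sum>l<L. of_real (R ^ (k + l + 2) / sqrt (real (Suc k * Suc l))) * moment_C (Suc k) (Suc l) \<tau> * y l))\<^sup>2 =
       (R ^ Suc k * sqrt (Suc k))\<^sup>2 * (norm ((deriv ^^ Suc k) G 0 / fact (Suc k)))\<^sup>2"
      by (simp only: norm_mult norm_minus_cancel norm_of_real power_mult_distrib power2_abs)
    also have "(R ^ Suc k * sqrt (Suc k))\<^sup>2 = (real k + 1) * R ^ (2 * k + 2)"
      by (simp add: power_mult_distrib power2_eq_square power_add power_mult)
    finally show "(real k + 1) * (norm ((deriv ^^ Suc k) G 0 / fact (Suc k)))\<^sup>2 * R ^ (2 * k + 2) =
       (norm (\<Sum>l<L. of_real (R ^ (k + l + 2) / sqrt (real (Suc k * Suc l))) * moment_C (Suc k) (Suc l) \<tau> * y l))\<^sup>2"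
      by (simp only: mult_ac)
  qed
  finally show ?thesis .
qed
end

section \<open>Circle integrals and integrals depending on a complex parameter\<close>

text \<open>The contour integral over the circle divided by \<open>2 * pi * \<i>\<close>. Written
  over the unit interval it can be treated as a parameter integral.\<close>

definition cint :: "real \<Rightarrow> (complex \<Rightarrow> complex) \<Rightarrow> complex" where
  "cint r f = integral {0..1} (\<lambda>t. f (circlepath 0 r t) * circlepath 0 r t)"

lemma norm_circlepath_0: "norm (circlepath 0 r t) = \<bar>r\<bar>"
  by (simp add: circlepath norm_mult)

lemma continuous_on_circlepath [continuous_intros]: "continuous_on S (circlepath z r)"
  unfolding circlepath by (intro continuous_intros)

lemma contour_integral_cint: "contour_integral (circlepath 0 r) f = 2 * of_real pi * \<i> * cint r f"
proof -
  have "contour_integral (circlepath 0 r) f =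
     integral {0..1} (\<lambda>t. f (circlepath 0 r t) * vector_derivative (circlepath 0 r) (at t))"
    by (rule contour_integral_integral)
  also have "\<dots> = integral {0..1} (\<lambda>t. 2 * of_real pi * \<i> * (f (circlepath 0 r t) * circlepath 0 r t))"
    unfolding vector_derivative_circlepath by (intro integral_cong) (simp add: circlepath algebra_simps)
  also have "\<dots> = 2 * of_real pi * \<i> * cint r f"
    unfolding cint_def by (rule integral_mult_right)
  finally show ?thesis .
qed

lemma norm_cint_le:
  assumes "continuous_on (sphere 0 r) f" "\<And>z. norm z = r \<Longrightarrow> norm (f z * z) \<le> K" "r > 0"
  shows "norm (cint r f) \<le> K"
proof -
  have "norm (integral {0..1} (\<lambda>t. f (circlepath 0 r t) * circlepath 0 r t)) \<le> K * (1 - 0)"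
  proof (rule integral_bound)
    show "continuous_on {0..1} (\<lambda>t. f (circlepath 0 r t) * circlepath 0 r t)"
      by (intro continuous_intros continuous_on_compose2[OF assms(1)])
         (use assms(3) in \<open>auto simp: norm_circlepath_0\<close>)
    show "norm (f (circlepath 0 r t) * circlepath 0 r t) \<le> K" if "t \<in> {0..1}" for t
      using assms by (intro assms(2)) (simp add: norm_circlepath_0)
  qed simp
  then show ?thesis by (simp add: cint_def)
qed

lemma cint_annulus:
  assumes f: "f holomorphic_on {z. r0 < norm z \<and> norm z < r9}"
    and s: "0 \<le> r0" "r0 < s" "s < r9" "r0 < s'" "s' < r9"
  shows "cint s f = cint s' f"
proof -
  let ?A = "{z::complex. r0 < norm z \<and> norm z < r9}"
  have "open ?A" by (intro open_Collect_conj open_Collect_less continuous_intros)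
  moreover have "homotopic_loops ?A (circlepath 0 s) (circlepath 0 s')"
  proof (rule homotopic_loops_linear)
    fix t :: real
    show "closed_segment (circlepath 0 s t) (circlepath 0 s' t) \<subseteq> ?A"
    proof
      fix x assume "x \<in> closed_segment (circlepath 0 s t) (circlepath 0 s' t)"
      then obtain u where u: "0 \<le> u" "u \<le> 1" "x = (1 - u) *\<^sub>R circlepath 0 s t + u *\<^sub>R circlepath 0 s' t"
        by (auto simp: in_segment)
      have "x = circlepath 0 ((1 - u) * s + u * s') t"
        by (simp add: u(3) circlepath scaleR_conv_of_real algebra_simps)
      then have nx: "norm x = \<bar>(1 - u) * s + u * s'\<bar>" by (simp add: norm_circlepath_0)
      have "(1 - u) * s + u * s' \<in> {r0<..<r9}"
        using convexD[of "{r0<..<r9}" s s' "1 - u" u] s u by simp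
      then show "x \<in> ?A" using nx s by auto
    qed
  qed auto
  ultimately have "contour_integral (circlepath 0 s) f = contour_integral (circlepath 0 s') f"
    by (intro Cauchy_theorem_homotopic_loops[where S = ?A] f) auto
  then show ?thesis by (simp add: contour_integral_cint)
qed

lemma cint_Cauchy_inside: "norm z < r \<Longrightarrow> cint r (\<lambda>w. 1 / (w - z)) = 1"
proof -
  assume z: "norm z < r"
  have "((\<lambda>u. 1 / (u - z)) has_contour_integral (2 * of_real pi * \<i> * 1)) (circlepath 0 r)"
    by (rule Cauchy_integral_circlepath) (use z in \<open>auto intro!: holomorphic_intros continuous_intros\<close>)
  then have "contour_integral (circlepath 0 r) (\<lambda>w. 1 / (w - z)) = 2 * of_real pi * \<i>"
    by (simp add: contour_integral_unique)
  then show ?thesis unfolding contour_integral_cint by simp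
qed

lemma cint_Cauchy_outside: "0 < r \<Longrightarrow> r < norm z \<Longrightarrow> cint r (\<lambda>w. 1 / (w - z)) = 0"
proof -
  assume r: "0 < r" "r < norm z"
  have "((\<lambda>w. 1 / (w - z)) has_contour_integral 0) (circlepath 0 r)"
    by (rule Cauchy_theorem_disc_simple[of _ 0 "norm z"])
       (use r in \<open>auto intro!: holomorphic_intros\<close>)
  then have "contour_integral (circlepath 0 r) (\<lambda>w. 1 / (w - z)) = 0"
    by (rule contour_integral_unique)
  then show ?thesis unfolding contour_integral_cint by simp
qed

lemma cint_diff:
  assumes "continuous_on (sphere 0 r) f" "continuous_on (sphere 0 r) g" "r > 0"
  shows "cint r (\<lambda>w. f w - g w) = cint r f - cint r g"
proof -
  have "(\<lambda>t. h (circlepath 0 r t) * circlepath 0 r t) integrable_on {0..1}" if "continuous_on (sphere 0 r) h" for h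
    by (intro integrable_continuous_real continuous_intros continuous_on_compose2[OF that])
       (use assms(3) in \<open>auto simp: norm_circlepath_0\<close>)
  then show ?thesis using assms unfolding cint_def
    by (subst integral_diff[symmetric]) (simp_all add: left_diff_distrib)
qed

lemma cint_cmult: "cint r (\<lambda>w. c * f w) = c * cint r f"
  unfolding cint_def by (simp add: mult.assoc)

lemma cint_cong: "(\<And>z. norm z = r \<Longrightarrow> f z = g z) \<Longrightarrow> r > 0 \<Longrightarrow> cint r f = cint r g"
  unfolding cint_def by (intro integral_cong) (simp add: norm_circlepath_0)

text \<open>The quotient \<open>(f w - f z) / (w - z)\<close>, with its singularity removed, has the
  same integral over both circles, while the kernel \<open>1 / (w - z)\<close> integrates to 1 over
  the outer circle and to 0 over the inner one.\<close>

lemma Cauchy_annulus: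
  assumes f: "f holomorphic_on {z. r0 < norm z \<and> norm z < r9}"
    and s: "0 \<le> r0" "r0 < s" "s < norm z" "norm z < s'" "s' < r9"
  shows "f z = cint s' (\<lambda>w. f w / (w - z)) - cint s (\<lambda>w. f w / (w - z))"
proof -
  let ?A = "{z::complex. r0 < norm z \<and> norm z < r9}"
  have A: "open ?A" by (intro open_Collect_conj open_Collect_less continuous_intros)
  have zA: "z \<in> ?A" using s by simp
  define g where "g w = (if w = z then deriv f z else (f w - f z) / (w - z))" for w
  have "g holomorphic_on ?A"
    unfolding g_def by (rule pole_lemma[OF f]) (use A zA interior_open in auto)
  then have "cint s' g = cint s g"
    by (rule cint_annulus) (use s in auto)
  moreover have "cint r g = cint r (\<lambda>w. f w / (w - z)) - f z * cint r (\<lambda>w. 1 / (w - z))" if r: "r = s \<or> r = s'" for r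
  proof -
    have r0: "r > 0" using r s by auto
    have cont: "continuous_on (sphere 0 r) f"
      by (rule holomorphic_on_imp_continuous_on[OF holomorphic_on_subset[OF f]]) (use r s in auto)
    have nz: "w - z \<noteq> 0" if "w \<in> sphere 0 r" for w using that r s by auto
    have "cint r g = cint r (\<lambda>w. f w / (w - z) - f z * (1 / (w - z)))"
      by (rule cint_cong[OF _ r0]) (use nz in \<open>auto simp: g_def diff_divide_distrib\<close>)
    also have "\<dots> = cint r (\<lambda>w. f w / (w - z)) - cint r (\<lambda>w. f z * (1 / (w - z)))"
      by (rule cint_diff[OF _ _ r0]) (use nz in \<open>auto intro!: continuous_intros cont\<close>)
    finally show ?thesis by (simp only: cint_cmult)
  qed
  moreover have "cint s' (\<lambda>w. 1 / (w - z)) = 1" using s by (intro cint_Cauchy_inside) auto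
  moreover have "cint s (\<lambda>w. 1 / (w - z)) = 0" using s by (intro cint_Cauchy_outside) auto
  ultimately show ?thesis by (auto simp: algebra_simps)
qed

text \<open>The box may have any dimension: circle integrals use one real parameter, the primitive
  constructed in \<open>elliptic_expansion\<close> uses two.\<close>

lemma param_integral_deriv:
  fixes \<phi> \<psi> :: "'b::euclidean_space \<Rightarrow> complex"
  assumes \<phi>: "continuous_on (cbox a b) \<phi>" and \<psi>: "continuous_on (cbox a b) \<psi>"
    and h: "h holomorphic_on A" "open A" and U: "open U" "z \<in> U"
    and sub: "\<And>z t. z \<in> U \<Longrightarrow> t \<in> cbox a b \<Longrightarrow> z - \<psi> t \<in> A"
  shows "((\<lambda>z. integral (cbox a b) (\<lambda>t. \<phi> t * h (z - \<psi> t))) has_field_derivative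
     integral (cbox a b) (\<lambda>t. \<phi> t * deriv h (z - \<psi> t))) (at z)"
proof -
  obtain r where r: "r > 0" "ball z r \<subseteq> U" using U open_contains_ball by blast
  have "((\<lambda>z. integral (cbox a b) (\<lambda>t. \<phi> t * h (z - \<psi> t))) has_field_derivative
     integral (cbox a b) (\<lambda>t. \<phi> t * deriv h (z - \<psi> t))) (at z within ball z r)"
  proof (rule leibniz_rule_field_derivative)
    fix x t assume xt: "x \<in> ball z r" "t \<in> cbox a b"
    then have "x - \<psi> t \<in> A" using sub r by auto
    then have d: "(h has_field_derivative deriv h (x - \<psi> t)) (at (x - \<psi> t))"
      using holomorphic_derivI[OF h] by blast
    have "((\<lambda>x. h (x - \<psi> t)) has_field_derivative deriv h (x - \<psi> t) * 1) (at x)"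
      by (rule DERIV_chain2[where f = h and g = "\<lambda>x. x - \<psi> t", OF d]) (auto intro!: derivative_eq_intros)
    then have "((\<lambda>x. h (x - \<psi> t)) has_field_derivative deriv h (x - \<psi> t)) (at x)" by simp
    from has_field_derivative_at_within[OF DERIV_cmult[OF this]]
    show "((\<lambda>x. \<phi> t * h (x - \<psi> t)) has_field_derivative \<phi> t * deriv h (x - \<psi> t)) (at x within ball z r)" .
  next
    fix x assume x: "x \<in> ball z r"
    show "(\<lambda>t. \<phi> t * h (x - \<psi> t)) integrable_on cbox a b"
      by (intro integrable_continuous continuous_intros \<phi> \<psi>
           continuous_on_compose2[OF holomorphic_on_imp_continuous_on[OF h(1)]]) (use x r sub in auto)
  next
    have "continuous_on (ball z r \<times> cbox a b) (\<lambda>p. \<phi> (snd p) * deriv h (fst p - \<psi> (snd p)))"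
      by (intro continuous_intros continuous_on_compose2[OF \<phi>] continuous_on_compose2[OF \<psi>]
           continuous_on_compose2[OF holomorphic_on_imp_continuous_on[OF holomorphic_deriv[OF h]]])
         (use r sub in auto)
    then show "continuous_on (ball z r \<times> cbox a b) (\<lambda>(x, t). \<phi> t * deriv h (x - \<psi> t))"
      by (simp add: case_prod_unfold)
  qed (use r in auto)
  moreover have "at z within ball z r = at z" using r by (intro at_within_open) auto
  ultimately show ?thesis by (simp only:)
qed

lemma param_integral_holomorphic:
  fixes \<phi> \<psi> :: "'b::euclidean_space \<Rightarrow> complex"
  assumes "continuous_on (cbox a b) \<phi>" "continuous_on (cbox a b) \<psi>"
    "h holomorphic_on A" "open A" "open U" "\<And>z t. z \<in> U \<Longrightarrow> t \<in> cbox a b \<Longrightarrow> z - \<psi> t \<in> A"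
  shows "(\<lambda>z. integral (cbox a b) (\<lambda>t. \<phi> t * h (z - \<psi> t))) holomorphic_on U"
  using param_integral_deriv[OF assms(1-5) _ assms(6)] assms(5) holomorphic_on_open by blast

lemma param_integral_higher_deriv:
  fixes \<phi> \<psi> :: "'b::euclidean_space \<Rightarrow> complex"
  assumes "continuous_on (cbox a b) \<phi>" "continuous_on (cbox a b) \<psi>"
    "h holomorphic_on A" "open A" "open U" "z \<in> U" "\<And>z t. z \<in> U \<Longrightarrow> t \<in> cbox a b \<Longrightarrow> z - \<psi> t \<in> A"
  shows "(deriv ^^ n) (\<lambda>z. integral (cbox a b) (\<lambda>t. \<phi> t * h (z - \<psi> t))) z =
     integral (cbox a b) (\<lambda>t. \<phi> t * (deriv ^^ n) h (z - \<psi> t))"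
  using assms(6)
proof (induction n arbitrary: z)
  case (Suc n)
  have "eventually (\<lambda>z. z \<in> U) (nhds z)" using Suc.prems assms(5) by (rule eventually_nhds_in_open[rotated])
  then have "eventually (\<lambda>z. (deriv ^^ n) (\<lambda>z. integral (cbox a b) (\<lambda>t. \<phi> t * h (z - \<psi> t))) z =
     integral (cbox a b) (\<lambda>t. \<phi> t * (deriv ^^ n) h (z - \<psi> t))) (nhds z)"
    by eventually_elim (rule Suc.IH)
  then have "deriv ((deriv ^^ n) (\<lambda>z. integral (cbox a b) (\<lambda>t. \<phi> t * h (z - \<psi> t)))) z =
     deriv (\<lambda>z. integral (cbox a b) (\<lambda>t. \<phi> t * (deriv ^^ n) h (z - \<psi> t))) z"
    by (rule deriv_cong_ev) simp
  also have "\<dots> = integral (cbox a b) (\<lambda>t. \<phi> t * deriv ((deriv ^^ n) h) (z - \<psi> t))"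
    by (rule DERIV_imp_deriv, rule param_integral_deriv[OF assms(1,2) holomorphic_higher_deriv[OF assms(3,4)] assms(4,5) Suc.prems assms(7)])
  finally show ?case by simp
qed simp

section \<open>Elliptic functions on the excised torus: Laurent coefficients and periods\<close>

context torus
begin

lemma open_far: "open {z. \<forall>w\<in>\<Lambda>. r < norm (z - w)}"
proof -
  have "{z. \<forall>w\<in>\<Lambda>. r < norm (z - w)} = {z. r < infdist z \<Lambda>}"
  proof -
    have "(\<forall>w\<in>\<Lambda>. r < norm (z - w)) \<longleftrightarrow> r < infdist z \<Lambda>" for z
    proof
      assume *: "\<forall>w\<in>\<Lambda>. r < norm (z - w)"
      have "closed \<Lambda>" using open_compl_lattice by (simp add: closed_def)
      then obtain w where "w \<in> \<Lambda>" "infdist z \<Lambda> = dist z w"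
        using infdist_attains_inf[of \<Lambda> z] lattice_0 by blast
      then show "r < infdist z \<Lambda>" using * by (simp add: dist_norm)
    next
      assume "r < infdist z \<Lambda>"
      then show "\<forall>w\<in>\<Lambda>. r < norm (z - w)"
        by (metis dist_norm infdist_le order_less_le_trans)
    qed
    then show ?thesis by auto
  qed
  then show ?thesis by (simp add: open_Collect_less continuous_on_infdist)
qed

lemma t_coord_periods: "t_coord \<omega>\<^sub>1 = 0" "t_coord \<omega>\<^sub>2 = 1"
  using Im_pos by (simp_all add: t_coord_def)

lemma far_shift_iff:
  assumes "w \<in> \<Lambda>"
  shows "(\<forall>u\<in>\<Lambda>. r \<le> norm (z + w - u)) \<longleftrightarrow> (\<forall>u\<in>\<Lambda>. r \<le> norm (z - u))"
proof safe
  fix u assume *: "\<forall>u\<in>\<Lambda>. r \<le> norm (z + w - u)" "u \<in> \<Lambda>"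
  then have "r \<le> norm (z + w - (u + w))" using lattice_add assms by blast
  then show "r \<le> norm (z - u)" by simp
next
  fix u assume *: "\<forall>u\<in>\<Lambda>. r \<le> norm (z - u)" "u \<in> \<Lambda>"
  then have "r \<le> norm (z - (u - w))" using lattice_diff assms by blast
  then show "r \<le> norm (z + w - u)" by (simp add: algebra_simps)
qed

text \<open>
  The derivative of the glued entire function is elliptic, hence constant by Liouville's theorem;
  the two periods then force first the slope and next the increment \<open>c\<close> to vanish.
\<close>

lemma quasi_elliptic_constant:
  fixes h e :: "complex \<Rightarrow> complex"
  assumes \<rho>: "0 < \<rho>" "\<rho> < R" "R + \<rho> \<le> D"
    and h: "h holomorphic_on {z. \<forall>w\<in>\<Lambda>. \<rho> < norm (z - w)}"
    and per: "\<And>z w. \<forall>u\<in>\<Lambda>. \<rho> \<le> norm (z - u) \<Longrightarrow> w \<in> \<Lambda> \<Longrightarrow> h (z + w) = h z + of_real (t_coord w) * c"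
    and e: "e holomorphic_on ball 0 R"
    and he: "\<And>z. \<rho> \<le> norm z \<Longrightarrow> norm z < R \<Longrightarrow> h z = e z"
  obtains \<gamma> where "c = 0" "\<And>z. \<forall>u\<in>\<Lambda>. \<rho> \<le> norm (z - u) \<Longrightarrow> h z = \<gamma>" "\<And>z. norm z < R \<Longrightarrow> e z = \<gamma>"
proof -
  define far where "far z \<longleftrightarrow> (\<forall>u\<in>\<Lambda>. \<rho> \<le> norm (z - u))" for z
  define near where "near z = (SOME w. w \<in> \<Lambda> \<and> norm (z - w) < \<rho>)" for z
  define H where "H z = (if far z then h z else e (z - near z) + of_real (t_coord (near z)) * c)" for z
  have H1: "H z = e (z - w) + of_real (t_coord w) * c" if w: "w \<in> \<Lambda>" "norm (z - w) < R" for z w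
  proof (cases "far z")
    case True
    have "far (z - w)" using far_shift_iff[OF lattice_minus[OF w(1)]] True by (simp add: far_def)
    then have "h (z - w + w) = h (z - w) + of_real (t_coord w) * c"
      by (intro per w) (simp add: far_def)
    moreover have "h (z - w) = e (z - w)"
      using True w by (intro he) (auto simp: far_def)
    ultimately show ?thesis using True by (simp add: H_def)
  next
    case False
    then have "\<exists>w. w \<in> \<Lambda> \<and> norm (z - w) < \<rho>" by (auto simp: far_def not_le)
    from someI_ex[OF this] have n: "near z \<in> \<Lambda>" "norm (z - near z) < \<rho>" by (auto simp: near_def)
    then have "near z = w" using w \<rho> by (intro lattice_near_unique[of _ _ z]) auto
    then show ?thesis using False by (simp add: H_def)
  qed
  have Hper: "H (z + w) = H z + of_real (t_coord w) * c" if w: "w \<in> \<Lambda>" for z w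
  proof (cases "far z")
    case True
    then show ?thesis using far_shift_iff[OF w, of \<rho> z] per[OF _ w, of z] by (simp add: H_def far_def)
  next
    case False
    then obtain u where u: "u \<in> \<Lambda>" "norm (z - u) < \<rho>" by (auto simp: far_def not_le)
    have "H z = e (z - u) + of_real (t_coord u) * c" using u \<rho> by (intro H1) auto
    moreover have "H (z + w) = e (z + w - (u + w)) + of_real (t_coord (u + w)) * c"
      using u \<rho> by (intro H1 lattice_add w) auto
    ultimately show ?thesis by (simp add: coord_add algebra_simps)
  qed
  have "H field_differentiable at z" for z
  proof (cases "\<forall>w\<in>\<Lambda>. \<rho> < norm (z - w)")
    case True
    have "H holomorphic_on {z. \<forall>w\<in>\<Lambda>. \<rho> < norm (z - w)}"
      by (rule holomorphic_transform[OF h]) (auto simp: H_def far_def less_imp_le)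
    then show ?thesis using True open_far by (intro holomorphic_on_imp_differentiable_at) auto
  next
    case False
    then obtain w where w: "w \<in> \<Lambda>" "norm (z - w) \<le> \<rho>" by (auto simp: not_less)
    have "(\<lambda>z. e (z - w) + of_real (t_coord w) * c) holomorphic_on ball w R"
      by (intro holomorphic_intros holomorphic_on_compose_gen[of "\<lambda>z. z - w" _ e, unfolded o_def, OF _ e])
         (auto simp: dist_norm norm_minus_commute)
    then have "H holomorphic_on ball w R"
      by (rule holomorphic_transform) (use H1[OF w(1)] in \<open>auto simp: dist_norm norm_minus_commute\<close>)
    then show ?thesis using w \<rho> by (intro holomorphic_on_imp_differentiable_at) (auto simp: dist_norm norm_minus_commute)
  qed
  then have Hd: "(H has_field_derivative deriv H z) (at z)" for z
    using field_differentiable_derivI by blast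
  then have Hh: "H holomorphic_on UNIV" by (auto simp: holomorphic_on_open)
  then have dH: "deriv H holomorphic_on UNIV" by (intro holomorphic_deriv) auto
  have dper: "deriv H (z + w) = deriv H z" if w: "w \<in> \<Lambda>" for z w
  proof -
    have "((\<lambda>z. H (z + w)) has_field_derivative deriv H (z + w) * 1) (at z)"
      by (rule DERIV_chain2[where f = H and g = "\<lambda>z. z + w", OF Hd]) (auto intro!: derivative_eq_intros)
    moreover have "((\<lambda>z. H (z + w)) has_field_derivative deriv H z) (at z)"
      unfolding Hper[OF w] by (auto intro!: derivative_eq_intros Hd)
    ultimately show ?thesis using DERIV_unique by fastforce
  qed
  obtain M where "\<And>z. norm (deriv H z) \<le> M"
    using periodic_bounded[OF holomorphic_on_imp_continuous_on[OF dH] dper] by blast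
  then have "bounded (range (deriv H))" by (auto simp: bounded_iff)
  then obtain \<kappa> where \<kappa>: "\<And>z. deriv H z = \<kappa>"
    using Liouville_theorem[OF dH] by (auto simp: constant_on_def)
  have "((\<lambda>z. H z - \<kappa> * z) has_field_derivative 0) (at z within UNIV)" for z
    using Hd[of z] by (auto intro!: derivative_eq_intros simp: \<kappa>)
  then obtain \<gamma> where "\<And>z. H z - \<kappa> * z = \<gamma>"
    using has_field_derivative_zero_constant[of UNIV "\<lambda>z. H z - \<kappa> * z"] by auto
  then have Hz: "H z = \<gamma> + \<kappa> * z" for z by (metis add_diff_cancel_left' diff_add_cancel add.commute)
  have "\<kappa> = 0" using Hper[OF lattice_1, of 0] by (simp add: Hz t_coord_periods)
  then have H\<gamma>: "H z = \<gamma>" for z using Hz by simp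
  have c0: "c = 0" using Hper[OF lattice_2, of 0] by (simp add: H\<gamma> t_coord_periods)
  show ?thesis
  proof (rule that[OF c0])
    show "h z = \<gamma>" if "\<forall>u\<in>\<Lambda>. \<rho> \<le> norm (z - u)" for z
      using H\<gamma>[of z] that by (simp add: H_def far_def)
    show "e z = \<gamma>" if "norm z < R" for z
      using H1[OF lattice_0, of z] H\<gamma>[of z] that c0 by simp
  qed
qed
lemma far_minus_near:
  assumes "\<And>w. w \<in> \<Lambda> \<Longrightarrow> r < norm (z - w)" "norm c \<le> r"
  shows "z - c \<notin> \<Lambda>"
proof
  assume "z - c \<in> \<Lambda>"
  then have "r < norm (z - (z - c))" by (rule assms(1))
  then show False using assms(2) by simp
qed

text \<open>The two signs \<open>(- 1) ^ l\<close> and \<open>(- 1) ^ k\<close> disagree only when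
  \<open>k + l\<close> is odd, and then both sides vanish.\<close>

lemma moment_C_eq_higher_deriv:
  "(deriv ^^ (Suc l + k)) reg 0 / (fact (Suc l) * fact k) * (- 1) ^ Suc l = moment_C (Suc k) (Suc l) \<tau> / of_nat (Suc l)"
proof (cases "even (k + l)")
  case False
  then have "odd (Suc k + Suc l)" "odd (Suc (Suc l + k))" by simp_all
  then have "eisenstein (Suc k + Suc l) \<tau> = 0" "eisenstein (Suc (Suc l + k)) \<tau> = 0"
    by (blast intro: eisenstein_odd)+
  then show ?thesis by (simp only: moment_C_def higher_deriv_reg mult_zero_right mult_zero_left div_0)
next
  case True
  then have s: "(- 1) ^ l = ((- 1) ^ k :: complex)" by (simp add: minus_one_power_iff)
  have f: "(fact (Suc l) :: complex) = of_nat (Suc l) * fact l" by simp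
  have e: "Suc (Suc l + k) = Suc k + Suc l" "Suc l + k = Suc k + Suc l - 1" "Suc k - 1 = k" "Suc l - 1 = l" by simp_all
  show ?thesis
    unfolding moment_C_def higher_deriv_reg f e(1,3,4) power_Suc s
    by (simp add: divide_inverse mult_ac e(2) add_ac)
qed

lemma integral_power_series:
  fixes \<phi> c :: "real \<Rightarrow> complex"
  assumes \<phi>: "continuous_on {0..1} \<phi>" and c: "continuous_on {0..1} c"
    and r: "\<And>t. norm (c t) = r" "r < D"
    and h: "h holomorphic_on ball 0 D"
  shows "(\<lambda>n. (deriv ^^ n) h 0 / fact n * integral {0..1} (\<lambda>t. \<phi> t * c t ^ n)) sums integral {0..1} (\<lambda>t. \<phi> t * h (c t))"
proof -
  define a where "a n = (deriv ^^ n) h 0 / fact n" for n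
  have r0: "r \<ge> 0" using r(1)[of 0] by auto
  have sums: "(\<lambda>n. a n * z ^ n) sums h z" if "norm z < D" for z
    using holomorphic_power_series[OF h, of z] that by (simp add: a_def)
  have "compact (\<phi> ` {0..1})" by (intro compact_continuous_image \<phi>) auto
  then obtain M where M: "\<And>t. t \<in> {0..1} \<Longrightarrow> norm (\<phi> t) \<le> M"
    by (meson bounded_iff compact_imp_bounded imageI)
  have sm: "summable (\<lambda>n. M * (norm (a n) * r ^ n))"
  proof (rule summable_mult)
    have "summable (\<lambda>n. a n * (of_real ((r + D) / 2) :: complex) ^ n)"
      using sums[of "of_real ((r + D) / 2)"] r r0 unfolding norm_of_real by (simp add: sums_iff)
    then have "summable (\<lambda>n. norm (a n * of_real r ^ n))"
      by (rule powser_insidea) (unfold norm_of_real, use r r0 in auto)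
    then show "summable (\<lambda>n. norm (a n) * r ^ n)" using r0 by (simp add: norm_mult norm_power)
  qed
  have ul: "uniform_limit (cbox 0 1) (\<lambda>m t. \<Sum>n<m. a n * (\<phi> t * c t ^ n)) (\<lambda>t. \<Sum>n. a n * (\<phi> t * c t ^ n)) sequentially"
  proof (rule Weierstrass_m_test[OF _ sm])
    fix n and t :: real assume "t \<in> cbox 0 1"
    then have "norm (\<phi> t) \<le> M" using M by simp
    then have "norm (\<phi> t) * (norm (a n) * r ^ n) \<le> M * (norm (a n) * r ^ n)"
      using r0 by (intro mult_right_mono) auto
    then show "norm (a n * (\<phi> t * c t ^ n)) \<le> M * (norm (a n) * r ^ n)"
      by (simp add: norm_mult norm_power r mult_ac)
  qed
  obtain I J where IJ: "\<And>m. ((\<lambda>t. \<Sum>n<m. a n * (\<phi> t * c t ^ n)) has_integral I m) (cbox 0 1)"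
    "((\<lambda>t. \<Sum>n. a n * (\<phi> t * c t ^ n)) has_integral J) (cbox 0 1)" "I \<longlonglongrightarrow> J"
    by (rule uniform_limit_integral_cbox[OF ul]) (use \<phi> c in \<open>auto intro!: continuous_intros\<close>)
  have int: "(\<lambda>t. a n * (\<phi> t * c t ^ n)) integrable_on {0..1}" for n
    by (intro integrable_continuous_real continuous_intros \<phi> c)
  have Im: "I m = (\<Sum>n<m. a n * integral {0..1} (\<lambda>t. \<phi> t * c t ^ n))" for m
  proof -
    have "I m = integral {0..1} (\<lambda>t. \<Sum>n<m. a n * (\<phi> t * c t ^ n))"
      using IJ(1)[of m] by (simp add: integral_unique)
    also have "\<dots> = (\<Sum>n<m. integral {0..1} (\<lambda>t. a n * (\<phi> t * c t ^ n)))"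
      by (rule integral_sum) (use int in auto)
    finally show ?thesis by simp
  qed
  have J: "J = integral {0..1} (\<lambda>t. \<phi> t * h (c t))"
  proof -
    have "(\<Sum>n. a n * (\<phi> t * c t ^ n)) = \<phi> t * h (c t)" for t
      using sums_mult[OF sums[of "c t"], of "\<phi> t"] r by (simp add: sums_iff mult_ac)
    then show ?thesis using IJ(2) by (simp add: integral_unique)
  qed
  show ?thesis using IJ(3) unfolding sums_def a_def[symmetric] Im[abs_def] J .
qed

text \<open>The bounding circle is compact, so analyticity on it extends uniformly a little way into
  the removed disc. The gap between \<open>r0\<close> and \<rho> is needed to integrate over a
  circle that the closed excised torus does not meet.\<close>

lemma analytic_on_annulus:
  assumes f: "f analytic_on {z. \<forall>w\<in>\<Lambda>. \<rho> \<le> norm (z - w)}" and \<rho>: "0 < \<rho>" "2 * \<rho> < D"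
  obtains r0 where "0 \<le> r0" "r0 < \<rho>" "f holomorphic_on {z. r0 < norm z \<and> norm z < D - \<rho>}"
proof -
  let ?E = "{z. \<forall>w\<in>\<Lambda>. \<rho> \<le> norm (z - w)}"
  obtain T where T: "open T" "?E \<subseteq> T" "f holomorphic_on T"
    using f unfolding analytic_on_holomorphic by blast
  have ring: "z \<in> ?E" if "\<rho> \<le> norm z" "norm z < D - \<rho>" for z
    using far_from_lattice[of z \<rho>] that by auto
  have "sphere 0 \<rho> \<subseteq> T" using ring T(2) \<rho> by auto
  then obtain d where d: "d > 0" "{x. infdist x (sphere 0 \<rho>) \<le> d} \<subseteq> T"
    using compact_in_open_separated[of "sphere (0::complex) \<rho>" T] T(1) \<rho> by auto
  show ?thesis
  proof (rule that[of "max 0 (\<rho> - d)"])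
    show "f holomorphic_on {z. max 0 (\<rho> - d) < norm z \<and> norm z < D - \<rho>}"
    proof (rule holomorphic_on_subset[OF T(3)], safe)
      fix z :: complex assume z: "max 0 (\<rho> - d) < norm z" "norm z < D - \<rho>"
      show "z \<in> T"
      proof (cases "\<rho> \<le> norm z")
        case True
        then show ?thesis using ring T(2) z by blast
      next
        case False
        have z0: "norm z > 0" using z by simp
        define y where "y = of_real (\<rho> / norm z) * z"
        have "y \<in> sphere 0 \<rho>" using z0 \<rho> by (simp add: y_def norm_mult norm_divide)
        have "z - y = of_real (1 - \<rho> / norm z) * z" by (simp add: y_def algebra_simps)
        then have "norm (z - y) = \<bar>1 - \<rho> / norm z\<bar> * norm z" by (simp only: norm_mult norm_of_real)
        also have "\<dots> = \<rho> - norm z" using False z0 by (simp add: abs_if field_simps)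
        finally have "dist z y \<le> d" using z by (simp add: dist_norm)
        then have "infdist z (sphere 0 \<rho>) \<le> d" using infdist_le2[OF \<open>y \<in> sphere 0 \<rho>\<close>] by blast
        then show ?thesis using d by auto
      qed
    qed
  qed (use \<rho> d in auto)
qed

text \<open>Here \<open>c k\<close> is the Laurent coefficient of \<open>z ^ k\<close> and
  \<open>b l\<close> that of \<open>1 / z ^ Suc l\<close>. A superposition \<open>S\<close> of
  translates of \<open>P\<close> reproduces the singular part of \<open>f\<close>, and Liouville's
  theorem makes \<open>f - S\<close> a constant \<gamma>. Taylor coefficients at 0 then give the
  series in the moments, and a quasi-periodic primitive of \<open>S\<close> gives the
  periods.\<close>

lemma elliptic_expansion:
  fixes f :: "complex \<Rightarrow> complex" and \<rho> :: real
  defines "E \<equiv> {z. \<forall>w\<in>\<Lambda>. \<rho> \<le> norm (z - w)}"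
  defines "c \<equiv> \<lambda>k. cint \<rho> (\<lambda>w. f w / w ^ Suc k)"
  defines "b \<equiv> \<lambda>l. cint \<rho> (\<lambda>w. f w * w ^ l)"
  assumes \<rho>: "0 < \<rho>" "2 * \<rho> < D" and f: "f analytic_on E"
    and per: "\<And>z w. z \<in> E \<Longrightarrow> w \<in> \<Lambda> \<Longrightarrow> f (z + w) = f z"
  obtains \<gamma> where
    "\<And>k. (\<lambda>l. moment_C (Suc k) (Suc l) \<tau> / of_nat (Suc l) * b (Suc l)) sums (c k - (if k = 0 then \<gamma> else 0))"
    "\<And>p w. valid_path p \<Longrightarrow> path_image p \<subseteq> E \<Longrightarrow> w \<in> \<Lambda> \<Longrightarrow> pathfinish p = pathstart p + w \<Longrightarrow>
       contour_integral p f = w * \<gamma> + of_real (t_coord w) * b 1"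
proof -
  obtain r0 where r0: "0 \<le> r0" "r0 < \<rho>" and hol: "f holomorphic_on {z. r0 < norm z \<and> norm z < D - \<rho>}"
    by (rule analytic_on_annulus[OF f[unfolded E_def] \<rho>])
  \<comment> \<open>Both circles lie in the annulus of analyticity: the first strictly inside the
    removed disc, the second further out. By \<open>cint_annulus\<close> the Laurent coefficients
    may be computed on either.\<close>
  define R1 where "R1 = (r0 + \<rho>) / 2"
  have R1: "r0 < R1" "R1 < \<rho>" "0 < R1" using r0 \<rho> by (auto simp: R1_def)
  define R2 where "R2 = D / 2"
  have R2: "\<rho> < R2" "R2 < D - \<rho>" using \<rho> by (auto simp: R2_def)
  let ?c1 = "circlepath 0 R1"
  let ?c2 = "circlepath 0 R2"
  have nc1: "norm (?c1 t) = R1" and nc2: "norm (?c2 t) = R2" for t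
    using R1 R2 \<rho> by (auto simp: norm_circlepath_0)
  define \<phi> where "\<phi> t = f (?c1 t) * ?c1 t" for t
  have fc: "continuous_on S (\<lambda>t. f (circlepath 0 r t))" if "r0 < r" "r < D - \<rho>" for r S
    by (rule continuous_on_compose2[OF holomorphic_on_imp_continuous_on[OF hol]])
       (use that r0 in \<open>auto intro!: continuous_intros simp: norm_circlepath_0\<close>)
  have \<phi>c: "continuous_on S \<phi>" for S
    unfolding \<phi>_def using R1 R2 by (intro continuous_intros fc) auto
  have c1c: "continuous_on S ?c1" and c2c: "continuous_on S ?c2" for S by (intro continuous_intros)+
  define Out where "Out = {z. \<forall>w\<in>\<Lambda>. R1 < norm (z - w)}"
  have oOut: "open Out" unfolding Out_def by (rule open_far)
  have EOut: "E \<subseteq> Out" using R1 by (auto simp: E_def Out_def intro: less_le_trans)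
  have notlat: "z - of_real x * ?c1 t \<notin> \<Lambda>" if "z \<in> Out" "0 \<le> x" "x \<le> 1" for z x t
  proof (rule far_minus_near)
    show "R1 < norm (z - w)" if "w \<in> \<Lambda>" for w using \<open>z \<in> Out\<close> that by (simp add: Out_def)
    show "norm (of_real x * ?c1 t) \<le> R1" using that R1 mult_left_le_one_le[of R1 x] by (simp add: norm_mult nc1)
  qed
  \<comment> \<open>Integrating \<open>P (z - w)\<close> against \<open>f\<close> over the inner
    circle superposes all principal parts at once, without a Laurent series. Near 0,
    \<open>g\<close> is the contribution of \<open>reg\<close> to \<open>S\<close>, and
    \<open>F\<close> is the outer half of Cauchy's formula for \<open>f\<close>.\<close>
  define S where "S z = integral (cbox 0 1) (\<lambda>t. \<phi> t * P (z - ?c1 t))" for z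
  define g where "g z = integral (cbox 0 1) (\<lambda>t. \<phi> t * reg (z - ?c1 t))" for z
  define F where "F z = integral (cbox 0 1) (\<lambda>t. - (f (?c2 t) * ?c2 t) * (1 / (z - ?c2 t)))" for z
  have S_hol: "S holomorphic_on Out"
    unfolding S_def
    by (rule param_integral_holomorphic[OF \<phi>c c1c P_holomorphic open_compl_lattice oOut])
       (use notlat[of _ 1] in auto)
  have g_hol: "g holomorphic_on ball 0 (D - R1)"
    unfolding g_def
  proof (rule param_integral_holomorphic[OF \<phi>c c1c reg_holomorphic open_ball open_ball])
    show "z - ?c1 t \<in> ball 0 D" if "z \<in> ball 0 (D - R1)" for z t
      using norm_triangle_ineq4[of z "?c1 t"] that by (simp add: nc1)
  qed
  have c2nz: "z - ?c2 t \<in> - {0}" if "z \<in> ball 0 R2" for z t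
    using that nc2[of t] by auto
  have inv_hol: "(\<lambda>u::complex. 1 / u) holomorphic_on - {0}" by (intro holomorphic_intros) auto
  have ophi: "open (- {0::complex})" by auto
  have f2c: "continuous_on X (\<lambda>t. - (f (?c2 t) * ?c2 t))" for X
    using r0 R2 by (intro continuous_intros fc) auto
  have F_hol: "F holomorphic_on ball 0 R2"
    unfolding F_def
    by (rule param_integral_holomorphic[OF f2c c2c inv_hol ophi open_ball c2nz])
  have Pint: "(\<lambda>t. \<phi> t * P (z - ?c1 t)) integrable_on {0..1}" if "z \<in> Out" for z
    by (intro integrable_continuous_real continuous_intros \<phi>c
         continuous_on_compose2[OF holomorphic_on_imp_continuous_on[OF P_holomorphic]])
       (use notlat[OF that, of 1] in auto)
  have \<phi>int: "\<phi> integrable_on {0..1}" by (intro integrable_continuous_real \<phi>c)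
  \<comment> \<open>The residue of \<open>f\<close> at 0. It appears as the quasi-period of
    \<open>- S\<close>, and \<open>quasi_elliptic_constant\<close> forces it to vanish.\<close>
  define n0 where "n0 = integral {0..1} \<phi>"
  have S_per: "S (z + w) = S z - of_real (t_coord w) * n0" if z: "z \<in> Out" and w: "w \<in> \<Lambda>" for z w
  proof -
    have "P (z + w - ?c1 t) = P (z - ?c1 t) - of_real (t_coord w)" for t
      using P_quasi_periodic[OF notlat[OF z, of 1 t] w] by (simp add: algebra_simps)
    then have "S (z + w) = integral {0..1} (\<lambda>t. \<phi> t * P (z - ?c1 t) - of_real (t_coord w) * \<phi> t)"
      by (simp add: S_def right_diff_distrib mult.commute)
    also have "\<dots> = integral {0..1} (\<lambda>t. \<phi> t * P (z - ?c1 t)) - integral {0..1} (\<lambda>t. of_real (t_coord w) * \<phi> t)"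
      by (rule integral_diff[OF Pint[OF z]]) (intro integrable_continuous_real continuous_intros \<phi>c)
    finally show ?thesis by (simp add: S_def n0_def)
  qed
  have near: "f z - S z = F z - g z" if z: "\<rho> \<le> norm z" "norm z < R2" for z
  proof -
    have zO: "z \<in> Out"
      using far_from_lattice[of z \<rho>] z R2 EOut by (auto simp: E_def)
    have "f z = cint R2 (\<lambda>w. f w / (w - z)) - cint R1 (\<lambda>w. f w / (w - z))"
      by (rule Cauchy_annulus[OF hol]) (use r0 R1 R2 z in auto)
    also have "cint R2 (\<lambda>w. f w / (w - z)) = F z"
      unfolding cint_def F_def
    proof (simp only: box_real, intro integral_cong)
      fix t
      have "?c2 t \<noteq> z" using nc2[of t] z by auto
      then show "f (?c2 t) / (?c2 t - z) * ?c2 t = - (f (?c2 t) * ?c2 t) * (1 / (z - ?c2 t))"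
        by (simp add: field_simps)
    qed
    also have "cint R1 (\<lambda>w. f w / (w - z)) = g z - S z"
    proof -
      have "cint R1 (\<lambda>w. f w / (w - z)) = integral {0..1} (\<lambda>t. \<phi> t * reg (z - ?c1 t) - \<phi> t * P (z - ?c1 t))"
        unfolding cint_def
      proof (intro integral_cong)
        fix t
        have nz: "z - ?c1 t \<noteq> 0" using nc1[of t] z R1 by auto
        then show "f (?c1 t) / (?c1 t - z) * ?c1 t = \<phi> t * reg (z - ?c1 t) - \<phi> t * P (z - ?c1 t)"
          unfolding P_eq_reg[OF nz] \<phi>_def by (simp add: field_simps)
      qed
      also have "\<dots> = g z - S z"
        unfolding g_def S_def box_real
      proof (rule integral_diff[OF _ Pint[OF zO]])
        have "z - ?c1 t \<in> ball 0 D" for t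
          using norm_triangle_ineq4[of z "?c1 t"] z R1 R2 by (simp add: nc1)
        then show "(\<lambda>t. \<phi> t * reg (z - ?c1 t)) integrable_on {0..1}"
          by (intro integrable_continuous_real continuous_intros \<phi>c
               continuous_on_compose2[OF holomorphic_on_imp_continuous_on[OF reg_holomorphic]]) auto
      qed
      finally show ?thesis .
    qed
    finally show ?thesis by simp
  qed
  obtain \<gamma> where n00: "n0 = 0" and fS: "\<And>z. \<forall>u\<in>\<Lambda>. \<rho> \<le> norm (z - u) \<Longrightarrow> f z - S z = \<gamma>"
    and Fg: "\<And>z. norm z < R2 \<Longrightarrow> F z - g z = \<gamma>"
  proof (rule quasi_elliptic_constant[of \<rho> R2 "\<lambda>z. f z - S z" n0 "\<lambda>z. F z - g z"])
    have "f holomorphic_on E" using f by (rule analytic_imp_holomorphic)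
    then show "(\<lambda>z. f z - S z) holomorphic_on {z. \<forall>w\<in>\<Lambda>. \<rho> < norm (z - w)}"
      by (intro holomorphic_intros holomorphic_on_subset[OF S_hol])
         (use R1 in \<open>auto simp: E_def Out_def less_imp_le intro: less_trans elim!: holomorphic_on_subset\<close>)
    show "f (z + w) - S (z + w) = f z - S z + of_real (t_coord w) * n0"
      if "\<forall>u\<in>\<Lambda>. \<rho> \<le> norm (z - u)" "w \<in> \<Lambda>" for z w
      using per[of z w] S_per[of z w] EOut that by (auto simp: E_def)
    show "(\<lambda>z. F z - g z) holomorphic_on ball 0 R2"
      by (intro holomorphic_intros F_hol holomorphic_on_subset[OF g_hol]) (use R1 R2 in auto)
  qed (use \<rho> R2 near in auto)
  have circ: "cint s h = cint s' h" if "h holomorphic_on {z. r0 < norm z \<and> norm z < D - \<rho>}"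
      "s \<in> {R1, \<rho>, R2}" "s' \<in> {R1, \<rho>, R2}" for h s s'
    by (rule cint_annulus[OF that(1)]) (use that r0 R1 R2 in auto)
  have b_eq: "b l = integral {0..1} (\<lambda>t. \<phi> t * ?c1 t ^ l)" for l
  proof -
    have "b l = cint R1 (\<lambda>w. f w * w ^ l)"
      unfolding b_def by (rule circ) (auto intro!: holomorphic_intros hol)
    then show ?thesis by (simp add: cint_def \<phi>_def mult_ac)
  qed
  have c_eq: "c k = integral {0..1} (\<lambda>t. f (?c2 t) / ?c2 t ^ k)" for k
  proof -
    have "c k = cint R2 (\<lambda>w. f w / w ^ Suc k)"
      unfolding c_def by (rule circ) (use r0 in \<open>auto intro!: holomorphic_intros hol\<close>)
    moreover have "?c2 t \<noteq> 0" for t using nc2[of t] R2 \<rho> by auto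
    ultimately show ?thesis by (simp add: cint_def)
  qed
  show ?thesis
  proof (rule that[of \<gamma>])
    fix k
    have 0: "(0::complex) \<in> ball 0 R2" using R2 \<rho> by simp
    have "(deriv ^^ k) F 0 = integral (cbox 0 1) (\<lambda>t. - (f (?c2 t) * ?c2 t) * (deriv ^^ k) (\<lambda>u. 1 / u) (0 - ?c2 t))"
      unfolding F_def by (rule param_integral_higher_deriv[OF f2c c2c inv_hol ophi open_ball 0 c2nz])
    also have "\<dots> = integral {0..1} (\<lambda>t. fact k * (f (?c2 t) / ?c2 t ^ k))"
      unfolding box_real
    proof (intro integral_cong)
      fix t
      have nz: "?c2 t \<noteq> 0" using nc2[of t] R2 \<rho> by auto
      have "(- 1) ^ k * (- 1) ^ k = (1::complex)" by (simp flip: power_mult_distrib)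
      then have "x * y * ((- 1) ^ k * fact k / (y * ((- 1) ^ k * y ^ k))) = fact k * (x / y ^ k)" if "y \<noteq> 0" for x y :: complex
        using that by (simp add: field_simps)
      then show "- (f (?c2 t) * ?c2 t) * (deriv ^^ k) (\<lambda>u. 1 / u) (0 - ?c2 t) = fact k * (f (?c2 t) / ?c2 t ^ k)"
        using higher_deriv_inverse[of "0 - ?c2 t" k] nz by (simp add: power_minus[of "?c2 t"])
    qed
    also have "\<dots> = fact k * c k" unfolding c_eq by (rule integral_mult_right)
    finally have dF: "(deriv ^^ k) F 0 = fact k * c k" .
    have 0: "(0::complex) \<in> ball 0 (D - R1)" using R1 \<rho> by simp
    have dg: "(deriv ^^ k) g 0 = integral (cbox 0 1) (\<lambda>t. \<phi> t * (deriv ^^ k) reg (0 - ?c1 t))"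
      unfolding g_def
    proof (rule param_integral_higher_deriv[OF \<phi>c c1c reg_holomorphic open_ball open_ball 0])
      show "z - ?c1 t \<in> ball 0 D" if "z \<in> ball 0 (D - R1)" for z t
        using norm_triangle_ineq4[of z "?c1 t"] that by (simp add: nc1)
    qed
    have "(deriv ^^ k) F 0 = (deriv ^^ k) (\<lambda>z. \<gamma> + g z) 0"
      by (rule higher_deriv_transform_within_open[OF F_hol _ open_ball])
         (use Fg R1 R2 \<rho> in \<open>auto intro!: holomorphic_intros holomorphic_on_subset[OF g_hol] simp: algebra_simps\<close>)
    also have "\<dots> = (deriv ^^ k) (\<lambda>z. \<gamma>) 0 + (deriv ^^ k) g 0"
      by (rule higher_deriv_add[OF _ g_hol open_ball 0]) auto
    finally have ck: "fact k * c k = (if k = 0 then \<gamma> else 0) + (deriv ^^ k) g 0"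
      by (simp add: dF higher_deriv_const)
    have "(\<lambda>n. (deriv ^^ n) ((deriv ^^ k) reg) 0 / fact n * integral {0..1} (\<lambda>t. \<phi> t * (- ?c1 t) ^ n))
       sums integral {0..1} (\<lambda>t. \<phi> t * (deriv ^^ k) reg (- ?c1 t))"
      using R1 \<rho>
      by (intro integral_power_series[where r = R1] \<phi>c continuous_intros holomorphic_higher_deriv reg_holomorphic open_ball)
         (auto simp: nc1)
    note s = sums_divide[OF this, of "fact k"]
    have eq: "(deriv ^^ n) ((deriv ^^ k) reg) 0 / fact n * integral {0..1} (\<lambda>t. \<phi> t * (- ?c1 t) ^ n) / fact k =
      (deriv ^^ (n + k)) reg 0 / (fact n * fact k) * (- 1) ^ n * b n" for n
    proof -
      have "integral {0..1} (\<lambda>t. \<phi> t * (- ?c1 t) ^ n) = integral {0..1} (\<lambda>t. (- 1) ^ n * (\<phi> t * ?c1 t ^ n))"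
        unfolding power_minus[of "?c1 _"] by (simp add: mult_ac)
      also have "\<dots> = (- 1) ^ n * b n" unfolding b_eq by (rule integral_mult_right)
      finally show ?thesis by (simp add: funpow_add)
    qed
    have "integral {0..1} (\<lambda>t. \<phi> t * (deriv ^^ k) reg (- ?c1 t)) = (deriv ^^ k) g 0"
      by (simp add: dg)
    with s have sums: "(\<lambda>n. (deriv ^^ (n + k)) reg 0 / (fact n * fact k) * (- 1) ^ n * b n) sums ((deriv ^^ k) g 0 / fact k)"
      unfolding eq by (simp only:)
    have "b 0 = 0" using n00 by (simp add: b_eq n0_def)
    then have "(\<lambda>n. (deriv ^^ (Suc n + k)) reg 0 / (fact (Suc n) * fact k) * (- 1) ^ Suc n * b (Suc n)) sums ((deriv ^^ k) g 0 / fact k)"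
      using sums by (subst sums_Suc_iff) simp
    then have "(\<lambda>l. moment_C (Suc k) (Suc l) \<tau> / of_nat (Suc l) * b (Suc l)) sums ((deriv ^^ k) g 0 / fact k)"
      unfolding moment_C_eq_higher_deriv .
    also have "(deriv ^^ k) g 0 / fact k = c k - (if k = 0 then \<gamma> else 0)"
    proof -
      have "(deriv ^^ k) g 0 = fact k * c k - (if k = 0 then \<gamma> else 0)" using ck by simp
      then show ?thesis by (cases "k = 0") (simp_all add: diff_divide_distrib)
    qed
    finally show "(\<lambda>l. moment_C (Suc k) (Suc l) \<tau> / of_nat (Suc l) * b (Suc l)) sums (c k - (if k = 0 then \<gamma> else 0))" .
  next
    fix p w assume p: "valid_path p" "path_image p \<subseteq> E" "pathfinish p = pathstart p + w" and w: "w \<in> \<Lambda>"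
    let ?\<phi> = "\<lambda>x::real \<times> real. - (\<phi> (fst x) * ?c1 (fst x))"
    let ?\<psi> = "\<lambda>x::real \<times> real. of_real (snd x) * ?c1 (fst x)"
    \<comment> \<open>A primitive of \<open>P\<close> itself would be logarithmic. Because the
      residue \<open>n0\<close> is 0, \<open>P (z - w)\<close> may be replaced by
      \<open>P (z - w) - P z\<close>, which is the integral of
      \<open>- w * deriv P (z - s * w)\<close> over \<open>s\<close> from 0 to 1. Hence this double
      integral is a single-valued primitive of \<open>S\<close>, and the quasi-period of
      \<open>P\<close> gives it the increment \<open>t_coord w * b 1\<close>.\<close>
    define T where "T z = integral (cbox (0, 0) (1, 1)) (\<lambda>x. ?\<phi> x * P (z - ?\<psi> x))" for z
    have \<phi>2c: "continuous_on X ?\<phi>" and \<psi>2c: "continuous_on X ?\<psi>" for X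
      by (intro continuous_intros continuous_on_compose2[OF \<phi>c[of UNIV]] continuous_on_compose2[OF c1c[of UNIV]]; simp)+
    have \<phi>3c: "continuous_on X (\<lambda>x. \<phi> (fst x) * ?c1 (fst x))" for X :: "(real \<times> real) set"
      using continuous_on_minus[OF \<phi>2c] by simp
    have sub: "z - ?\<psi> x \<in> - \<Lambda>" if "z \<in> Out" "x \<in> cbox (0, 0) (1, 1)" for z x
    proof -
      have "0 \<le> snd x" "snd x \<le> 1" using that(2) by (cases x; simp add: cbox_Pair_eq)+
      then show ?thesis using notlat[OF that(1)] by simp
    qed
    have T_deriv: "(T has_field_derivative S z) (at z)" if z: "z \<in> Out" for z
    proof -
      have "(T has_field_derivative integral (cbox (0, 0) (1, 1)) (\<lambda>x. ?\<phi> x * deriv P (z - ?\<psi> x))) (at z)"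
        unfolding T_def
        by (rule param_integral_deriv[OF \<phi>2c \<psi>2c P_holomorphic open_compl_lattice oOut z sub])
      also have "integral (cbox (0, 0) (1, 1)) (\<lambda>x. ?\<phi> x * deriv P (z - ?\<psi> x)) =
         integral (cbox 0 1) (\<lambda>t. integral (cbox 0 1) (\<lambda>s. ?\<phi> (t, s) * deriv P (z - ?\<psi> (t, s))))"
        by (rule integral_prod_continuous)
           (intro continuous_intros \<phi>2c \<psi>2c continuous_on_compose2[OF holomorphic_on_imp_continuous_on[OF holomorphic_deriv[OF P_holomorphic open_compl_lattice]]],
            use sub[OF z] in auto)
      also have "\<dots> = integral (cbox 0 1) (\<lambda>t. \<phi> t * P (z - ?c1 t) - \<phi> t * P z)"
      proof (intro integral_cong)
        fix t :: real
        have hi: "((\<lambda>s. \<phi> t * (- ?c1 t * deriv P (z - of_real s * ?c1 t))) has_integral \<phi> t * (P (z - of_real 1 * ?c1 t) - P (z - of_real 0 * ?c1 t))) {0..1}"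
        proof (rule has_integral_mult_right, rule fundamental_theorem_of_calculus)
          fix s :: real assume s: "s \<in> {0..1}"
          have d: "(P has_field_derivative deriv P (z - of_real s * ?c1 t)) (at (z - of_real s * ?c1 t))"
            using notlat[OF z, of s t] s by (intro holomorphic_derivI[OF P_holomorphic open_compl_lattice]) auto
          have "((\<lambda>u. P (z - u * ?c1 t)) has_field_derivative deriv P (z - of_real s * ?c1 t) * (- ?c1 t)) (at (of_real s))"
            by (rule DERIV_chain2[where f = P and g = "\<lambda>u. z - u * ?c1 t", OF d]) (auto intro!: derivative_eq_intros)
          from has_vector_derivative_real_field[OF this]
          show "((\<lambda>s. P (z - of_real s * ?c1 t)) has_vector_derivative - ?c1 t * deriv P (z - of_real s * ?c1 t)) (at s within {0..1})"
            by (simp add: mult.commute)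
        qed simp
        have "integral (cbox 0 1) (\<lambda>s. ?\<phi> (t, s) * deriv P (z - ?\<psi> (t, s))) =
            integral {0..1} (\<lambda>s. \<phi> t * (- ?c1 t * deriv P (z - of_real s * ?c1 t)))"
          unfolding box_real by (intro integral_cong) simp
        also have "\<dots> = \<phi> t * (P (z - of_real 1 * ?c1 t) - P (z - of_real 0 * ?c1 t))"
          using hi by (rule integral_unique)
        finally show "integral (cbox 0 1) (\<lambda>s. ?\<phi> (t, s) * deriv P (z - ?\<psi> (t, s))) = \<phi> t * P (z - ?c1 t) - \<phi> t * P z"
          by (simp add: right_diff_distrib)
      qed
      also have "\<dots> = S z - n0 * P z"
        unfolding S_def box_real n0_def
        by (subst integral_diff[OF Pint[OF z]]) (auto intro!: integrable_continuous_real continuous_intros \<phi>c)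
      finally show ?thesis using n00 by simp
    qed
    have T_per: "T (z + w) = T z + of_real (t_coord w) * b 1" if z: "z \<in> Out" for z
    proof -
      have "T (z + w) = integral (cbox (0, 0) (1, 1)) (\<lambda>x. ?\<phi> x * P (z - ?\<psi> x) + of_real (t_coord w) * (\<phi> (fst x) * ?c1 (fst x)))"
        unfolding T_def
      proof (intro integral_cong)
        fix x :: "real \<times> real" assume x: "x \<in> cbox (0, 0) (1, 1)"
        have eq: "P (z + w - ?\<psi> x) = P (z - ?\<psi> x) - of_real (t_coord w)"
          using P_quasi_periodic[OF _ w, of "z - ?\<psi> x"] sub[OF z x] by (simp add: algebra_simps)
        show "?\<phi> x * P (z + w - ?\<psi> x) = ?\<phi> x * P (z - ?\<psi> x) + of_real (t_coord w) * (\<phi> (fst x) * ?c1 (fst x))"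
          unfolding eq by (simp only: right_diff_distrib) simp
      qed
      also have "\<dots> = T z + integral (cbox (0, 0) (1, 1)) (\<lambda>x::real \<times> real. of_real (t_coord w) * (\<phi> (fst x) * ?c1 (fst x)))"
        unfolding T_def
      proof -
        have 1: "(\<lambda>x. ?\<phi> x * P (z - ?\<psi> x)) integrable_on cbox (0, 0) (1, 1)"
          by (intro integrable_continuous continuous_intros \<phi>2c \<psi>2c continuous_on_compose2[OF holomorphic_on_imp_continuous_on[OF P_holomorphic]])
             (use sub[OF z] in auto)
        have 2: "(\<lambda>x::real \<times> real. of_real (t_coord w) * (\<phi> (fst x) * ?c1 (fst x))) integrable_on cbox (0, 0) (1, 1)"
          by (intro integrable_continuous continuous_on_mult_left \<phi>3c)
        show "integral (cbox (0, 0) (1, 1)) (\<lambda>x. ?\<phi> x * P (z - ?\<psi> x) + of_real (t_coord w) * (\<phi> (fst x) * ?c1 (fst x))) =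
          integral (cbox (0, 0) (1, 1)) (\<lambda>x. ?\<phi> x * P (z - ?\<psi> x)) + integral (cbox (0, 0) (1, 1)) (\<lambda>x::real \<times> real. of_real (t_coord w) * (\<phi> (fst x) * ?c1 (fst x)))"
          using Henstock_Kurzweil_Integration.integral_add[OF 1 2] by simp
      qed
      also have "integral (cbox (0, 0) (1, 1)) (\<lambda>x::real\<times>real. of_real (t_coord w) * (\<phi> (fst x) * ?c1 (fst x))) =
        integral (cbox 0 1) (\<lambda>t. integral (cbox 0 (1::real)) (\<lambda>s. of_real (t_coord w) * (\<phi> t * ?c1 t)))"
        by (subst integral_prod_continuous) (simp_all add: continuous_on_mult_left \<phi>3c)
      also have "\<dots> = of_real (t_coord w) * b 1" by (simp add: b_eq)
      finally show ?thesis .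
    qed
    have deriv: "((\<lambda>z. \<gamma> * z + T z) has_field_derivative f z) (at z within E)" if "z \<in> E" for z
    proof -
      have "S z + \<gamma> = f z" using fS[of z] that by (simp add: E_def algebra_simps)
      moreover have "((\<lambda>z. \<gamma> * z + T z) has_field_derivative \<gamma> + S z) (at z)"
        using T_deriv[of z] that EOut by (auto intro!: derivative_eq_intros)
      ultimately show ?thesis by (simp add: add.commute has_field_derivative_at_within)
    qed
    have "contour_integral p f = (\<gamma> * pathfinish p + T (pathfinish p)) - (\<gamma> * pathstart p + T (pathstart p))"
      using contour_integral_primitive[OF deriv p(1,2)] by (rule contour_integral_unique)
    moreover have "pathstart p \<in> Out" using p(2) EOut pathstart_in_path_image by blast
    then have "T (pathfinish p) = T (pathstart p) + of_real (t_coord w) * b 1"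
      unfolding p(3) by (rule T_per)
    ultimately show "contour_integral p f = w * \<gamma> + of_real (t_coord w) * b 1"
      by (simp add: p(3) algebra_simps)
  qed
qed
end

section \<open>Alternating matrix products and the contraction of square-summable sequences\<close>

lemma bar_bar [simp]: "bar (bar a) = a"
  using exhaust_2[of a] by (auto simp: bar_def)

lemma bar_neq [simp]: "bar a \<noteq> a" "a \<noteq> bar a"
  using exhaust_2[of a] by (auto simp: bar_def)

lemma neq_iff_bar: "a \<noteq> b \<longleftrightarrow> b = bar a"
  using exhaust_2[of a] exhaust_2[of b] by (auto simp: bar_def)

lemma funpow_bar: "(bar ^^ m) a = (if even m then a else bar a)"
  by (induction m) auto

text \<open>The product of \<open>m\<close> matrices, taken alternately from the two tori and
  starting with torus \<open>a\<close>, applied to \<open>u\<close>, with all summation indices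
  below \<open>M\<close>. It is the truncated term of order \<open>m\<close> of the Neumann series,
  up to sign, and equally a sum over label sequences.\<close>

primrec chain :: "(2 \<Rightarrow> nat \<Rightarrow> nat \<Rightarrow> complex) \<Rightarrow> nat \<Rightarrow> (2 \<Rightarrow> nat \<Rightarrow> complex) \<Rightarrow> nat \<Rightarrow> 2 \<Rightarrow> nat \<Rightarrow> complex" where
  "chain A M u 0 a k = u a k"
| "chain A M u (Suc m) a k = (\<Sum>l<M. A a k l * chain A M u m (bar a) l)"

lemma chain_scale:
  "chain A M (\<lambda>a k. g a * u a k) m a k = g ((bar ^^ m) a) * chain A M u m a k"
  by (induction m arbitrary: a k)
     (simp_all add: sum_distrib_left mult_ac funpow_Suc_right del: funpow.simps(2))

definition l2 :: "nat \<Rightarrow> (nat \<Rightarrow> complex) \<Rightarrow> real" where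
  "l2 M x = L2_set (\<lambda>k. norm (x k)) {..<M}"

lemma l2_nonneg [simp]: "0 \<le> l2 M x" by (simp add: l2_def)

lemma l2_add: "l2 M (\<lambda>k. x k + y k) \<le> l2 M x + l2 M y"
proof -
  have "l2 M (\<lambda>k. x k + y k) \<le> L2_set (\<lambda>k. norm (x k) + norm (y k)) {..<M}"
    unfolding l2_def by (rule L2_set_mono) (auto intro: norm_triangle_ineq)
  also have "\<dots> \<le> l2 M x + l2 M y" unfolding l2_def by (rule L2_set_triangle_ineq)
  finally show ?thesis .
qed

lemma l2_uminus [simp]: "l2 M (\<lambda>k. - x k) = l2 M x" by (simp add: l2_def)

lemma norm_le_l2: "k < M \<Longrightarrow> norm (x k) \<le> l2 M x"
  unfolding l2_def by (rule member_le_L2_set) auto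

lemma l2_le_iff: "C \<ge> 0 \<Longrightarrow> l2 M x \<le> C \<longleftrightarrow> (\<Sum>k<M. (norm (x k))\<^sup>2) \<le> C\<^sup>2"
  unfolding l2_def L2_set_def using real_sqrt_le_iff[of "\<Sum>k<M. (norm (x k))\<^sup>2" "C\<^sup>2"] by simp

text \<open>The Grunsky inequality for rectangular sections: the numbers of rows and columns are
  independent, so a vector supported far out can be tested against the first \<open>M\<close> rows.
  This is how the truncation error is estimated. \<eta> is the factor gained per edge.\<close>

locale contraction =
  fixes G :: "2 \<Rightarrow> nat \<Rightarrow> nat \<Rightarrow> complex" and \<eta> :: complex
  assumes contr: "\<And>a N L y. (\<Sum>k<N. (norm (\<Sum>l<L. G a k l * y l))\<^sup>2) \<le> (\<Sum>l<L. (norm (y l))\<^sup>2)"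
    and \<eta>: "norm \<eta> < 1"
begin

definition B :: "2 \<Rightarrow> nat \<Rightarrow> nat \<Rightarrow> complex" where "B a k l = G a k l * \<eta> ^ Suc l"

lemma l2_B: "l2 N (\<lambda>k. \<Sum>l<L. B a k l * y l) \<le> norm \<eta> * l2 L y"
proof -
  have "(\<Sum>k<N. (norm (\<Sum>l<L. B a k l * y l))\<^sup>2) \<le> (\<Sum>l<L. (norm (\<eta> ^ Suc l * y l))\<^sup>2)"
    using contr[where a = a and N = N and L = L and y = "\<lambda>l. \<eta> ^ Suc l * y l"] by (simp only: B_def mult.assoc)
  also have "\<dots> \<le> (\<Sum>l<L. (norm \<eta>)\<^sup>2 * (norm (y l))\<^sup>2)"
  proof (rule sum_mono)
    fix l
    have "norm (\<eta> ^ Suc l * y l) = norm \<eta> ^ l * (norm \<eta> * norm (y l))" by (simp add: norm_mult norm_power)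
    also have "\<dots> \<le> 1 * (norm \<eta> * norm (y l))"
      using \<eta> by (intro mult_right_mono power_le_one) auto
    finally have "(norm (\<eta> ^ Suc l * y l))\<^sup>2 \<le> (norm \<eta> * norm (y l))\<^sup>2" by (intro power_mono) auto
    then show "(norm (\<eta> ^ Suc l * y l))\<^sup>2 \<le> (norm \<eta>)\<^sup>2 * (norm (y l))\<^sup>2" by (simp only: power_mult_distrib)
  qed
  also have "\<dots> = (norm \<eta> * l2 L y)\<^sup>2"
    by (simp add: power_mult_distrib l2_def L2_set_def sum_nonneg sum_distrib_left)
  finally show ?thesis by (subst l2_le_iff) auto
qed

lemma l2_chain:
  assumes V: "\<And>a. l2 M (u a) \<le> V"
  shows "l2 M (chain B M u m a) \<le> norm \<eta> ^ m * V"
proof (induction m arbitrary: a)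
  case 0
  have "chain B M u 0 a = u a" by (rule ext) simp
  then show ?case using V[of a] by simp
next
  case (Suc m)
  have "chain B M u (Suc m) a = (\<lambda>k. \<Sum>l<M. B a k l * chain B M u m (bar a) l)" by (rule ext) simp
  then have "l2 M (chain B M u (Suc m) a) \<le> norm \<eta> * l2 M (chain B M u m (bar a))"
    using l2_B[of M a "chain B M u m (bar a)" M] by simp
  also have "\<dots> \<le> norm \<eta> * (norm \<eta> ^ m * V)" by (intro mult_left_mono Suc) auto
  finally show ?case by (simp only: power_Suc mult.assoc)
qed

text \<open>The error after \<open>m\<close> steps satisfies a recursion with ratio
  \<open>norm \<eta>\<close> and with the truncation error of the equation as forcing term, so it is
  at most \<open>norm \<eta> ^ m * Y + t M / (1 - norm \<eta>)\<close>. Taking \<open>m = M\<close>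
  sends both terms to 0 together, \<open>t M\<close> being a tail of the square-summable
  solution.\<close>

lemma truncated_solution_tendsto:
  fixes y u :: "2 \<Rightarrow> nat \<Rightarrow> complex"
  assumes eq: "\<And>a k. (\<lambda>l. B a k l * y (bar a) l) sums (u a k - y a k)"
    and sm: "\<And>a. summable (\<lambda>l. (norm (y a l))\<^sup>2)"
  shows "(\<lambda>M. \<Sum>i<M. (- 1) ^ i * chain B M u i a 0) \<longlonglongrightarrow> y a 0"
proof -
  define Y where "Y = (\<Sum>a\<in>UNIV. sqrt (\<Sum>l. (norm (y a l))\<^sup>2))"
  \<comment> \<open>Adding the tails of both tori gives one bound for a recursion that alternates
    between them.\<close>
  define t where "t M = (\<Sum>a\<in>UNIV. sqrt (\<Sum>l. (norm (y a (l + M)))\<^sup>2))" for M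
  have sm': "summable (\<lambda>l. (norm (y a (l + M)))\<^sup>2)" for a M using sm by (rule summable_ignore_initial_segment)
  have Y: "l2 M (y a) \<le> Y" for M a
  proof -
    have "l2 M (y a) \<le> sqrt (\<Sum>l. (norm (y a l))\<^sup>2)"
      unfolding l2_def L2_set_def by (simp add: sum_le_suminf sm)
    also have "\<dots> \<le> Y" unfolding Y_def by (rule member_le_sum) (auto intro!: suminf_nonneg sm)
    finally show ?thesis .
  qed
  have tail: "l2 M (\<lambda>k. u a k - y a k - (\<Sum>l<M. B a k l * y (bar a) l)) \<le> t M" for a M
  proof -
    define z where "z l = (if l < M then 0 else y (bar a) l)" for l
    have "l2 M (\<lambda>k. \<Sum>l<L. B a k l * z l) \<le> sqrt (\<Sum>l. (norm (y (bar a) (l + M)))\<^sup>2)" for L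
    proof -
      have "l2 M (\<lambda>k. \<Sum>l<L. B a k l * z l) \<le> norm \<eta> * l2 L z" by (rule l2_B)
      also have "\<dots> \<le> 1 * l2 L z" using \<eta> by (intro mult_right_mono) auto
      also have "l2 L z \<le> sqrt (\<Sum>l. (norm (y (bar a) (l + M)))\<^sup>2)"
      proof -
        have "(\<Sum>l<L. (norm (z l))\<^sup>2) \<le> (\<Sum>l<L + M. (norm (z l))\<^sup>2)"
          by (rule sum_mono2) auto
        also have "\<dots> = (\<Sum>l<L. (norm (y (bar a) (l + M)))\<^sup>2)"
          by (induction L) (simp_all add: z_def)
        also have "\<dots> \<le> (\<Sum>l. (norm (y (bar a) (l + M)))\<^sup>2)" by (rule sum_le_suminf[OF sm']) auto
        finally show ?thesis unfolding l2_def L2_set_def by simp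
      qed
      finally show ?thesis by simp
    qed
    moreover have "(\<lambda>L. l2 M (\<lambda>k. \<Sum>l<L. B a k l * z l)) \<longlonglongrightarrow> l2 M (\<lambda>k. u a k - y a k - (\<Sum>l<M. B a k l * y (bar a) l))"
      unfolding l2_def L2_set_def
    proof (intro tendsto_intros)
      fix k
      have "(\<lambda>l. B a k l * y (bar a) l - (if l \<in> {..<M} then B a k l * y (bar a) l else 0)) sums
         (u a k - y a k - (\<Sum>l<M. B a k l * y (bar a) l))"
        by (intro sums_diff eq sums_If_finite_set) auto
      also have "(\<lambda>l. B a k l * y (bar a) l - (if l \<in> {..<M} then B a k l * y (bar a) l else 0)) = (\<lambda>l. B a k l * z l)"
        by (auto simp: z_def)
      finally show "(\<lambda>L. \<Sum>l<L. B a k l * z l) \<longlonglongrightarrow> u a k - y a k - (\<Sum>l<M. B a k l * y (bar a) l)"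
        by (simp add: sums_def)
    qed
    ultimately have "l2 M (\<lambda>k. u a k - y a k - (\<Sum>l<M. B a k l * y (bar a) l)) \<le> sqrt (\<Sum>l. (norm (y (bar a) (l + M)))\<^sup>2)"
      by (intro LIMSEQ_le_const2) auto
    also have "\<dots> \<le> t M" unfolding t_def by (rule member_le_sum) (auto intro!: suminf_nonneg sm')
    finally show ?thesis .
  qed
  define e where "e M m a k = y a k - (\<Sum>i<m. (- 1) ^ i * chain B M u i a k)" for M m a k
  have e_Suc: "e M (Suc m) a k = - (\<Sum>l<M. B a k l * e M m (bar a) l) + - (u a k - y a k - (\<Sum>l<M. B a k l * y (bar a) l))" for M m a k
  proof -
    have "(\<Sum>i<Suc m. (- 1) ^ i * chain B M u i a k) = u a k - (\<Sum>i<m. (- 1) ^ i * (\<Sum>l<M. B a k l * chain B M u i (bar a) l))"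
      unfolding sum.lessThan_Suc_shift by (simp add: sum_negf)
    also have "(\<Sum>i<m. (- 1) ^ i * (\<Sum>l<M. B a k l * chain B M u i (bar a) l)) =
       (\<Sum>l<M. B a k l * (\<Sum>i<m. (- 1) ^ i * chain B M u i (bar a) l))"
      unfolding sum_distrib_left by (subst sum.swap) (simp add: mult_ac)
    finally show ?thesis
      unfolding e_def by (simp add: right_diff_distrib sum_subtractf)
  qed
  have t0: "0 \<le> t M" for M unfolding t_def by (intro sum_nonneg real_sqrt_ge_zero suminf_nonneg sm') auto
  have e_bound: "l2 M (e M m a) \<le> norm \<eta> ^ m * Y + t M / (1 - norm \<eta>)" for M m a
  proof (induction m arbitrary: a)
    case 0
    have "e M 0 a = y a" by (rule ext) (simp add: e_def)
    moreover have "0 \<le> t M / (1 - norm \<eta>)" using t0 \<eta> by simp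
    ultimately show ?case using Y[of M a] by simp
  next
    case (Suc m)
    have "e M (Suc m) a = (\<lambda>k. - (\<Sum>l<M. B a k l * e M m (bar a) l) + - (u a k - y a k - (\<Sum>l<M. B a k l * y (bar a) l)))"
      by (rule ext) (rule e_Suc)
    then have e_eq: "e M (Suc m) a = (\<lambda>k. - (\<Sum>l<M. B a k l * e M m (bar a) l) + - (u a k - y a k - (\<Sum>l<M. B a k l * y (bar a) l)))" .
    have "l2 M (e M (Suc m) a) \<le> l2 M (\<lambda>k. - (\<Sum>l<M. B a k l * e M m (bar a) l)) + l2 M (\<lambda>k. - (u a k - y a k - (\<Sum>l<M. B a k l * y (bar a) l)))"
      unfolding e_eq by (rule l2_add)
    also have "\<dots> \<le> norm \<eta> * l2 M (e M m (bar a)) + t M"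
      unfolding l2_uminus using tail l2_B by (intro add_mono)
    also have "\<dots> \<le> norm \<eta> * (norm \<eta> ^ m * Y + t M / (1 - norm \<eta>)) + t M"
      by (intro add_right_mono mult_left_mono Suc) auto
    also have "\<dots> = norm \<eta> ^ Suc m * Y + t M / (1 - norm \<eta>)"
      using \<eta> by (simp add: field_simps)
    finally show ?case .
  qed
  have "(\<lambda>M. norm \<eta> ^ M * Y + t M / (1 - norm \<eta>)) \<longlonglongrightarrow> 0 * Y + (\<Sum>a\<in>(UNIV :: 2 set). sqrt 0) / (1 - norm \<eta>)"
    unfolding t_def using \<eta>
    by (intro tendsto_intros suminf_exist_split2 LIMSEQ_power_zero sm) auto
  then have lim0: "(\<lambda>M. norm \<eta> ^ M * Y + t M / (1 - norm \<eta>)) \<longlonglongrightarrow> 0" by simp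
  have "(\<lambda>M. e M M a 0) \<longlonglongrightarrow> 0"
  proof (rule Lim_null_comparison[OF _ lim0])
    show "\<forall>\<^sub>F M in sequentially. norm (e M M a 0) \<le> norm \<eta> ^ M * Y + t M / (1 - norm \<eta>)"
      using eventually_gt_at_top[of 0]
    proof eventually_elim
      case (elim M)
      show ?case using norm_le_l2[OF elim, of "e M M a"] e_bound[of M M a] by linarith
    qed
  qed
  from tendsto_diff[OF tendsto_const[of "y a 0"] this] show ?thesis by (simp add: e_def)
qed

end

section \<open>Finite sums over necklaces as truncated chains\<close>

definition edge_seq :: "nat \<Rightarrow> 2 \<Rightarrow> 2 list" where
  "edge_seq m a = map (\<lambda>i. (bar ^^ i) a) [0..<m]"

text \<open>The first label is exempt from the bound \<open>M\<close>, since only the summation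
  indices of \<open>chain\<close> are bounded. The last label is 1 because the starting vector is
  the first unit vector.\<close>

definition label_lists :: "nat \<Rightarrow> nat \<Rightarrow> nat \<Rightarrow> nat list set" where
  "label_lists M m k = {ks. length ks = Suc m \<and> hd ks = k \<and> last ks = 1 \<and> set (tl ks) \<subseteq> {1..M}}"

lemma finite_label_lists: "finite (label_lists M m k)"
proof (rule finite_subset)
  show "label_lists M m k \<subseteq> {ks. set ks \<subseteq> insert k {1..M} \<and> length ks = Suc m}"
  proof
    fix ks assume "ks \<in> label_lists M m k"
    then show "ks \<in> {ks. set ks \<subseteq> insert k {1..M} \<and> length ks = Suc m}"
      by (cases ks) (auto simp: label_lists_def)
  qed
qed (rule finite_lists_length_eq, simp)

lemma chain_moment_A:
  fixes \<tau> :: "2 \<Rightarrow> complex"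
  shows "chain (\<lambda>a k l. moment_A (Suc k) (Suc l) (\<tau> a) \<epsilon>) M (\<lambda>a k. if k = 0 then 1 else 0) m a k =
    (\<Sum>ks\<in>label_lists M m (Suc k). \<Prod>i<m. moment_A (ks ! i) (ks ! Suc i) (\<tau> ((bar ^^ i) a)) \<epsilon>)"
proof (induction m arbitrary: a k)
  case 0
  have "label_lists M 0 (Suc k) = (if k = 0 then {[1]} else {})"
    by (auto simp: label_lists_def length_Suc_conv)
  then show ?case by simp
next
  case (Suc m)
  let ?w = "\<lambda>m a ks. \<Prod>i<m. moment_A (ks ! i) (ks ! Suc i) (\<tau> ((bar ^^ i) a)) \<epsilon>"
  have split: "label_lists M (Suc m) (Suc k) = (\<lambda>(l, ks). Suc k # ks) ` (Sigma {..<M} (\<lambda>l. label_lists M m (Suc l)))"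
  proof (intro set_eqI iffI)
    fix ks assume ks: "ks \<in> label_lists M (Suc m) (Suc k)"
    then obtain x y zs where xyz: "ks = x # y # zs"
      by (auto simp: label_lists_def length_Suc_conv)
    then have "x = Suc k" "y \<in> {1..M}" using ks by (auto simp: label_lists_def)
    moreover have "y # zs \<in> label_lists M m (Suc (y - 1))" using ks xyz by (auto simp: label_lists_def)
    ultimately show "ks \<in> (\<lambda>(l, ks). Suc k # ks) ` (Sigma {..<M} (\<lambda>l. label_lists M m (Suc l)))"
      using xyz by (intro image_eqI[of _ _ "(y - 1, y # zs)"]) auto
  next
    fix ks assume "ks \<in> (\<lambda>(l, ks). Suc k # ks) ` (Sigma {..<M} (\<lambda>l. label_lists M m (Suc l)))"
    then obtain l ks' where l: "l < M" "ks' \<in> label_lists M m (Suc l)" "ks = Suc k # ks'" by auto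
    then show "ks \<in> label_lists M (Suc m) (Suc k)"
      by (cases ks') (auto simp: label_lists_def)
  qed
  have inj: "inj_on (\<lambda>(l, ks). Suc k # ks) (Sigma {..<M} (\<lambda>l. label_lists M m (Suc l)))"
    by (auto simp: inj_on_def label_lists_def)
  have "(\<Sum>ks\<in>label_lists M (Suc m) (Suc k). ?w (Suc m) a ks) =
      (\<Sum>(l, ks)\<in>Sigma {..<M} (\<lambda>l. label_lists M m (Suc l)). ?w (Suc m) a (Suc k # ks))"
    unfolding split by (subst sum.reindex[OF inj]) (simp add: o_def case_prod_unfold)
  also have "\<dots> = (\<Sum>l<M. \<Sum>ks\<in>label_lists M m (Suc l). ?w (Suc m) a (Suc k # ks))"
    by (subst sum.Sigma) (auto simp: finite_label_lists)
  also have "\<dots> = (\<Sum>l<M. \<Sum>ks\<in>label_lists M m (Suc l). moment_A (Suc k) (Suc l) (\<tau> a) \<epsilon> * ?w m (bar a) ks)"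
  proof (intro sum.cong refl)
    fix l ks assume "ks \<in> label_lists M m (Suc l)"
    then have "ks ! 0 = Suc l" by (cases ks) (auto simp: label_lists_def)
    then show "?w (Suc m) a (Suc k # ks) = moment_A (Suc k) (Suc l) (\<tau> a) \<epsilon> * ?w m (bar a) ks"
      unfolding prod.lessThan_Suc_shift by (simp add: funpow_Suc_right del: funpow.simps(2))
  qed
  finally show ?case by (simp add: Suc sum_distrib_left)
qed

text \<open>With first edge \<open>bar a\<close> fixed, the last of \<open>m\<close> edges is
  determined, and it is \<open>bar b\<close> exactly when the parity condition holds. For
  \<open>m = 0\<close> the same condition places the degenerate necklace in the types with distinct
  indices.\<close>

definition short_necklaces :: "nat \<Rightarrow> 2 \<Rightarrow> 2 \<Rightarrow> necklace set" where
  "short_necklaces M a b =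
     (\<lambda>(m, ks). Necklace ks (edge_seq m (bar a))) `
       (Sigma {m. m < M \<and> (even m \<longleftrightarrow> a \<noteq> b)} (\<lambda>m. label_lists M m 1))"

lemma finite_short_necklaces: "finite (short_necklaces M a b)"
  unfolding short_necklaces_def by (intro finite_imageI finite_SigmaI finite_label_lists) auto

lemma edge_seq_hd_last: "m > 0 \<Longrightarrow> hd (edge_seq m a) = a \<and> last (edge_seq m a) = (bar ^^ (m - 1)) a"
  by (simp add: edge_seq_def hd_map last_map)

lemma short_necklaces_subset: "short_necklaces M a b \<subseteq> necklaces a b"
proof
  fix N assume "N \<in> short_necklaces M a b"
  then obtain m ks where N: "N = Necklace ks (edge_seq m (bar a))" "even m \<longleftrightarrow> a \<noteq> b" "ks \<in> label_lists M m 1"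
    by (auto simp: short_necklaces_def)
  have "set ks \<subseteq> {1..}" using N(3) by (cases ks) (auto simp: label_lists_def)
  moreover have "last (edge_seq m (bar a)) = bar b" if "m > 0"
    using edge_seq_hd_last[OF that, of "bar a"] N(2) that neq_iff_bar[of a b]
    by (cases m) (auto simp: funpow_bar)
  ultimately show "N \<in> necklaces a b"
    using N edge_seq_hd_last[of m "bar a"]
    by (cases "m = 0") (auto simp: necklaces_def chequered_def label_lists_def edge_seq_def)
qed

text \<open>Interior labels are counted twice by the exponents of the edges and the two end labels 1
  once, so the degree plus one is the sum of all node labels. A degree below \<open>M\<close> thus
  bounds both the number of edges and every label.\<close>

lemma necklace_short:
  assumes N: "N \<in> necklaces a b" and deg: "degree_of N < M"
  shows "N \<in> short_necklaces M a b"
proof -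
  obtain ks es where Nk: "N = Necklace ks es" by (cases N)
  define m where "m = length es"
  have len: "length ks = Suc m" and pos: "\<And>k. k \<in> set ks \<Longrightarrow> 0 < k" and ends: "hd ks = 1" "last ks = 1"
    and alt: "\<And>i. Suc i < m \<Longrightarrow> es ! Suc i = bar (es ! i)"
    using N by (auto simp: necklaces_def chequered_def Nk m_def)
  have es_nth: "es ! i = (bar ^^ i) (bar a)" if "i < m" for i
    using that
  proof (induction i)
    case 0
    then have "es \<noteq> []" by (auto simp: m_def)
    then show ?case using N by (simp add: necklaces_def Nk hd_conv_nth)
  next
    case (Suc i)
    then show ?case using alt[of i] by simp
  qed
  then have es: "es = edge_seq m (bar a)"
    by (intro nth_equalityI) (auto simp: edge_seq_def m_def)
  have par: "even m \<longleftrightarrow> a \<noteq> b"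
  proof (cases "m = 0")
    case True
    then show ?thesis using N by (simp add: necklaces_def Nk m_def)
  next
    case False
    then have "last es = bar b" using N by (auto simp: necklaces_def Nk m_def)
    then have "(bar ^^ (m - 1)) (bar a) = bar b" using False edge_seq_hd_last[of m "bar a"] es by simp
    then show ?thesis using False neq_iff_bar[of a b] by (cases m) (auto simp: funpow_bar split: if_splits)
  qed
  have tel: "(\<Sum>i<j. ks ! i + ks ! Suc i) + ks ! 0 + ks ! j = 2 * (\<Sum>i\<le>j. ks ! i)" for j
    by (induction j) simp_all
  have "ks \<noteq> []" using len by auto
  then have "ks ! 0 = 1" "ks ! m = 1" using len ends by (simp_all add: hd_conv_nth last_conv_nth)
  then have "(\<Sum>i<m. ks ! i + ks ! Suc i) + 2 = 2 * (\<Sum>i\<le>m. ks ! i)" using tel[of m] by simp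
  then have deg_eq: "Suc (degree_of N) = (\<Sum>i\<le>m. ks ! i)"
    by (simp add: degree_of_def Nk m_def)
  have "(\<Sum>i\<le>m. 1) \<le> (\<Sum>i\<le>m. ks ! i)"
    using pos len by (intro sum_mono) (auto simp: Suc_le_eq)
  then have mM: "m < M" using deg_eq deg by simp
  have "ks ! i \<le> M" if "i \<le> m" for i
    using member_le_sum[of i "{..m}" "\<lambda>i. ks ! i"] that deg_eq deg by simp
  then have "set ks \<subseteq> {1..M}"
    using pos len by (force simp: in_set_conv_nth Suc_le_eq)
  then have "ks \<in> label_lists M m 1"
    using len ends by (cases ks) (auto simp: label_lists_def)
  then show ?thesis unfolding short_necklaces_def using Nk es par mM by auto
qed

lemma sum_short_necklaces:
  fixes \<tau> :: "2 \<Rightarrow> complex"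
  shows "(\<Sum>N\<in>short_necklaces M a b. weight \<tau> \<epsilon> N) =
    (\<Sum>m | m < M \<and> (even m \<longleftrightarrow> a \<noteq> b).
       chain (\<lambda>a k l. moment_A (Suc k) (Suc l) (\<tau> a) \<epsilon>) M (\<lambda>a k. if k = 0 then 1 else 0) m (bar a) 0)"
proof -
  let ?I = "{m. m < M \<and> (even m \<longleftrightarrow> a \<noteq> b)}"
  have inj: "inj_on (\<lambda>(m, ks). Necklace ks (edge_seq m (bar a))) (Sigma ?I (\<lambda>m. label_lists M m 1))"
    by (auto simp: inj_on_def label_lists_def)
  have "(\<Sum>N\<in>short_necklaces M a b. weight \<tau> \<epsilon> N) =
     (\<Sum>(m, ks)\<in>Sigma ?I (\<lambda>m. label_lists M m 1). weight \<tau> \<epsilon> (Necklace ks (edge_seq m (bar a))))"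
    unfolding short_necklaces_def by (subst sum.reindex[OF inj]) (simp add: o_def case_prod_unfold)
  also have "\<dots> = (\<Sum>m\<in>?I. \<Sum>ks\<in>label_lists M m 1. weight \<tau> \<epsilon> (Necklace ks (edge_seq m (bar a))))"
    by (subst sum.Sigma) (auto simp: finite_label_lists)
  finally show ?thesis
    by (simp add: chain_moment_A weight_def edge_seq_def)
qed

section \<open>Convergence of the necklace series in powers of the sewing parameter\<close>

lemma polynomial_coeff_bound:
  fixes c :: "nat \<Rightarrow> complex"
  assumes \<rho>: "\<rho> > 0" and K: "\<And>z. norm z = \<rho> \<Longrightarrow> norm (\<Sum>i<d. c i * z ^ i) \<le> K" and n: "n < d"
  shows "norm (c n) * \<rho> ^ n \<le> K"
proof -
  define p where "p z = (\<Sum>i<d. c i * z ^ i)" for z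
  have hol: "p holomorphic_on UNIV" unfolding p_def by (intro holomorphic_intros)
  have "p has_fps_expansion Abs_fps (\<lambda>i. if i \<in> {..<d} then c i else 0)"
  proof (rule has_fps_expansionI, rule always_eventually, rule allI)
    fix z
    have "(\<lambda>i. if i \<in> {..<d} then c i * z ^ i else 0) sums p z"
      unfolding p_def by (rule sums_If_finite_set) simp
    also have "(\<lambda>i. if i \<in> {..<d} then c i * z ^ i else 0) = (\<lambda>i. (if i \<in> {..<d} then c i else 0) * z ^ i)"
      by auto
    finally show "(\<lambda>i. fps_nth (Abs_fps (\<lambda>i. if i \<in> {..<d} then c i else 0)) i * z ^ i) sums p z" by simp
  qed
  from fps_nth_fps_expansion[OF this, of n] have "(deriv ^^ n) p 0 = fact n * c n" using n by simp
  moreover have "norm ((deriv ^^ n) p 0) \<le> fact n * K / \<rho> ^ n"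
  proof (rule Cauchy_inequality)
    show "p holomorphic_on ball 0 \<rho>" using hol by (rule holomorphic_on_subset) auto
    show "continuous_on (cball 0 \<rho>) p"
      by (rule continuous_on_subset[OF holomorphic_on_imp_continuous_on[OF hol]]) auto
    show "norm (p x) \<le> K" if "norm (0 - x) = \<rho>" for x using K that by (simp add: p_def)
  qed (rule \<rho>)
  ultimately have "fact n * norm (c n) \<le> fact n * (K / \<rho> ^ n)" by (simp add: norm_mult)
  then have "norm (c n) \<le> K / \<rho> ^ n" by (simp only: mult_le_cancel_left_pos[OF fact_gt_zero])
  then show ?thesis using \<rho> by (simp add: field_simps)
qed

text \<open>The bound \<open>K\<close> is uniform in \<open>M\<close>, so Cauchy's estimates bound
  the coefficient of degree \<open>n\<close> of every truncation by \<open>K / \<rho> ^ n\<close>.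
  Below degree \<open>M\<close> these coefficients are already those of the full series; truncated
  sum and partial sum therefore differ by at most a geometric tail.\<close>

lemma omega_tendsto:
  fixes \<tau> :: "2 \<Rightarrow> complex"
  assumes \<rho>: "norm \<epsilon> < \<rho>"
    and K: "\<And>M z. norm z = \<rho> \<Longrightarrow> norm (\<Sum>N\<in>short_necklaces M a b. weight \<tau> z N) \<le> K"
  shows "summable (omega_term \<tau> \<epsilon> a b)"
    and "(\<lambda>M. \<Sum>N\<in>short_necklaces M a b. weight \<tau> \<epsilon> N) \<longlonglongrightarrow> omega \<tau> \<epsilon> a b"
proof -
  have \<rho>0: "\<rho> > 0" using \<rho> by (rule le_less_trans[OF norm_ge_zero])
  let ?S = "\<lambda>M. short_necklaces M a b"
  define w where "w n = (\<Sum>N | N \<in> necklaces a b \<and> degree_of N = n. weight \<tau> 1 N)" for n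
  define c where "c M n = (\<Sum>N | N \<in> ?S M \<and> degree_of N = n. weight \<tau> 1 N)" for M n
  define d where "d M = Suc (Max (insert 0 (degree_of ` ?S M)))" for M
  have dN: "degree_of N < d M" if "N \<in> ?S M" for N M
    using Max_ge[of "insert 0 (degree_of ` ?S M)" "degree_of N"] that finite_short_necklaces[of M a b]
    by (simp add: d_def less_Suc_eq_le)
  have poly: "(\<Sum>N\<in>?S M. weight \<tau> z N) = (\<Sum>n<d M. c M n * z ^ n)" for M z
  proof -
    have "(\<Sum>N\<in>?S M. weight \<tau> z N) = (\<Sum>N\<in>?S M. weight \<tau> 1 N * z ^ degree_of N)"
      by (intro sum.cong refl weight_eq_power[of _ a b]) (use short_necklaces_subset in blast)
    also have "\<dots> = (\<Sum>n<d M. \<Sum>N | N \<in> ?S M \<and> degree_of N = n. weight \<tau> 1 N * z ^ degree_of N)"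
      by (rule sum.group[symmetric]) (use dN finite_short_necklaces in auto)
    also have "\<dots> = (\<Sum>n<d M. c M n * z ^ n)"
      unfolding c_def sum_distrib_right by (intro sum.cong refl) auto
    finally show ?thesis .
  qed
  have cw: "c M n = w n" if "n < M" for M n
    unfolding c_def w_def
    by (rule sum.cong) (use that necklace_short short_necklaces_subset in blast)+
  have "norm (\<Sum>N\<in>?S 0. weight \<tau> (of_real \<rho>) N) \<le> K" by (rule K) (use \<rho>0 in simp)
  then have K0: "K \<ge> 0" by (rule order_trans[OF norm_ge_zero])
  have cb: "norm (c M n) \<le> K / \<rho> ^ n" for M n
  proof (cases "n < d M")
    case True
    have "norm (c M n) * \<rho> ^ n \<le> K"
    proof (rule polynomial_coeff_bound[OF \<rho>0 _ True])
      show "norm (\<Sum>n<d M. c M n * z ^ n) \<le> K" if "norm z = \<rho>" for z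
        using K[OF that, of M] unfolding poly .
    qed
    then show ?thesis using \<rho>0 by (simp add: field_simps)
  next
    case False
    then have "{N. N \<in> ?S M \<and> degree_of N = n} = {}" using dN by fastforce
    then have "c M n = 0" unfolding c_def by (metis sum.empty)
    then show ?thesis using K0 \<rho>0 by simp
  qed
  have wb: "norm (w n) \<le> K / \<rho> ^ n" for n using cb[of "Suc n" n] cw[of n "Suc n"] by simp
  have term_eq: "omega_term \<tau> \<epsilon> a b n = w n * \<epsilon> ^ n" for n
    unfolding omega_term_def w_def sum_distrib_right
    by (intro sum.cong refl) (auto simp: weight_eq_power[of _ a b \<tau> \<epsilon>])
  define x where "x = norm \<epsilon> / \<rho>"
  have x: "0 \<le> x" "x < 1" using \<rho> \<rho>0 by (auto simp: x_def)
  have b: "norm (v * \<epsilon> ^ n) \<le> K * x ^ n" if "norm v \<le> K / \<rho> ^ n" for v n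
  proof -
    have "norm (v * \<epsilon> ^ n) \<le> K / \<rho> ^ n * norm \<epsilon> ^ n"
      unfolding norm_mult norm_power using that by (intro mult_right_mono) auto
    then show ?thesis by (simp add: x_def power_divide)
  qed
  have gs: "summable (\<lambda>n. K * x ^ n)" using x by (intro summable_mult summable_geometric) auto
  show sm: "summable (omega_term \<tau> \<epsilon> a b)"
    by (rule summable_comparison_test[OF _ gs]) (use b[OF wb] term_eq in auto)
  have lim: "(\<lambda>M. \<Sum>n<M. omega_term \<tau> \<epsilon> a b n) \<longlonglongrightarrow> omega \<tau> \<epsilon> a b"
    unfolding omega_def using sm by (rule summable_LIMSEQ)
  have "(\<lambda>M. (\<Sum>N\<in>?S M. weight \<tau> \<epsilon> N) - (\<Sum>n<M. omega_term \<tau> \<epsilon> a b n)) \<longlonglongrightarrow> 0"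
  proof (rule Lim_null_comparison[OF always_eventually suminf_exist_split2[OF gs]], rule allI)
    fix M
    define e where "e = max M (d M)"
    have "(\<Sum>N\<in>?S M. weight \<tau> \<epsilon> N) = (\<Sum>n<e. c M n * \<epsilon> ^ n)"
    proof -
      have "c M n = 0" if "n \<ge> d M" for n
      proof -
        have "{N. N \<in> ?S M \<and> degree_of N = n} = {}" using dN that by fastforce
        then show ?thesis unfolding c_def by (metis sum.empty)
      qed
      then show ?thesis unfolding poly by (intro sum.mono_neutral_left) (auto simp: e_def)
    qed
    also have "\<dots> = (\<Sum>n<M. c M n * \<epsilon> ^ n) + (\<Sum>n=M..<e. c M n * \<epsilon> ^ n)"
      using sum.atLeastLessThan_concat[of 0 M e "\<lambda>n. c M n * \<epsilon> ^ n"] by (simp add: e_def lessThan_atLeast0)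
    also have "(\<Sum>n<M. c M n * \<epsilon> ^ n) = (\<Sum>n<M. omega_term \<tau> \<epsilon> a b n)"
      by (intro sum.cong refl) (simp add: term_eq cw)
    finally have "norm ((\<Sum>N\<in>?S M. weight \<tau> \<epsilon> N) - (\<Sum>n<M. omega_term \<tau> \<epsilon> a b n)) \<le> (\<Sum>n=M..<e. K * x ^ n)"
      by (simp add: sum_norm_le b[OF cb])
    also have "\<dots> = (\<Sum>i<e - M. K * x ^ (i + M))"
      by (rule sum.reindex_bij_witness[where i = "\<lambda>i. i + M" and j = "\<lambda>n. n - M"]) auto
    also have "\<dots> \<le> (\<Sum>i. K * x ^ (i + M))"
      by (rule sum_le_suminf[OF summable_ignore_initial_segment[OF gs]]) (use x K0 in auto)
    finally show "norm ((\<Sum>N\<in>?S M. weight \<tau> \<epsilon> N) - (\<Sum>n<M. omega_term \<tau> \<epsilon> a b n)) \<le> (\<Sum>i. K * x ^ (i + M))" .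
  qed
  from tendsto_add[OF this lim] show "(\<lambda>M. \<Sum>N\<in>?S M. weight \<tau> \<epsilon> N) \<longlonglongrightarrow> omega \<tau> \<epsilon> a b" by simp
qed

section \<open>Inversion of circles and the constant forms\<close>

lemma integral_unit_period_reflect:
  fixes F :: "real \<Rightarrow> complex"
  assumes F: "continuous_on UNIV F" and per: "\<And>x. F (x + 1) = F x" and \<phi>: "0 \<le> \<phi>" "\<phi> \<le> 1"
  shows "integral {0..1} (\<lambda>t. F (\<phi> - t)) = integral {0..1} F"
proof -
  have int: "F integrable_on {x..y}" for x y
    by (intro integrable_continuous_real continuous_on_subset[OF F]) auto
  have "(F has_integral integral {\<phi> - 1..\<phi>} F) (cbox (\<phi> - 1) \<phi>)"
    using int by (simp add: integrable_integral)
  from has_integral_affinity[OF this, of "-1" \<phi>]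
  have "((\<lambda>t. F (\<phi> - t)) has_integral integral {\<phi> - 1..\<phi>} F) ((\<lambda>x. - x + \<phi>) ` {\<phi> - 1..\<phi>})" by simp
  moreover have "(\<lambda>x. - x + \<phi>) ` {\<phi> - 1..\<phi>} = {0..1}"
    using image_affinity_atLeastAtMost[of "-1" \<phi> "\<phi> - 1" \<phi>] by simp
  ultimately have "integral {0..1} (\<lambda>t. F (\<phi> - t)) = integral {\<phi> - 1..\<phi>} F"
    by (simp add: integral_unique)
  also have "\<dots> = integral {\<phi> - 1..0} F + integral {0..\<phi>} F"
    using \<phi> int by (subst Henstock_Kurzweil_Integration.integral_combine) auto
  also have "integral {\<phi> - 1..0} F = integral {\<phi>..1} F"
  proof -
    have "(F has_integral integral {\<phi> - 1..0} F) (cbox (\<phi> - 1) 0)"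
      using int by (simp add: integrable_integral)
    from has_integral_affinity[OF this, of 1 "-1"]
    have "((\<lambda>x. F (x - 1)) has_integral integral {\<phi> - 1..0} F) ((\<lambda>x. x + 1) ` {\<phi> - 1..0})" by simp
    moreover have "(\<lambda>x. F (x - 1)) = F" using per[of "_ - 1"] by (simp add: fun_eq_iff)
    moreover have "(\<lambda>x. x + 1) ` {\<phi> - 1..0} = {\<phi>..1}"
      using image_affinity_atLeastAtMost[of 1 1 "\<phi> - 1" 0] \<phi> by simp
    ultimately show ?thesis by (simp add: integral_unique)
  qed
  also have "integral {\<phi>..1} F + integral {0..\<phi>} F = integral {0..1} F"
    using \<phi> int by (subst add.commute, subst Henstock_Kurzweil_Integration.integral_combine) auto
  finally show ?thesis .
qed

text \<open>In the parameter \<open>t\<close> the map \<open>w -> \<mu> / w\<close> between the two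
  circles is a reflection followed by a shift by the argument of \<mu>. Neither changes the integral
  of a function of period 1 over a period.\<close>

lemma integral_circlepath_inversion:
  fixes h :: "complex \<Rightarrow> complex"
  assumes \<mu>: "\<mu> \<noteq> 0" and s: "s > 0" and h: "continuous_on (sphere 0 (norm \<mu> / s)) h"
  shows "integral {0..1} (\<lambda>t. h (\<mu> / circlepath 0 s t)) = integral {0..1} (\<lambda>t. h (circlepath 0 (norm \<mu> / s) t))"
proof -
  define \<phi> where "\<phi> = Arg2pi \<mu> / (2 * pi)"
  define F where "F t = h (circlepath 0 (norm \<mu> / s) t)" for t
  have \<phi>: "0 \<le> \<phi>" "\<phi> \<le> 1" using Arg2pi[of \<mu>] by (auto simp: \<phi>_def)
  have cont: "continuous_on UNIV F"
    unfolding F_def by (rule continuous_on_compose2[OF h])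
      (use s in \<open>auto intro!: continuous_intros simp: norm_circlepath_0\<close>)
  have per: "F (t + 1) = F t" for t
  proof -
    have "exp (2 * of_real pi * \<i> * of_real (t + 1)) = exp (2 * of_real pi * \<i> * of_real t)"
      using exp_plus_2pin[of "2 * of_real pi * \<i> * of_real t" 1] by (simp add: algebra_simps)
    then show ?thesis by (simp only: F_def circlepath)
  qed
  have "h (\<mu> / circlepath 0 s t) = F (\<phi> - t)" for t
  proof -
    have "\<mu> = of_real (norm \<mu>) * exp (\<i> * of_real (Arg2pi \<mu>))" by (rule Arg2pi_eq)
    also have "\<i> * of_real (Arg2pi \<mu>) = 2 * of_real pi * \<i> * of_real \<phi>" by (simp add: \<phi>_def)
    finally have m: "\<mu> = of_real (norm \<mu>) * exp (2 * of_real pi * \<i> * of_real \<phi>)" .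
    have "circlepath 0 (norm \<mu> / s) (\<phi> - t) = of_real (norm \<mu>) * exp (2 * of_real pi * \<i> * of_real \<phi>) / (of_real s * exp (2 * of_real pi * \<i> * of_real t))"
      by (simp add: circlepath right_diff_distrib exp_diff)
    also have "\<dots> = \<mu> / circlepath 0 s t" using m by (simp add: circlepath)
    finally show ?thesis by (simp add: F_def)
  qed
  then have "integral {0..1} (\<lambda>t. h (\<mu> / circlepath 0 s t)) = integral {0..1} (\<lambda>t. F (\<phi> - t))" by simp
  also have "\<dots> = integral {0..1} F" by (rule integral_unit_period_reflect[OF cont per \<phi>])
  finally show ?thesis by (simp add: F_def[abs_def])
qed

lemma constant_contour_integral:
  assumes "valid_path p" shows "contour_integral p (\<lambda>_. k) = k * (pathfinish p - pathstart p)"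
proof -
  have "((\<lambda>_. k) has_contour_integral (k * pathfinish p - k * pathstart p)) p"
    by (rule contour_integral_primitive[of UNIV "\<lambda>z. k * z"]) (use assms in \<open>auto intro!: derivative_eq_intros\<close>)
  then show ?thesis by (simp add: contour_integral_unique right_diff_distrib)
qed

lemma (in torus) entire_elliptic_constant:
  assumes f: "f holomorphic_on UNIV" and per: "\<And>z w. w \<in> \<Lambda> \<Longrightarrow> f (z + w) = f z"
  obtains k where "f = (\<lambda>_. k)"
proof -
  obtain M where "\<And>z. norm (f z) \<le> M"
    using periodic_bounded[OF holomorphic_on_imp_continuous_on[OF f] per] by blast
  then have "bounded (range f)" by (auto simp: bounded_iff)
  then have "f constant_on UNIV" by (rule Liouville_theorem[OF f])
  then show ?thesis using that by (auto simp: constant_on_def fun_eq_iff)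
qed

section \<open>Forms on the sewn surface and their periods\<close>

locale sewn_tori =
  fixes \<tau> :: "2 \<Rightarrow> complex" and \<epsilon> :: complex and r :: "2 \<Rightarrow> real"
  assumes domain: "(\<tau> 1, \<tau> 2, \<epsilon>) \<in> sewing_domain" and radii: "sewing_radii \<tau> \<epsilon> r"
begin

lemma r_pos: "0 < r a" and r_less: "2 * r a < min_length (\<tau> a)"
  using spec[OF conjunct1[OF radii[unfolded sewing_radii_def]], of a] by simp_all

sublocale torus "\<tau> a" for a
proof
  show "0 < Im (\<tau> a)"
    using domain exhaust_2[of a] by (auto simp: sewing_domain_def upper_half_plane_def)
  show "0 < min_length (\<tau> a)" using r_pos[of a] r_less[of a] by simp
qed

definition "\<rho> a = norm \<epsilon> / r (bar a)"
text \<open>Midway between \<open>r a\<close> and half the minimal length: above \<open>r a\<close>,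
  so that \<epsilon> is strictly smaller than the product of the two radii, and below the half
  length, so that the Grunsky inequality applies.\<close>

definition "R a = (r a + min_length (\<tau> a) / 2) / 2"
definition "RR = R 1 * R 2"

lemma two_prod: "g a * g (bar a) = g 1 * g 2" for g :: "2 \<Rightarrow> real"
  using exhaust_2[of a] by (auto simp: bar_def mult.commute)

lemma rho_le: "\<rho> a \<le> r a"
  using radii two_prod[of r a] r_pos[of "bar a"] by (simp add: \<rho>_def sewing_radii_def field_simps)

lemma R: "0 < R a" "r a < R a" "2 * R a < min_length (\<tau> a)"
  using r_pos[of a] r_less[of a] by (auto simp: R_def)

lemma R_prod: "R a * R (bar a) = RR" unfolding RR_def by (rule two_prod)

lemma RR: "0 < RR" "norm \<epsilon> < RR"
proof -
  show "0 < RR" unfolding RR_def using R(1) by simp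
  have "norm \<epsilon> \<le> r 1 * r 2" using radii by (simp add: sewing_radii_def)
  also have "\<dots> < R 1 * R 2" using R(2) r_pos by (intro mult_strict_mono') (auto intro: less_imp_le)
  finally show "norm \<epsilon> < RR" by (simp add: RR_def)
qed

definition "G a k l = of_real (R a ^ (k + l + 2) / sqrt (real (Suc k * Suc l))) * moment_C (Suc k) (Suc l) (\<tau> a)"

lemma contraction: "norm \<eta> < 1 \<Longrightarrow> contraction G \<eta>"
proof
  show "(\<Sum>k<N. (norm (\<Sum>l<L. G a k l * y l))\<^sup>2) \<le> (\<Sum>l<L. (norm (y l))\<^sup>2)" for a N L y
    unfolding G_def by (rule grunsky[OF R(1,3)])
qed

abbreviation "MA z \<equiv> \<lambda>a k l. moment_A (Suc k) (Suc l) (\<tau> a) z"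
abbreviation "unit_vec \<equiv> \<lambda>(a::2) k::nat. if k = 0 then 1 else 0 :: complex"

text \<open>A conjugation by the diagonal matrices with entries
  \<open>(R a / csqrt z) ^ Suc k\<close>. As the two ends of an edge carry the factors of different
  tori and \<open>R a * R (bar a)\<close> is \<open>RR\<close>, the half-integral powers combine to
  \<open>(z / RR) ^ Suc l\<close> on each edge. At index 0 the square root cancels
  altogether.\<close>

lemma scaled_chain:
  assumes z: "z \<noteq> 0"
  shows "csqrt z * (of_real (R a) / csqrt z) ^ Suc k * chain (MA z) M unit_vec m a k =
    chain (\<lambda>a k l. G a k l * (z / of_real RR) ^ Suc l) M (\<lambda>a k. of_real (R a) * unit_vec a k) m a k"
proof (induction m arbitrary: a k)
  case 0
  then show ?case using z by simp
next
  case (Suc m)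
  let ?s = "csqrt z"
  have s: "?s \<noteq> 0" "?s * ?s = z" using z power2_csqrt[of z] by (auto simp: power2_eq_square)
  have swap: "?s * (of_real (R a) / ?s) ^ Suc k * MA z a k l = G a k l * (z / of_real RR) ^ Suc l * (?s * (of_real (R (bar a)) / ?s) ^ Suc l)" for l
  proof -
    have "of_real (R a) * (z / of_real RR) * (of_real (R (bar a)) / ?s) = ?s"
    proof -
      have "of_real (R a) * (z / of_real RR) * (of_real (R (bar a)) / ?s) = of_real (R a * R (bar a)) * z / (of_real RR * ?s)"
        by simp
      also have "\<dots> = z / ?s" unfolding R_prod using RR(1) by simp
      also have "\<dots> = ?s" using s by (simp add: field_simps)
      finally show ?thesis .
    qed
    then have p: "of_real (R a) ^ Suc l * (z / of_real RR) ^ Suc l * (of_real (R (bar a)) / ?s) ^ Suc l = ?s ^ Suc l"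
      by (simp only: power_mult_distrib[symmetric])
    have "G a k l * (z / of_real RR) ^ Suc l * (?s * (of_real (R (bar a)) / ?s) ^ Suc l) =
      of_real (R a) ^ Suc k * (of_real (R a) ^ Suc l * (z / of_real RR) ^ Suc l * (of_real (R (bar a)) / ?s) ^ Suc l) * ?s
        * (moment_C (Suc k) (Suc l) (\<tau> a) / of_real (sqrt (real (Suc k * Suc l))))"
    proof -
      have gen: "of_real (A * A' / Q) * C * H * (s * J) = of_real A * (of_real A' * H * J) * s * (C / of_real Q)"
        for A A' Q :: real and C H J s :: complex
        by (simp add: divide_inverse mult_ac)
      have "R a ^ (k + l + 2) = R a ^ Suc k * R a ^ Suc l" by (simp add: power_add)
      then show ?thesis unfolding G_def by (simp only: gen of_real_power)
    qed
    also have "\<dots> = ?s * (of_real (R a) / ?s) ^ Suc k * MA z a k l"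
      unfolding p unfolding moment_A_def power_divide power_add using s(1)
      by (simp add: field_simps del: of_nat_Suc mult_Suc mult_Suc_right of_nat_mult)
    finally show ?thesis ..
  qed
  show ?case
    unfolding chain.simps sum_distrib_left mult.assoc[symmetric] swap
    by (simp only: mult.assoc[of "G a k _ * _"] Suc)
qed

lemma scaled_chain_0:
  assumes z: "z \<noteq> 0"
  shows "of_real (R a) * chain (MA z) M unit_vec m a 0 =
    chain (\<lambda>a k l. G a k l * (z / of_real RR) ^ Suc l) M (\<lambda>a k. of_real (R a) * unit_vec a k) m a 0"
  using scaled_chain[OF z, of a 0 M m] z by simp

text \<open>Each further edge costs a factor \<open>s / RR\<close> by the contraction property, so
  the number of edges is summed as a geometric series. The bound is the same for every
  \<open>M\<close>, as the coefficient estimates require.\<close>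

lemma sum_short_bound:
  assumes z: "norm z = s" "0 < s" "s < RR"
  shows "norm (\<Sum>N\<in>short_necklaces M a b. weight \<tau> z N) \<le> (R 1 + R 2) / R (bar a) / (1 - s / RR)"
proof -
  let ?\<eta> = "z / of_real RR"
  have z0: "z \<noteq> 0" using z by auto
  have n\<eta>: "norm ?\<eta> = s / RR" using z RR by (simp add: norm_divide)
  then interpret c: contraction G ?\<eta> using z RR by (intro contraction) simp
  let ?v = "\<lambda>a k. of_real (R a) * unit_vec a k"
  have V: "l2 M (?v a) \<le> R 1 + R 2" for a
  proof -
    have "(\<Sum>k<M. (norm (?v a k))\<^sup>2) \<le> (R a)\<^sup>2"
    proof -
      have "(\<Sum>k<M. (norm (?v a k))\<^sup>2) = (\<Sum>k<M. if k = 0 then (R a)\<^sup>2 else 0)"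
        by (intro sum.cong refl) auto
      also have "\<dots> \<le> (R a)\<^sup>2" by (subst sum.delta) auto
      finally show ?thesis .
    qed
    then have "l2 M (?v a) \<le> R a" using R(1)[of a] by (subst l2_le_iff) auto
    then show ?thesis using R(1)[of 1] R(1)[of 2] exhaust_2[of a] by auto
  qed
  have one: "norm (chain (MA z) M unit_vec m (bar a) 0) \<le> (R 1 + R 2) / R (bar a) * (s / RR) ^ m" if "m < M" for m
  proof -
    have "R (bar a) * norm (chain (MA z) M unit_vec m (bar a) 0) = norm (chain c.B M ?v m (bar a) 0)"
      using arg_cong[OF scaled_chain_0[OF z0, of "bar a" M m], of norm] R(1)[of "bar a"]
      by (simp add: norm_mult c.B_def[abs_def])
    also have "\<dots> \<le> l2 M (chain c.B M ?v m (bar a))" using that by (intro norm_le_l2) simp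
    also have "\<dots> \<le> (s / RR) ^ m * (R 1 + R 2)" using c.l2_chain[where m = m and a = "bar a", OF V] n\<eta> by simp
    finally have "norm (chain (MA z) M unit_vec m (bar a) 0) * R (bar a) \<le> (s / RR) ^ m * (R 1 + R 2)"
      by (simp only: mult.commute)
    then have "norm (chain (MA z) M unit_vec m (bar a) 0) \<le> (s / RR) ^ m * (R 1 + R 2) / R (bar a)"
      by (simp only: pos_le_divide_eq[OF R(1)])
    then show ?thesis by (simp only: times_divide_eq_right mult.commute[of "(R 1 + R 2) / R (bar a)"])
  qed
  have x: "0 \<le> s / RR" "s / RR < 1" using z RR by simp_all
  have "0 \<le> (R 1 + R 2) / R (bar a)" using R(1)[of 1] R(1)[of 2] R(1)[of "bar a"] by simp
  then have nonneg: "0 \<le> (R 1 + R 2) / R (bar a) * (s / RR) ^ m" for m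
    using x(1) by (intro mult_nonneg_nonneg zero_le_power)
  let ?I = "{m. m < M \<and> (even m \<longleftrightarrow> a \<noteq> b)}"
  have "norm (\<Sum>N\<in>short_necklaces M a b. weight \<tau> z N) \<le> (\<Sum>m\<in>?I. (R 1 + R 2) / R (bar a) * (s / RR) ^ m)"
    unfolding sum_short_necklaces by (rule sum_norm_le) (use one in auto)
  also have "\<dots> \<le> (\<Sum>m<M. (R 1 + R 2) / R (bar a) * (s / RR) ^ m)"
    by (rule sum_mono2) (use nonneg in auto)
  also have "\<dots> \<le> (\<Sum>m. (R 1 + R 2) / R (bar a) * (s / RR) ^ m)"
    by (rule sum_le_suminf[OF summable_mult[OF summable_geometric]]) (use x nonneg in auto)
  also have "\<dots> = (R 1 + R 2) / R (bar a) * (\<Sum>m. (s / RR) ^ m)"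
    by (rule suminf_mult[OF summable_geometric]) (use x in auto)
  also have "(\<Sum>m. (s / RR) ^ m) = 1 / (1 - s / RR)"
    by (rule suminf_geometric) (use x in auto)
  finally show ?thesis by simp
qed

lemma
  shows summable_omega: "summable (omega_term \<tau> \<epsilon> a b)"
    and omega_limit: "(\<lambda>M. \<Sum>N\<in>short_necklaces M a b. weight \<tau> \<epsilon> N) \<longlonglongrightarrow> omega \<tau> \<epsilon> a b"
proof -
  define s where "s = (norm \<epsilon> + RR) / 2"
  have s: "norm \<epsilon> < s" "s < RR" "0 < s"
    using RR by (auto simp: s_def intro: add_nonneg_pos)
  show "summable (omega_term \<tau> \<epsilon> a b)"
    by (rule omega_tendsto(1)[OF s(1) sum_short_bound[OF _ s(3,2)]])
  show "(\<lambda>M. \<Sum>N\<in>short_necklaces M a b. weight \<tau> \<epsilon> N) \<longlonglongrightarrow> omega \<tau> \<epsilon> a b"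
    by (rule omega_tendsto(2)[OF s(1) sum_short_bound[OF _ s(3,2)]])
qed

text \<open>\<open>sewn_one_form\<close> states the matching only from torus 1 to torus 2. The
  relation is an involution, so it may be used from either side; the inner circle of one torus is
  matched with the circle of radius \<open>r\<close> on the other.\<close>

lemma glue:
  assumes f: "sewn_one_form \<tau> \<epsilon> r f" and \<epsilon>: "\<epsilon> \<noteq> 0" and z: "norm z = \<rho> a"
  shows "f a z = f (bar a) (\<epsilon> / z) * (- \<epsilon> / z\<^sup>2)"
proof -
  have \<rho>0: "0 < \<rho> b" for b using \<epsilon> r_pos[of "bar b"] by (simp add: \<rho>_def)
  have z0: "z \<noteq> 0" using z \<rho>0[of a] by auto
  have nz: "norm (\<epsilon> / z) = r (bar a)"
    using z \<epsilon> r_pos[of "bar a"] by (simp add: norm_divide \<rho>_def)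
  have za: "z \<in> sewing_annulus \<epsilon> r a"
    using z rho_le[of a] by (simp add: sewing_annulus_def \<rho>_def)
  have zb: "\<epsilon> / z \<in> sewing_annulus \<epsilon> r (bar a)"
    using rho_le[of "bar a"] unfolding sewing_annulus_def mem_Collect_eq nz \<rho>_def by simp
  have match: "f 1 z\<^sub>1 = f 2 z\<^sub>2 * (- \<epsilon> / z\<^sub>1\<^sup>2)"
    if "z\<^sub>1 \<in> sewing_annulus \<epsilon> r 1" "z\<^sub>2 \<in> sewing_annulus \<epsilon> r 2" "z\<^sub>1 * z\<^sub>2 = \<epsilon>" for z\<^sub>1 z\<^sub>2
    using f \<epsilon> that by (auto simp: sewn_one_form_def)
  show ?thesis
  proof (cases "a = 1")
    case True
    then show ?thesis using match[of z "\<epsilon> / z"] za zb z0 by (simp add: bar_def)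
  next
    case False
    then have a: "a = 2" "bar a = 1" using exhaust_2[of a] by (auto simp: bar_def)
    have "f 1 (\<epsilon> / z) = f 2 z * (- \<epsilon> / (\<epsilon> / z)\<^sup>2)"
      using match[of "\<epsilon> / z" z] za zb z0 a by simp
    moreover have "bar 2 = 1" by (simp add: bar_def)
    ultimately show ?thesis unfolding a(1) using z0 \<epsilon> by (simp add: field_simps power2_eq_square)
  qed
qed

text \<open>The normalization of the \<alpha>-periods fixes the constant \<gamma> as the Kronecker
  delta of \<open>a\<close> and \<open>j\<close>. The \<beta>-period is then
  \<open>2 * pi * \<i> * \<tau> a * \<gamma> a\<close> plus \<open>b a 1\<close>, and gluing turns
  \<open>b a 1\<close> into \<open>- \<epsilon>\<close> times the constant coefficient on the other
  torus, which is the first entry of the Neumann solution.\<close>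

lemma sewn_form_periods:
  assumes \<epsilon>: "\<epsilon> \<noteq> 0" and f: "sewn_one_form \<tau> \<epsilon> r f"
    and \<alpha>: "\<And>a. a_cycle \<tau> \<epsilon> r a (\<alpha> a)" "\<And>a. contour_integral (\<alpha> a) (f a) = (if a = j then 2 * of_real pi * \<i> else 0)"
    and \<beta>: "\<And>a. b_cycle \<tau> \<epsilon> r a (\<beta> a)"
  shows "contour_integral (\<beta> a) (f a) = (if a = j then 2 * of_real pi * \<i> * \<tau> a else 0)
    - \<epsilon> * ((if a = j then - 1 else 1) * omega \<tau> \<epsilon> a j)"
proof -
  have \<rho>0: "0 < \<rho> a" for a using \<epsilon> r_pos[of "bar a"] by (simp add: \<rho>_def)
  have \<rho>D: "2 * \<rho> a < min_length (\<tau> a)" for a using rho_le[of a] r_less[of a] by simp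
  have E: "excised_torus \<tau> \<epsilon> r a = {z. \<forall>w\<in>period_lattice (\<tau> a). \<rho> a \<le> norm (z - w)}" for a
    by (simp add: excised_torus_def \<rho>_def)
  have fan: "f a analytic_on {z. \<forall>w\<in>period_lattice (\<tau> a). \<rho> a \<le> norm (z - w)}" for a
    using f unfolding sewn_one_form_def E by blast
  have fper: "f a (z + w) = f a z" if "z \<in> {z. \<forall>w\<in>period_lattice (\<tau> a). \<rho> a \<le> norm (z - w)}" "w \<in> period_lattice (\<tau> a)" for a z w
    using f that unfolding sewn_one_form_def E by blast
  define c where "c a k = cint (\<rho> a) (\<lambda>w. f a w / w ^ Suc k)" for a k
  define b where "b a l = cint (\<rho> a) (\<lambda>w. f a w * w ^ l)" for a l
  \<comment> \<open>Both conclusions of \<open>elliptic_expansion\<close> are packed into one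
    predicate of the constant, so that one function \<open>\<gamma>\<close> can be chosen for both
    tori and satisfy them simultaneously.\<close>
  define Q where "Q a g \<longleftrightarrow> (\<forall>k. (\<lambda>l. moment_C (Suc k) (Suc l) (\<tau> a) / of_nat (Suc l) * b a (Suc l)) sums (c a k - (if k = 0 then g else 0))) \<and>
      (\<forall>p w. valid_path p \<longrightarrow> path_image p \<subseteq> excised_torus \<tau> \<epsilon> r a \<longrightarrow> w \<in> period_lattice (\<tau> a) \<longrightarrow>
         pathfinish p = pathstart p + w \<longrightarrow> contour_integral p (f a) = w * g + of_real (t_coord a w) * b a 1)" for a g
  have "\<exists>g. Q a g" for a
  proof -
    obtain g where 1: "\<And>k. (\<lambda>l. moment_C (Suc k) (Suc l) (\<tau> a) / of_nat (Suc l) * b a (Suc l)) sums (c a k - (if k = 0 then g else 0))"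
      and 2: "\<And>p w. valid_path p \<Longrightarrow> path_image p \<subseteq> excised_torus \<tau> \<epsilon> r a \<Longrightarrow> w \<in> period_lattice (\<tau> a) \<Longrightarrow>
         pathfinish p = pathstart p + w \<Longrightarrow> contour_integral p (f a) = w * g + of_real (t_coord a w) * b a 1"
      unfolding E c_def b_def
    proof (rule elliptic_expansion[where a = a and f = "f a" and \<rho> = "\<rho> a", OF \<rho>0 \<rho>D fan fper])
      fix g
      assume "\<And>k. (\<lambda>l. moment_C (Suc k) (Suc l) (\<tau> a) / of_nat (Suc l) * cint (\<rho> a) (\<lambda>w. f a w * w ^ Suc l)) sums
          (cint (\<rho> a) (\<lambda>w. f a w / w ^ Suc k) - (if k = 0 then g else 0))"
        and "\<And>p w. valid_path p \<Longrightarrow> path_image p \<subseteq> {z. \<forall>w\<in>period_lattice (\<tau> a). \<rho> a \<le> norm (z - w)} \<Longrightarrow>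
          w \<in> period_lattice (\<tau> a) \<Longrightarrow> pathfinish p = pathstart p + w \<Longrightarrow>
          contour_integral p (f a) = w * g + of_real (t_coord a w) * cint (\<rho> a) (\<lambda>w. f a w * w ^ 1)"
      then show thesis by (rule that[unfolded E c_def b_def])
    qed
    show ?thesis unfolding Q_def by (rule exI[of _ g], intro conjI allI impI) (rule 1, rule 2)
  qed
  then obtain \<gamma> where Q: "\<And>a. Q a (\<gamma> a)" by metis
  have series: "(\<lambda>l. moment_C (Suc k) (Suc l) (\<tau> a) / of_nat (Suc l) * b a (Suc l)) sums (c a k - (if k = 0 then \<gamma> a else 0))" for a k
    using conjunct1[OF Q[of a, unfolded Q_def]] by (rule spec)
  have periods: "contour_integral p (f a) = w * \<gamma> a + of_real (t_coord a w) * b a 1"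
    if "valid_path p" "path_image p \<subseteq> excised_torus \<tau> \<epsilon> r a" "w \<in> period_lattice (\<tau> a)" "pathfinish p = pathstart p + w" for a p w
    using conjunct2[OF Q[of a, unfolded Q_def]] that by blast
  have \<gamma>: "\<gamma> a = (if a = j then 1 else 0)" for a
  proof -
    have "contour_integral (\<alpha> a) (f a) = 2 * of_real pi * \<i> * \<gamma> a + of_real (t_coord a (2 * of_real pi * \<i>)) * b a 1"
      using \<alpha>(1)[of a] unfolding a_cycle_def torus_cycle_def by (intro periods lattice_1) auto
    then have "2 * of_real pi * \<i> * \<gamma> a = (if a = j then 2 * of_real pi * \<i> else 0)"
      using \<alpha>(2)[of a] t_coord_periods(1)[of a] by simp
    then show ?thesis by (auto split: if_splits)
  qed
  have beta: "contour_integral (\<beta> a) (f a) = 2 * of_real pi * \<i> * \<tau> a * \<gamma> a + b a 1" for a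
  proof -
    have "contour_integral (\<beta> a) (f a) = 2 * of_real pi * \<i> * \<tau> a * \<gamma> a + of_real (t_coord a (2 * of_real pi * \<i> * \<tau> a)) * b a 1"
      using \<beta>[of a] unfolding b_cycle_def torus_cycle_def by (intro periods lattice_2) auto
    then show ?thesis using t_coord_periods(2)[of a] by simp
  qed
  have radius: "c a k = cint s (\<lambda>w. f a w / w ^ Suc k) \<and> continuous_on (sphere 0 s) (f a)"
    if s: "\<rho> a \<le> s" "s < min_length (\<tau> a) - \<rho> a" for a k s
  proof -
    obtain r0 where r0: "0 \<le> r0" "r0 < \<rho> a" "f a holomorphic_on {z. r0 < norm z \<and> norm z < min_length (\<tau> a) - \<rho> a}"
      by (rule analytic_on_annulus[OF fan \<rho>0 \<rho>D])
    have "(\<lambda>w. f a w / w ^ Suc k) holomorphic_on {z. r0 < norm z \<and> norm z < min_length (\<tau> a) - \<rho> a}"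
      using r0(1) by (intro holomorphic_intros r0(3)) auto
    then have "c a k = cint s (\<lambda>w. f a w / w ^ Suc k)"
      unfolding c_def by (rule cint_annulus) (use r0 s \<rho>0[of a] in auto)
    moreover have "continuous_on (sphere 0 s) (f a)"
      by (rule holomorphic_on_imp_continuous_on[OF holomorphic_on_subset[OF r0(3)]]) (use r0 s in auto)
    ultimately show ?thesis by blast
  qed
  \<comment> \<open>The substitution \<open>w -> \<epsilon> / w\<close> exchanges negative and
    nonnegative Laurent coefficients of the two tori. The minus sign is that of
    \<open>dz\<^sub>2 = - \<epsilon> / z\<^sub>1\<^sup>2 dz\<^sub>1\<close>.\<close>
  have b_c: "b a (Suc l) = - (\<epsilon> ^ Suc l) * c (bar a) l" for a l
  proof -
    define h where "h v = f (bar a) v / v ^ l" for v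
    have "\<rho> (bar a) \<le> r (bar a)" "r (bar a) < min_length (\<tau> (bar a)) - \<rho> (bar a)"
      using rho_le[of "bar a"] r_less[of "bar a"] by auto
    note rd = radius[OF this, of l]
    have nr: "norm \<epsilon> / \<rho> a = r (bar a)" using \<epsilon> r_pos[of "bar a"] by (simp add: \<rho>_def)
    have ncirc: "norm (circlepath 0 (\<rho> a) t) = \<rho> a" for t using \<rho>0[of a] by (simp add: norm_circlepath_0)
    have cz: "circlepath 0 (\<rho> a) t \<noteq> 0" for t using ncirc[of t] \<rho>0[of a] by auto
    have "b a (Suc l) = integral {0..1} (\<lambda>t. - (\<epsilon> ^ Suc l) * h (\<epsilon> / circlepath 0 (\<rho> a) t))"
      unfolding b_def cint_def
    proof (intro integral_cong)
      fix t
      let ?w = "circlepath 0 (\<rho> a) t"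
      show "f a ?w * ?w ^ Suc l * ?w = - (\<epsilon> ^ Suc l) * h (\<epsilon> / ?w)"
        unfolding glue[OF f \<epsilon> ncirc] h_def using cz[of t] \<epsilon>
        by (simp add: power_divide power2_eq_square field_simps)
    qed
    also have "\<dots> = - (\<epsilon> ^ Suc l) * integral {0..1} (\<lambda>t. h (\<epsilon> / circlepath 0 (\<rho> a) t))"
      by (rule integral_mult_right)
    also have "integral {0..1} (\<lambda>t. h (\<epsilon> / circlepath 0 (\<rho> a) t)) = integral {0..1} (\<lambda>t. h (circlepath 0 (r (bar a)) t))"
      unfolding nr[symmetric]
    proof (rule integral_circlepath_inversion[OF \<epsilon> \<rho>0])
      show "continuous_on (sphere 0 (norm \<epsilon> / \<rho> a)) h"
        unfolding nr h_def using r_pos[of "bar a"] rd by (intro continuous_intros) auto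
    qed
    also have "\<dots> = c (bar a) l"
    proof -
      have "circlepath 0 (r (bar a)) t \<noteq> 0" for t
        using norm_circlepath_0[of "r (bar a)" t] r_pos[of "bar a"] by auto
      then show ?thesis using rd by (simp add: cint_def h_def)
    qed
    finally show ?thesis .
  qed
  \<comment> \<open>The same weights as in the Grunsky inequality, so that the linear system for the
    nonnegative coefficients is governed by the contractions \<open>G\<close>.\<close>
  define y where "y a k = of_real (R a ^ Suc k / sqrt (real (Suc k))) * c a k" for a k
  define \<eta> where "\<eta> = \<epsilon> / of_real RR"
  interpret con: contraction G \<eta>
    using RR by (intro contraction) (simp add: \<eta>_def norm_divide)
  define u where "u = (\<lambda>a k. \<gamma> a * (of_real (R a) * unit_vec a k))"
  have sol: "(\<lambda>l. con.B a k l * y (bar a) l) sums (u a k - y a k)" for a k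
  proof -
    let ?q = "complex_of_real (R a ^ Suc k / sqrt (real (Suc k)))"
    have "(\<lambda>l. - ?q * (moment_C (Suc k) (Suc l) (\<tau> a) / of_nat (Suc l) * b a (Suc l))) sums (- ?q * (c a k - (if k = 0 then \<gamma> a else 0)))"
      by (rule sums_mult[OF series])
    also have "- ?q * (c a k - (if k = 0 then \<gamma> a else 0)) = u a k - y a k"
      by (simp add: u_def y_def right_diff_distrib)
    also have "(\<lambda>l. - ?q * (moment_C (Suc k) (Suc l) (\<tau> a) / of_nat (Suc l) * b a (Suc l))) = (\<lambda>l. con.B a k l * y (bar a) l)"
    proof
      fix l
      have gen: "- of_real (A / p) * (C / of_real (m * m) * (- (e ^ n) * d)) = of_real (A * x ^ n / (p * m)) * C * (e / of_real v) ^ n * (of_real (z ^ n / m) * d)"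
        if v: "v = x * z" "v \<noteq> 0" for A p m x z v :: real and C e d :: complex and n
      proof -
        have "of_real x * (e / of_real v) * of_real z = e" using v by simp
        then have eq: "of_real (x ^ n) * (e / of_real v) ^ n * of_real (z ^ n) = e ^ n"
          by (metis of_real_power power_mult_distrib)
        have key: "of_real (A * X / (p * m)) * C * H * (of_real (Z / m) * d) = of_real (A / p) * (C / of_real (m * m) * ((of_real X * H * of_real Z) * d))" for X Z H
          by (simp add: divide_inverse mult_ac)
        show ?thesis unfolding key eq by simp
      qed
      have 1: "R a ^ (k + l + 2) = R a ^ Suc k * R a ^ Suc l" by (simp add: power_add)
      have 2: "sqrt (real (Suc k * Suc l)) = sqrt (real (Suc k)) * sqrt (real (Suc l))" by (simp only: of_nat_mult real_sqrt_mult)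
      have 3: "(of_nat (Suc l) :: complex) = of_real (sqrt (real (Suc l)) * sqrt (real (Suc l)))"
        by (simp del: of_nat_Suc)
      have v: "RR = R a * R (bar a)" "RR \<noteq> 0" using R_prod[of a] RR(1) by auto
      show "- ?q * (moment_C (Suc k) (Suc l) (\<tau> a) / of_nat (Suc l) * b a (Suc l)) = con.B a k l * y (bar a) l"
        unfolding con.B_def
        unfolding G_def y_def \<eta>_def b_c 1 2 3 by (rule gen[OF v])
    qed
    finally show ?thesis .
  qed
  have "summable (\<lambda>k. (norm (y a k))\<^sup>2)" for a
  proof -
    \<comment> \<open>The form is analytic on the circle of radius \<open>s\<close>, which is
      strictly larger than \<open>R a\<close>. The coefficients are thus of order
      \<open>s ^ (- k)\<close>, and the rescaled ones decay geometrically.\<close>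
    define s where "s = min_length (\<tau> a) / 2"
    have s: "\<rho> a \<le> s" "s < min_length (\<tau> a) - \<rho> a" "0 < s" "R a < s"
      using \<rho>D[of a] \<rho>0[of a] R(3)[of a] by (auto simp: s_def)
    note rd = radius[OF s(1,2)]
    have "compact (f a ` sphere 0 s)" using rd by (intro compact_continuous_image) auto
    then obtain K where K: "\<And>z. z \<in> sphere 0 s \<Longrightarrow> norm (f a z) \<le> K"
      by (meson bounded_iff compact_imp_bounded imageI)
    have cK: "norm (c a k) \<le> K / s ^ k" for k
    proof -
      have "norm (cint s (\<lambda>w. f a w / w ^ Suc k)) \<le> K / s ^ k"
      proof (rule norm_cint_le)
        show "continuous_on (sphere 0 s) (\<lambda>w. f a w / w ^ Suc k)"
          using rd s by (intro continuous_intros) auto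
        show "norm (f a z / z ^ Suc k * z) \<le> K / s ^ k" if "norm z = s" for z
          using that K[of z] s by (auto simp: norm_mult norm_divide norm_power intro!: divide_right_mono)
      qed (rule s)
      then show ?thesis using rd by simp
    qed
    have K0: "0 \<le> K" using K[of "of_real s"] s norm_ge_zero[of "f a (of_real s)"] by (simp del: norm_ge_zero)
    define x where "x = R a / s"
    have x: "0 \<le> x" "x < 1" using s R(1)[of a] by (auto simp: x_def)
    have "norm (y a k) \<le> R a * K * x ^ k" for k
    proof -
      have "R a ^ Suc k / sqrt (real (Suc k)) \<le> R a ^ Suc k / 1"
        using R(1)[of a] by (intro divide_left_mono) auto
      then have "norm (y a k) \<le> R a ^ Suc k * (K / s ^ k)"
        unfolding y_def norm_mult norm_of_real using cK[of k] R(1)[of a] by (intro mult_mono) auto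
      then show ?thesis by (simp add: x_def power_divide mult_ac)
    qed
    then have le: "(norm (y a k))\<^sup>2 \<le> (R a * K)\<^sup>2 * (x\<^sup>2) ^ k" for k
      using power_mono[of "norm (y a k)" "R a * K * x ^ k" 2] by (simp add: power_mult_distrib power_mult[symmetric] mult.commute)
    have sm: "summable (\<lambda>k. (R a * K)\<^sup>2 * (x\<^sup>2) ^ k)"
      using x by (intro summable_mult summable_geometric) (simp add: power_less_one_iff)
    show ?thesis by (rule summable_comparison_test'[OF sm, of 0]) (use le in simp)
  qed
  note lim = con.truncated_solution_tendsto[OF sol this]
  have c0: "c a 0 = (if a = j then 1 else - 1) * omega \<tau> \<epsilon> (bar a) j" for a
  proof -
    \<comment> \<open>Only chains ending on torus \<open>j\<close> see a nonzero \<gamma>. This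
      fixes the parity of the number of edges, so the sign \<open>(- 1) ^ i\<close> is the same for
      all of them. The first edge is labelled \<open>a\<close>, which makes the type begin with
      \<open>bar a\<close>.\<close>
    have partial: "(\<Sum>i<M. (- 1) ^ i * chain con.B M u i a 0) =
       of_real (R a) * ((if a = j then 1 else - 1) * (\<Sum>N\<in>short_necklaces M (bar a) j. weight \<tau> \<epsilon> N))" for M
    proof -
      have ch: "chain con.B M u i a 0 = \<gamma> ((bar ^^ i) a) * (of_real (R a) * chain (MA \<epsilon>) M unit_vec i a 0)" for i
        unfolding con.B_def[abs_def] unfolding u_def chain_scale scaled_chain_0[OF \<epsilon>] \<eta>_def ..
      have "(\<Sum>i<M. (- 1) ^ i * chain con.B M u i a 0) =
        (\<Sum>i<M. if even i \<longleftrightarrow> a = j then of_real (R a) * ((if a = j then 1 else - 1) * chain (MA \<epsilon>) M unit_vec i a 0) else 0)"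
      proof (intro sum.cong refl)
        fix i
        have "(bar ^^ i) a = j \<longleftrightarrow> (even i \<longleftrightarrow> a = j)"
          using neq_iff_bar[of a j] by (auto simp: funpow_bar)
        then show "(- 1) ^ i * chain con.B M u i a 0 =
          (if even i \<longleftrightarrow> a = j then of_real (R a) * ((if a = j then 1 else - 1) * chain (MA \<epsilon>) M unit_vec i a 0) else 0)"
          unfolding ch \<gamma> by (auto simp: minus_one_power_iff)
      qed
      also have "\<dots> = (\<Sum>i | i < M \<and> (even i \<longleftrightarrow> a = j). of_real (R a) * ((if a = j then 1 else - 1) * chain (MA \<epsilon>) M unit_vec i a 0))"
        by (subst sum.inter_filter[symmetric]) auto
      also have "{i. i < M \<and> (even i \<longleftrightarrow> a = j)} = {i. i < M \<and> (even i \<longleftrightarrow> bar a \<noteq> j)}"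
        using neq_iff_bar[of "bar a" j] by auto
      finally show ?thesis by (simp add: sum_short_necklaces sum_distrib_left)
    qed
    have "(\<lambda>M. of_real (R a) * ((if a = j then 1 else - 1) * (\<Sum>N\<in>short_necklaces M (bar a) j. weight \<tau> \<epsilon> N))) \<longlonglongrightarrow>
       of_real (R a) * ((if a = j then 1 else - 1) * omega \<tau> \<epsilon> (bar a) j)"
      by (intro tendsto_intros omega_limit)
    then have "y a 0 = of_real (R a) * ((if a = j then 1 else - 1) * omega \<tau> \<epsilon> (bar a) j)"
      using LIMSEQ_unique[OF lim[of a, unfolded partial]] by blast
    then show ?thesis using R(1)[of a] by (simp add: y_def)
  qed
  have "bar a = j \<longleftrightarrow> a \<noteq> j" using neq_iff_bar[of a j] by auto
  then show ?thesis
    using beta[of a] b_c[of a 0] c0[of "bar a"] by (simp add: \<gamma>)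
qed

text \<open>Without gluing nothing is excised, so the form is an entire elliptic function on each
  torus, hence constant, and its periods are proportional to the lattice periods.\<close>

lemma degenerate_form_periods:
  assumes \<epsilon>: "\<epsilon> = 0" and f: "sewn_one_form \<tau> \<epsilon> r f"
    and \<alpha>: "a_cycle \<tau> \<epsilon> r a p" "contour_integral p (f a) = x * (2 * of_real pi * \<i>)"
    and \<beta>: "b_cycle \<tau> \<epsilon> r a p'"
  shows "contour_integral p' (f a) = x * (2 * of_real pi * \<i> * \<tau> a)"
proof -
  have E: "excised_torus \<tau> \<epsilon> r a = UNIV" by (simp add: excised_torus_def \<epsilon>)
  have "f a analytic_on UNIV" and per: "\<And>z w. w \<in> period_lattice (\<tau> a) \<Longrightarrow> f a (z + w) = f a z"
    using f unfolding sewn_one_form_def by (metis E UNIV_I)+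
  then obtain k where k: "f a = (\<lambda>_. k)"
    using entire_elliptic_constant[of "f a" a, OF analytic_imp_holomorphic] by blast
  have "k * (2 * of_real pi * \<i>) = x * (2 * of_real pi * \<i>)"
    using \<alpha> constant_contour_integral[of p k] by (simp add: a_cycle_def torus_cycle_def k)
  then have "k = x" by simp
  then show ?thesis
    using \<beta> constant_contour_integral[of p' k] by (simp add: b_cycle_def torus_cycle_def k)
qed

end

text \<open>Summability belongs to the conclusion because the infinite sum in \<open>omega\<close>
  has the intended meaning only for a convergent series.\<close>

theorem proposition4p4:
  fixes \<tau> :: "2 \<Rightarrow> complex" and \<epsilon> :: complex and r :: "2 \<Rightarrow> real" and \<Omega> :: "complex ^ 2 ^ 2"
  assumes "(\<tau> 1, \<tau> 2, \<epsilon>) \<in> sewing_domain"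
    and "sewing_radii \<tau> \<epsilon> r"
    and "is_period_matrix \<tau> \<epsilon> r \<Omega>"
  shows "(\<forall>a b. summable (omega_term \<tau> \<epsilon> a b)) \<and>
    (\<forall>a. \<Omega> $ a $ a = \<tau> a + \<epsilon> / (2 * of_real pi * \<i>) * omega \<tau> \<epsilon> a a \<and>
         \<Omega> $ a $ bar a = - (\<epsilon> / (2 * of_real pi * \<i>)) * omega \<tau> \<epsilon> a (bar a))"
proof -
  interpret sewn_tori \<tau> \<epsilon> r using assms(1,2) by unfold_locales
  obtain \<alpha> \<beta> \<nu> where cycles: "\<And>i. a_cycle \<tau> \<epsilon> r i (\<alpha> i)" "\<And>i. b_cycle \<tau> \<epsilon> r i (\<beta> i)"
    and forms: "\<And>j. sewn_one_form \<tau> \<epsilon> r (\<nu> j)"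
    and norm: "\<And>i j. contour_integral (\<alpha> i) (\<nu> j i) = (if i = j then 2 * of_real pi * \<i> else 0)"
    and \<Omega>: "\<And>i j. \<Omega> $ i $ j = 1 / (2 * of_real pi * \<i>) * contour_integral (\<beta> i) (\<nu> j i)"
    using assms(3) unfolding is_period_matrix_def normalized_forms_def by blast
  have b_period: "contour_integral (\<beta> a) (\<nu> j a) = (if a = j then 2 * of_real pi * \<i> * \<tau> a else 0)
      - \<epsilon> * ((if a = j then - 1 else 1) * omega \<tau> \<epsilon> a j)" for a j
  proof (cases "\<epsilon> = 0")
    case True
    have "contour_integral (\<alpha> a) (\<nu> j a) = (if a = j then 1 else 0) * (2 * of_real pi * \<i>)"
      using norm[of a j] by simp
    from degenerate_form_periods[OF True forms cycles(1) this cycles(2)] show ?thesis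
      using True by simp
  next
    case False
    then show ?thesis by (rule sewn_form_periods[OF _ forms cycles(1) norm cycles(2)])
  qed
  have "\<Omega> $ a $ a = \<tau> a + \<epsilon> / (2 * of_real pi * \<i>) * omega \<tau> \<epsilon> a a" for a
    unfolding \<Omega> b_period by (simp add: field_simps)
  moreover have "\<Omega> $ a $ bar a = - (\<epsilon> / (2 * of_real pi * \<i>)) * omega \<tau> \<epsilon> a (bar a)" for a
    unfolding \<Omega> b_period by simp
  ultimately show ?thesis using summable_omega by blast
qed

end
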